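(* Let $H$ be a compact Hopf $*$-algebra over $\mathbb{C}$ with integral $\int$ normalized by $\int(1_H)=1$. Let $g\star_c f:=\int(fS(g_1))\,g_2$ denote the convolution product on $H$, and let $\|a\|_{L^2}:=\big(\int(aa^* )\big)^{1/2}$. Then for all $f,g\in H$, $$\|f\star_c g\|_{L^2}\le\|f\|_{L^2}\cdot\|g\|_{L^2}.$$
   Context: $S$ is the antipode of $H$; Sweedler's notation is used for coproducts and coactions. A compact Hopf $*$-algebra is a co-semisimple Hopf algebra $H$ over $\mathbb{C}$ (every finite-dimensional comodule is a direct sum of simple ones) with an involutive antilinear algebra anti-homomorphism $^*:H\to H$ (compatible with the coproduct, as in any Hopf $*$-algebra: $\Delta(h^* )=h_1^*\otimes h_2^*$), such that every simple right comodule $V$, $\delta(v)=v_0\otimes v_1$, is unitarizable: it has a scalar product $\langle\cdot,\cdot\rangle$ with $\langle v_0,w\rangle S(v_1)=\langle v,w_0\rangle w_1^*$ for all $v,w\in V$. The integral on $H$ is a (two-sided) invariant linear functional, $x_1\int(x_2)=\int(x)1_H=\int(x_1)x_2$; with $\int(1_H)=1$ it is positive definite, so $\langle a,b\rangle:=\int(ab^* )$ is a scalar product on $H$ and $\|\cdot\|_{L^2}$ is the associated norm. *)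

theory Defs
  imports Complex_Main "HOL-Library.Poly_Mapping"
begin

section \<open>Complex vector spaces and algebras\<close>

class scaleC =
  fixes scaleC :: "complex \<Rightarrow> 'a \<Rightarrow> 'a" (infixr "*\<^sub>C" 75)

class complex_vector = scaleC + ab_group_add +
  assumes scaleC_add_right: "a *\<^sub>C (x + y) = a *\<^sub>C x + a *\<^sub>C y"
    and scaleC_add_left: "(a + b) *\<^sub>C x = a *\<^sub>C x + b *\<^sub>C x"
    and scaleC_scaleC: "a *\<^sub>C b *\<^sub>C x = (a * b) *\<^sub>C x"
    and scaleC_one: "1 *\<^sub>C x = x"

class complex_algebra_1 = complex_vector + ring_1 +
  assumes mult_scaleC_left: "(a *\<^sub>C x) * y = a *\<^sub>C (x * y)"
    and mult_scaleC_right: "x * (a *\<^sub>C y) = a *\<^sub>C (x * y)"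

global_interpretation cv: vector_space "scaleC :: complex \<Rightarrow> 'a \<Rightarrow> 'a::complex_vector"
  by standard (rule scaleC_add_right scaleC_add_left scaleC_scaleC scaleC_one)+

abbreviation clinear :: "('a::complex_vector \<Rightarrow> 'b::complex_vector) \<Rightarrow> bool" where
  "clinear \<equiv> Vector_Spaces.linear scaleC scaleC"

instantiation complex :: complex_algebra_1
begin
definition scaleC_complex :: "complex \<Rightarrow> complex \<Rightarrow> complex" where
  [simp]: "scaleC_complex c z = c * z"
instance by standard (simp_all add: algebra_simps)
end

instantiation poly_mapping :: (type, complex_vector) complex_vector
begin
definition scaleC_poly_mapping :: "complex \<Rightarrow> ('a \<Rightarrow>\<^sub>0 'b) \<Rightarrow> 'a \<Rightarrow>\<^sub>0 'b" where
  "scaleC_poly_mapping c = Poly_Mapping.map (scaleC c)"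

lemma lookup_scaleC [simp]:
  "Poly_Mapping.lookup (c *\<^sub>C p) k = c *\<^sub>C Poly_Mapping.lookup p k"
  unfolding scaleC_poly_mapping_def by (transfer fixing: c k) (auto simp: when_def)

instance
  by standard (auto intro!: poly_mapping_eqI
      simp: lookup_add scaleC_add_right scaleC_add_left scaleC_scaleC scaleC_one)
end


section \<open>The tensor product over the complex numbers\<close>

text \<open>The free complex vector space on pairs is divided by the span of the bilinearity relations.\<close>

definition tensor_relators ::
    "(('a::complex_vector \<times> 'b::complex_vector) \<Rightarrow>\<^sub>0 complex) set" where
  "tensor_relators =
     {Poly_Mapping.single (a + a', b) 1 - Poly_Mapping.single (a, b) 1
        - Poly_Mapping.single (a', b) 1 | a a' b. True}
   \<union> {Poly_Mapping.single (a, b + b') 1 - Poly_Mapping.single (a, b) 1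
        - Poly_Mapping.single (a, b') 1 | a b b'. True}
   \<union> {Poly_Mapping.single (c *\<^sub>C a, b) 1 - Poly_Mapping.single (a, b) c | c a b. True}
   \<union> {Poly_Mapping.single (a, c *\<^sub>C b) 1 - Poly_Mapping.single (a, b) c | c a b. True}"

definition tensor_eq ::
    "(('a::complex_vector \<times> 'b::complex_vector) \<Rightarrow>\<^sub>0 complex) \<Rightarrow>
     (('a \<times> 'b) \<Rightarrow>\<^sub>0 complex) \<Rightarrow> bool" where
  "tensor_eq p q \<longleftrightarrow> p - q \<in> cv.span tensor_relators"

quotient_type (overloaded) ('a, 'b) tensor =
  "('a::complex_vector \<times> 'b::complex_vector) \<Rightarrow>\<^sub>0 complex" / tensor_eq
proof (rule equivpI)
  show "reflp tensor_eq"
    by (auto simp: reflp_def tensor_eq_def cv.span_zero)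
  show "symp tensor_eq"
  proof (rule sympI)
    show "tensor_eq q p" if "tensor_eq p q" for p q
      using cv.span_neg[of "p - q" tensor_relators] that by (simp add: tensor_eq_def)
  qed
  show "transp tensor_eq"
  proof (rule transpI)
    show "tensor_eq p r" if "tensor_eq p q" "tensor_eq q r" for p q r
      using cv.span_add[of "p - q" tensor_relators "q - r"] that by (simp add: tensor_eq_def)
  qed
qed

instantiation tensor :: (complex_vector, complex_vector) complex_vector
begin

lift_definition zero_tensor :: "('a, 'b) tensor" is 0 .

lift_definition plus_tensor :: "('a, 'b) tensor \<Rightarrow> ('a, 'b) tensor \<Rightarrow> ('a, 'b) tensor" is "(+)"
proof -
  fix p q r s :: "('a \<times> 'b) \<Rightarrow>\<^sub>0 complex"
  assume "tensor_eq p q" "tensor_eq r s"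
  then show "tensor_eq (p + r) (q + s)"
    using cv.span_add[of "p - q" tensor_relators "r - s"]
    by (simp add: tensor_eq_def add_diff_add)
qed

lift_definition minus_tensor :: "('a, 'b) tensor \<Rightarrow> ('a, 'b) tensor \<Rightarrow> ('a, 'b) tensor" is "(-)"
proof -
  fix p q r s :: "('a \<times> 'b) \<Rightarrow>\<^sub>0 complex"
  assume "tensor_eq p q" "tensor_eq r s"
  moreover have "(p - r) - (q - s) = (p - q) - (r - s)" by simp
  ultimately show "tensor_eq (p - r) (q - s)"
    using cv.span_diff[of "p - q" tensor_relators "r - s"] by (simp only: tensor_eq_def)
qed

lift_definition uminus_tensor :: "('a, 'b) tensor \<Rightarrow> ('a, 'b) tensor" is uminus
proof -
  fix p q :: "('a \<times> 'b) \<Rightarrow>\<^sub>0 complex"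
  assume "tensor_eq p q"
  then show "tensor_eq (- p) (- q)"
    using cv.span_neg[of "p - q" tensor_relators] by (simp add: tensor_eq_def)
qed

lift_definition scaleC_tensor :: "complex \<Rightarrow> ('a, 'b) tensor \<Rightarrow> ('a, 'b) tensor" is scaleC
proof -
  fix c and p q :: "('a \<times> 'b) \<Rightarrow>\<^sub>0 complex"
  assume "tensor_eq p q"
  then show "tensor_eq (c *\<^sub>C p) (c *\<^sub>C q)"
    using cv.span_scale[of "p - q" tensor_relators c]
    by (simp add: tensor_eq_def cv.scale_right_diff_distrib)
qed

lemma tensor_eq_refl: "tensor_eq p p"
  by (simp add: tensor_eq_def cv.span_zero)

instance
  by (standard; transfer)
     (simp_all add: tensor_eq_refl algebra_simps scaleC_add_right scaleC_add_left
       scaleC_scaleC scaleC_one)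

end

lift_definition pure_tensor :: "'a::complex_vector \<Rightarrow> 'b::complex_vector \<Rightarrow> ('a, 'b) tensor"
    (infixr "\<otimes>" 72)
  is "\<lambda>a b. Poly_Mapping.single (a, b) 1" .

lemma tensor_add_left: "(a + a') \<otimes> b = a \<otimes> b + a' \<otimes> b"
proof (transfer)
  fix a a' :: 'a and b :: 'b
  have "Poly_Mapping.single (a + a', b) 1 - Poly_Mapping.single (a, b) 1
      - Poly_Mapping.single (a', b) (1::complex) \<in> tensor_relators"
    unfolding tensor_relators_def by blast
  then show "tensor_eq (Poly_Mapping.single (a + a', b) 1)
      (Poly_Mapping.single (a, b) 1 + Poly_Mapping.single (a', b) 1)"
    unfolding tensor_eq_def by (simp add: cv.span_base diff_diff_eq)
qed

lemma tensor_add_right: "a \<otimes> (b + b') = a \<otimes> b + a \<otimes> b'"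
proof (transfer)
  fix a :: 'a and b b' :: 'b
  have "Poly_Mapping.single (a, b + b') 1 - Poly_Mapping.single (a, b) 1
      - Poly_Mapping.single (a, b') (1::complex) \<in> tensor_relators"
    unfolding tensor_relators_def by blast
  then show "tensor_eq (Poly_Mapping.single (a, b + b') 1)
      (Poly_Mapping.single (a, b) 1 + Poly_Mapping.single (a, b') 1)"
    unfolding tensor_eq_def by (simp add: cv.span_base diff_diff_eq)
qed

lemma scaleC_single: "c *\<^sub>C Poly_Mapping.single k d = Poly_Mapping.single k (c *\<^sub>C d)"
  by (rule poly_mapping_eqI) (auto simp: lookup_single when_def)

lemma tensor_scaleC_left: "(c *\<^sub>C a) \<otimes> b = c *\<^sub>C (a \<otimes> b)"
proof (transfer)
  fix c and a :: 'a and b :: 'b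
  have "Poly_Mapping.single (c *\<^sub>C a, b) 1 - Poly_Mapping.single (a, b) c \<in> tensor_relators"
    unfolding tensor_relators_def by blast
  then show "tensor_eq (Poly_Mapping.single (c *\<^sub>C a, b) 1)
      (c *\<^sub>C Poly_Mapping.single (a, b) 1)"
    unfolding tensor_eq_def by (simp add: cv.span_base scaleC_single)
qed

lemma tensor_scaleC_right: "a \<otimes> (c *\<^sub>C b) = c *\<^sub>C (a \<otimes> b)"
proof (transfer)
  fix c and a :: 'a and b :: 'b
  have "Poly_Mapping.single (a, c *\<^sub>C b) 1 - Poly_Mapping.single (a, b) c \<in> tensor_relators"
    unfolding tensor_relators_def by blast
  then show "tensor_eq (Poly_Mapping.single (a, c *\<^sub>C b) 1)
      (c *\<^sub>C Poly_Mapping.single (a, b) 1)"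
    unfolding tensor_eq_def by (simp add: cv.span_base scaleC_single)
qed


section \<open>Sweedler notation\<close>

definition tensor_of_list :: "('a::complex_vector \<times> 'b::complex_vector) list \<Rightarrow> ('a, 'b) tensor"
  where "tensor_of_list l = (\<Sum>(a, b)\<leftarrow>l. a \<otimes> b)"

text \<open>
  The value of the expression F(t_1, t_2), where t = t_1 \<otimes> t_2 in Sweedler notation: the
  sum of the F(a_i, b_i) for a representation of t as the sum of the a_i \<otimes> b_i, with all
  a_i in V. Evaluating on lists rather than by a linear extension makes the notation available
  for maps that are conjugate linear in both arguments, as needed for the involution. Lemma
  \<open>sweedler_on_eq\<close> below shows independence of the representation.
\<close>

definition sweedler_on ::
    "'a::complex_vector set \<Rightarrow> ('a \<Rightarrow> 'b::complex_vector \<Rightarrow> 'c::ab_group_add) \<Rightarrow>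
     ('a, 'b) tensor \<Rightarrow> 'c" where
  "sweedler_on V F t =
     (let l = (SOME l. fst ` set l \<subseteq> V \<and> t = tensor_of_list l) in \<Sum>(a, b)\<leftarrow>l. F a b)"

abbreviation sweedler ::
    "('a::complex_vector \<Rightarrow> 'b::complex_vector \<Rightarrow> 'c::ab_group_add) \<Rightarrow> ('a, 'b) tensor \<Rightarrow> 'c"
  where "sweedler \<equiv> sweedler_on UNIV"

definition tensor_span :: "'a::complex_vector set \<Rightarrow> ('a, 'b::complex_vector) tensor set" where
  "tensor_span V = cv.span {v \<otimes> h | v h. v \<in> V}"

definition balanced_on ::
    "'a::complex_vector set \<Rightarrow> ('a \<Rightarrow> 'b::complex_vector \<Rightarrow> 'c::ab_group_add) \<Rightarrow> bool" where
  "balanced_on V F \<longleftrightarrow>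
     (\<forall>a\<in>V. \<forall>a'\<in>V. \<forall>b. F (a + a') b = F a b + F a' b) \<and>
     (\<forall>a\<in>V. \<forall>b b'. F a (b + b') = F a b + F a b') \<and>
     (\<forall>a\<in>V. \<forall>b c. F (c *\<^sub>C a) b = F a (c *\<^sub>C b))"

lemma tensor_span_representable:
  assumes V: "cv.subspace V" and t: "t \<in> tensor_span V"
  shows "\<exists>l. fst ` set l \<subseteq> V \<and> t = tensor_of_list l"
  using t unfolding tensor_span_def
proof (induction rule: cv.span_induct_alt)
  case base
  show ?case by (rule exI[of _ "[]"]) (simp add: tensor_of_list_def)
next
  case (step c x y)
  then obtain v h l where x: "x = v \<otimes> h" "v \<in> V" and l: "fst ` set l \<subseteq> V" "y = tensor_of_list l"
    by blast
  show ?case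
    using x l V
    by (intro exI[of _ "(c *\<^sub>C v, h) # l"])
       (auto simp: tensor_of_list_def tensor_scaleC_left cv.subspace_scale)
qed

lemma tensor_span_UNIV: "(t :: ('a::complex_vector, 'b::complex_vector) tensor) \<in> tensor_span UNIV"
proof -
  have "abs_tensor p \<in> tensor_span UNIV" for p :: "('a \<times> 'b) \<Rightarrow>\<^sub>0 complex"
  proof (induction p rule: Poly_Mapping.update_induct)
    case const
    then show ?case
      using cv.span_zero by (simp add: tensor_span_def zero_tensor.abs_eq[symmetric])
  next
    case (update f k v)
    obtain a b where k: "k = (a, b)" by force
    have "Poly_Mapping.update k v f = f + Poly_Mapping.single k v"
      using update.hyps
      by (intro poly_mapping_eqI)
         (auto simp: lookup_update lookup_add lookup_single when_def in_keys_iff)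
    then have "abs_tensor (Poly_Mapping.update k v f) =
        abs_tensor f + abs_tensor (Poly_Mapping.single k v)"
      by (simp add: plus_tensor.abs_eq)
    moreover have "abs_tensor (Poly_Mapping.single k v) = v *\<^sub>C (a \<otimes> b)"
      unfolding k by (simp add: pure_tensor.abs_eq scaleC_tensor.abs_eq scaleC_single)
    moreover have "v *\<^sub>C (a \<otimes> b) \<in> tensor_span UNIV"
      unfolding tensor_span_def by (auto intro!: cv.span_base simp: tensor_scaleC_left[symmetric])
    ultimately show ?case
      using update.IH by (simp add: tensor_span_def cv.span_add)
  qed
  then show ?thesis by (rule tensor.abs_induct)
qed

lemma balanced_well_defined:
  fixes F :: "'a::complex_vector \<Rightarrow> 'b::complex_vector \<Rightarrow> 'c::ab_group_add"
  assumes F: "balanced_on UNIV F" and l: "tensor_of_list l = tensor_of_list l'"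
  shows "(\<Sum>(a, b)\<leftarrow>l. F a b) = (\<Sum>(a, b)\<leftarrow>l'. F a b)"
proof -
  define G where "G k c = (case k of (a, b) \<Rightarrow> F (c *\<^sub>C a) b)" for k c
  define E where "E p = (\<Sum>k\<in>Poly_Mapping.keys p. G k (Poly_Mapping.lookup p k))" for p
  from F have add1: "F (a + a') b = F a b + F a' b" and add2: "F a (b + b') = F a b + F a b'"
    and bal: "F (c *\<^sub>C a) b = F a (c *\<^sub>C b)" for a a' b b' c
    by (auto simp: balanced_on_def)
  have G0: "G k 0 = 0" for k
    using add1[of 0 0] by (cases k) (simp add: G_def)
  have Gadd: "G k (c + d) = G k c + G k d" for k c d
    by (cases k) (simp add: G_def cv.scale_left_distrib add1)
  have E_sup: "E p = (\<Sum>k\<in>K. G k (Poly_Mapping.lookup p k))"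
    if "finite K" "Poly_Mapping.keys p \<subseteq> K" for p K
    unfolding E_def using that
    by (intro sum.mono_neutral_left) (auto simp: G0 in_keys_iff)
  have E_add: "E (p + q) = E p + E q" for p q
  proof -
    let ?K = "Poly_Mapping.keys p \<union> Poly_Mapping.keys q"
    have "Poly_Mapping.keys (p + q) \<subseteq> ?K" by (rule Poly_Mapping.keys_add)
    then show ?thesis
      by (simp add: E_sup[of ?K] lookup_add Gadd sum.distrib)
  qed
  have E0: "E 0 = 0" by (simp add: E_def)
  have E_diff: "E (p - q) = E p - E q" for p q
    using E_add[of "p - q" q] by (simp add: algebra_simps)
  have E_single: "E (Poly_Mapping.single (a, b) c) = F (c *\<^sub>C a) b" for a b c
    using E_sup[of "{(a, b)}" "Poly_Mapping.single (a, b) c"] by (simp add: G_def)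
  have sc_diff: "c *\<^sub>C (p - q) = c *\<^sub>C p - c *\<^sub>C q"
    for c and p q :: "('a \<times> 'b) \<Rightarrow>\<^sub>0 complex"
    by (rule cv.scale_right_diff_distrib)
  have rel: "E (c *\<^sub>C r) = 0" if "r \<in> tensor_relators" for c r
    using that unfolding tensor_relators_def
    by (auto simp: sc_diff E_diff scaleC_single E_single cv.scale_right_distrib add1 add2
        scaleC_scaleC bal mult.commute)
  have E_span: "E p = 0" if "p \<in> cv.span tensor_relators" for p
    using that by (induction rule: cv.span_induct_alt) (simp_all add: E0 E_add rel)
  define R where "R l = (\<Sum>k\<leftarrow>l. Poly_Mapping.single k (1::complex))" for l :: "('a \<times> 'b) list"
  have absR: "tensor_of_list l = abs_tensor (R l)" for l :: "('a \<times> 'b) list"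
    by (induction l)
       (auto simp: tensor_of_list_def R_def zero_tensor_def pure_tensor.abs_eq plus_tensor.abs_eq)
  have ER: "E (R l) = (\<Sum>(a, b)\<leftarrow>l. F a b)" for l
    by (induction l) (auto simp: R_def E0 E_add E_single scaleC_one)
  have "tensor_eq (R l) (R l')"
    using l unfolding absR by (simp add: tensor.abs_eq_iff)
  then have "E (R l) = E (R l')"
    using E_span[of "R l - R l'"] by (simp add: tensor_eq_def E_diff)
  then show ?thesis by (simp add: ER)
qed

lemma balanced_well_defined_on:
  fixes F :: "'a::complex_vector \<Rightarrow> 'b::complex_vector \<Rightarrow> 'c::ab_group_add"
  assumes V: "cv.subspace V" and F: "balanced_on V F"
    and l: "tensor_of_list l = tensor_of_list l'" "fst ` set l \<subseteq> V" "fst ` set l' \<subseteq> V"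
  shows "(\<Sum>(a, b)\<leftarrow>l. F a b) = (\<Sum>(a, b)\<leftarrow>l'. F a b)"
proof -
  interpret vector_space_pair "scaleC :: complex \<Rightarrow> 'a \<Rightarrow> 'a" "scaleC :: complex \<Rightarrow> 'a \<Rightarrow> 'a" ..
  obtain P :: "'a \<Rightarrow> 'a" where P: "P ` UNIV \<subseteq> V" "clinear P" "\<forall>v\<in>V. P v = v"
    using linear_exists_left_inverse_on[of "\<lambda>x. x" V] V cv.linear_ident by (auto simp: inj_on_def)
  interpret P: Vector_Spaces.linear scaleC scaleC P by (rule P(2))
  define F' where "F' a b = F (P a) b" for a b
  have PV: "P a \<in> V" for a using P(1) by blast
  have "balanced_on UNIV F'"
    using F PV unfolding balanced_on_def F'_def by (auto simp: P.add P.scale)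
  moreover have "(\<Sum>(a, b)\<leftarrow>l. F a b) = (\<Sum>(a, b)\<leftarrow>l. F' a b)" if "fst ` set l \<subseteq> V" for l
    using that P(3) by (intro arg_cong[of _ _ sum_list] map_cong) (auto simp: F'_def)
  ultimately show ?thesis
    using balanced_well_defined[of F' l l'] l by simp
qed

lemma sweedler_on_eq:
  assumes "cv.subspace V" "balanced_on V F" "fst ` set l \<subseteq> V"
  shows "sweedler_on V F (tensor_of_list l) = (\<Sum>(a, b)\<leftarrow>l. F a b)"
proof -
  define l' where
    "l' = (SOME l'. fst ` set l' \<subseteq> V \<and> tensor_of_list l = tensor_of_list l')"
  have "fst ` set l' \<subseteq> V \<and> tensor_of_list l = tensor_of_list l'"
    unfolding l'_def by (rule someI[of _ l]) (simp add: assms)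
  then show ?thesis
    using balanced_well_defined_on[OF assms(1,2), of l l'] assms(3)
    unfolding sweedler_on_def Let_def l'_def[symmetric] by simp
qed


section \<open>Hopf algebras and Hopf star-algebras\<close>

locale hopf_algebra =
  fixes \<Delta> :: "'h::complex_algebra_1 \<Rightarrow> ('h, 'h) tensor"
    and \<epsilon> :: "'h \<Rightarrow> complex"
    and S :: "'h \<Rightarrow> 'h"
  assumes comult_linear: "clinear \<Delta>"
    and comult_coassoc:
      "sweedler (\<lambda>x1 x2. sweedler (\<lambda>x11 x12. x11 \<otimes> x12 \<otimes> x2) (\<Delta> x1)) (\<Delta> x) =
       sweedler (\<lambda>x1 x2. x1 \<otimes> \<Delta> x2) (\<Delta> x)"
    and counit_linear: "clinear \<epsilon>"
    and counit_left: "sweedler (\<lambda>x1 x2. \<epsilon> x1 *\<^sub>C x2) (\<Delta> x) = x"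
    and counit_right: "sweedler (\<lambda>x1 x2. \<epsilon> x2 *\<^sub>C x1) (\<Delta> x) = x"
    and comult_one: "\<Delta> 1 = 1 \<otimes> 1"
    and comult_mult:
      "\<Delta> (x * y) =
       sweedler (\<lambda>x1 x2. sweedler (\<lambda>y1 y2. (x1 * y1) \<otimes> (x2 * y2)) (\<Delta> y)) (\<Delta> x)"
    and counit_one: "\<epsilon> 1 = 1"
    and counit_mult: "\<epsilon> (x * y) = \<epsilon> x * \<epsilon> y"
    and antipode_linear: "clinear S"
    and antipode_left: "sweedler (\<lambda>x1 x2. S x1 * x2) (\<Delta> x) = \<epsilon> x *\<^sub>C 1"
    and antipode_right: "sweedler (\<lambda>x1 x2. x1 * S x2) (\<Delta> x) = \<epsilon> x *\<^sub>C 1"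

locale hopf_star_algebra = hopf_algebra \<Delta> \<epsilon> S
  for \<Delta> :: "'h::complex_algebra_1 \<Rightarrow> ('h, 'h) tensor" and \<epsilon> S +
  fixes star :: "'h \<Rightarrow> 'h"
  assumes star_add: "star (x + y) = star x + star y"
    and star_scaleC: "star (c *\<^sub>C x) = cnj c *\<^sub>C star x"
    and star_mult: "star (x * y) = star y * star x"
    and star_star: "star (star x) = x"
    and comult_star: "\<Delta> (star x) = sweedler (\<lambda>x1 x2. star x1 \<otimes> star x2) (\<Delta> x)"


section \<open>Right comodules\<close>

text \<open>
  The underlying space of a comodule is a subspace V of a type; the values of the coaction
  outside V are irrelevant.
\<close>

definition right_comodule ::
    "('h::complex_algebra_1 \<Rightarrow> ('h, 'h) tensor) \<Rightarrow> ('h \<Rightarrow> complex) \<Rightarrow>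
     'v::complex_vector set \<Rightarrow> ('v \<Rightarrow> ('v, 'h) tensor) \<Rightarrow> bool" where
  "right_comodule \<Delta> \<epsilon> V \<delta> \<longleftrightarrow>
     cv.subspace V \<and>
     (\<forall>v\<in>V. \<forall>w\<in>V. \<delta> (v + w) = \<delta> v + \<delta> w) \<and>
     (\<forall>c. \<forall>v\<in>V. \<delta> (c *\<^sub>C v) = c *\<^sub>C \<delta> v) \<and>
     (\<forall>v\<in>V. \<delta> v \<in> tensor_span V) \<and>
     (\<forall>v\<in>V. sweedler_on V (\<lambda>v0 v1. sweedler_on V (\<lambda>v00 v01. v00 \<otimes> v01 \<otimes> v1) (\<delta> v0)) (\<delta> v) =
             sweedler_on V (\<lambda>v0 v1. v0 \<otimes> \<Delta> v1) (\<delta> v)) \<and>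
     (\<forall>v\<in>V. sweedler_on V (\<lambda>v0 v1. \<epsilon> v1 *\<^sub>C v0) (\<delta> v) = v)"

definition subcomodule ::
    "'v::complex_vector set \<Rightarrow> 'v set \<Rightarrow> ('v \<Rightarrow> ('v, 'h::complex_algebra_1) tensor) \<Rightarrow> bool" where
  "subcomodule U V \<delta> \<longleftrightarrow> cv.subspace U \<and> U \<subseteq> V \<and> (\<forall>u\<in>U. \<delta> u \<in> tensor_span U)"

definition simple_right_comodule ::
    "('h::complex_algebra_1 \<Rightarrow> ('h, 'h) tensor) \<Rightarrow> ('h \<Rightarrow> complex) \<Rightarrow>
     'v::complex_vector set \<Rightarrow> ('v \<Rightarrow> ('v, 'h) tensor) \<Rightarrow> bool" where
  "simple_right_comodule \<Delta> \<epsilon> V \<delta> \<longleftrightarrow>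
     right_comodule \<Delta> \<epsilon> V \<delta> \<and> V \<noteq> {0} \<and> (\<forall>U. subcomodule U V \<delta> \<longrightarrow> U = {0} \<or> U = V)"

definition finite_dimensional :: "'v::complex_vector set \<Rightarrow> bool" where
  "finite_dimensional V \<longleftrightarrow> (\<exists>B. finite B \<and> V = cv.span B)"

definition direct_sum_of_simples ::
    "('h::complex_algebra_1 \<Rightarrow> ('h, 'h) tensor) \<Rightarrow> ('h \<Rightarrow> complex) \<Rightarrow>
     'v::complex_vector set \<Rightarrow> ('v \<Rightarrow> ('v, 'h) tensor) \<Rightarrow> bool" where
  "direct_sum_of_simples \<Delta> \<epsilon> V \<delta> \<longleftrightarrow>
     (\<exists>(n::nat) U.
        (\<forall>i<n. subcomodule (U i) V \<delta> \<and> simple_right_comodule \<Delta> \<epsilon> (U i) \<delta>) \<and>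
        (\<forall>v\<in>V. \<exists>!x. (\<forall>i<n. x i \<in> U i) \<and> (\<forall>i\<ge>n. x i = 0) \<and> v = (\<Sum>i<n. x i)))"

definition scalar_product_on ::
    "'v::complex_vector set \<Rightarrow> ('v \<Rightarrow> 'v \<Rightarrow> complex) \<Rightarrow> bool" where
  "scalar_product_on V ip \<longleftrightarrow>
     (\<forall>u\<in>V. \<forall>v\<in>V. \<forall>w\<in>V. ip (u + v) w = ip u w + ip v w) \<and>
     (\<forall>c. \<forall>v\<in>V. \<forall>w\<in>V. ip (c *\<^sub>C v) w = c * ip v w) \<and>
     (\<forall>v\<in>V. \<forall>w\<in>V. ip w v = cnj (ip v w)) \<and>
     (\<forall>v\<in>V. v \<noteq> 0 \<longrightarrow> Re (ip v v) > 0)"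

definition unitarizable ::
    "('h::complex_algebra_1 \<Rightarrow> 'h) \<Rightarrow> ('h \<Rightarrow> 'h) \<Rightarrow>
     'v::complex_vector set \<Rightarrow> ('v \<Rightarrow> ('v, 'h) tensor) \<Rightarrow> bool" where
  "unitarizable S star V \<delta> \<longleftrightarrow>
     (\<exists>ip. scalar_product_on V ip \<and>
        (\<forall>v\<in>V. \<forall>w\<in>V.
           sweedler_on V (\<lambda>v0 v1. ip v0 w *\<^sub>C S v1) (\<delta> v) =
           sweedler_on V (\<lambda>w0 w1. ip v w0 *\<^sub>C star w1) (\<delta> w)))"

text \<open>
  HOL cannot quantify over types inside a definition. Comodules are therefore taken on subspaces
  of the countable-dimensional space \<open>nat \<Rightarrow>\<^sub>0 complex\<close>. Every comodule of finite dimension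
  is isomorphic to one of these, and simple comodules are of finite dimension by the fundamental
  theorem on comodules, so nothing is lost.
\<close>

type_synonym universe = "nat \<Rightarrow>\<^sub>0 complex"

locale compact_hopf_star_algebra = hopf_star_algebra \<Delta> \<epsilon> S star
  for \<Delta> :: "'h::complex_algebra_1 \<Rightarrow> ('h, 'h) tensor" and \<epsilon> S star +
  assumes cosemisimple:
      "\<And>(V :: universe set) \<delta>. right_comodule \<Delta> \<epsilon> V \<delta> \<Longrightarrow> finite_dimensional V \<Longrightarrow>
         direct_sum_of_simples \<Delta> \<epsilon> V \<delta>"
    and simple_unitarizable:
      "\<And>(V :: universe set) \<delta>. simple_right_comodule \<Delta> \<epsilon> V \<delta> \<Longrightarrow> unitarizable S star V \<delta>"


section \<open>Integral, convolution and norm\<close>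

definition hopf_integral ::
    "('h::complex_algebra_1 \<Rightarrow> ('h, 'h) tensor) \<Rightarrow> ('h \<Rightarrow> complex) \<Rightarrow> bool" where
  "hopf_integral \<Delta> \<phi> \<longleftrightarrow>
     clinear \<phi> \<and>
     (\<forall>x. sweedler (\<lambda>x1 x2. \<phi> x2 *\<^sub>C x1) (\<Delta> x) = \<phi> x *\<^sub>C 1) \<and>
     (\<forall>x. sweedler (\<lambda>x1 x2. \<phi> x1 *\<^sub>C x2) (\<Delta> x) = \<phi> x *\<^sub>C 1)"

definition convolution ::
    "('h::complex_algebra_1 \<Rightarrow> ('h, 'h) tensor) \<Rightarrow> ('h \<Rightarrow> 'h) \<Rightarrow> ('h \<Rightarrow> complex) \<Rightarrow>
     'h \<Rightarrow> 'h \<Rightarrow> 'h" where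
  "convolution \<Delta> S \<phi> g f = sweedler (\<lambda>g1 g2. \<phi> (f * S g1) *\<^sub>C g2) (\<Delta> g)"

text \<open>
  The integral of \<open>a * star a\<close> is a nonnegative real for the normalized integral on a compact
  Hopf star-algebra; \<open>Re\<close> only serves to obtain a value of type real.
\<close>

definition L2_norm ::
    "('h::complex_algebra_1 \<Rightarrow> 'h) \<Rightarrow> ('h \<Rightarrow> complex) \<Rightarrow> 'h \<Rightarrow> real" where
  "L2_norm star \<phi> a = sqrt (Re (\<phi> (a * star a)))"

end

theory Submission
  imports Defs
begin

text \<open>
  Every element of the algebra is a linear combination of coefficients of a unitary
  corepresentation \<open>u\<close>, that is, \<open>S (u i j) = star (u j i)\<close>. Left invariance of the integral
  gives, for unitary \<open>u\<close> and \<open>v\<close>,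
  \<open>(\<Sum>k. \<langle>v p q, u k i\<rangle> u k j) = (\<Sum>r. \<langle>v r q, u j i\<rangle> v p r)\<close>, so that convolution with f can also be
  computed from the coproduct of g. As the coproduct is isometric, the operator \<open>R f\<close> of
  convolution with f has norm at most \<open>\<parallel>f'\<parallel>\<close>, where \<open>f' = star (S f)\<close> and \<open>R f'\<close> is the adjoint of
  \<open>R f\<close>. Now \<open>R f' R f = R h\<close> with \<open>h = R f' f\<close> and \<open>h' = h\<close>, hence
  \<open>\<parallel>R f\<parallel>\<^sup>2 = \<parallel>R h\<parallel> \<le> \<parallel>h\<parallel> = \<parallel>R f' f\<parallel> \<le> \<parallel>R f\<parallel> \<parallel>f\<parallel>\<close>, which gives \<open>\<parallel>R f\<parallel> \<le> \<parallel>f\<parallel>\<close>.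
  Nonnegativity of the form comes from unitarizability of the corepresentation conjugate to \<open>u\<close>.
\<close>

section \<open>Tensors\<close>

text \<open>The obstacle is that the integral need not be a trace: the norms of f' and f differ in
  general, so Cauchy-Schwarz on the coproduct yields the inequality with the wrong norm. That
  estimate still serves twice: it makes the operator norm of \<open>R f\<close> finite, and it has
  the right norm at elements fixed by the prime. Passing through \<open>R f' R f\<close> is the
  C*-identity, and finiteness of the operator norm is what allows one factor of it to be cancelled.
  A second obstacle is that \<open>u\<close> may be reducible, with linearly dependent entries. One
  element then has several coefficient matrices. Computations are done on matrices, and the
  convolution product, which sees only the element, certifies that two matrices of the same element
  give the same operator. The integral form is shown to be positive semidefinite, hence the separate
  treatment of null vectors.\<close>

lemma clinearI:
  assumes "\<And>x y. f (x + y) = f x + f y" "\<And>c x. f (c *\<^sub>C x) = c *\<^sub>C f x"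
  shows "clinear f"
  by (rule Vector_Spaces.linear.intro)
    (auto intro!: module_hom.intro module_hom_axioms.intro assms cv.module_axioms cv.vector_space_axioms)

lemma clinear_add: "clinear f \<Longrightarrow> f (x + y) = f x + f y"
  by (rule module_hom.add[OF Vector_Spaces.linear.axioms(3)])

lemma clinear_scale: "clinear f \<Longrightarrow> f (c *\<^sub>C x) = c *\<^sub>C f x"
  by (rule module_hom.scale[OF Vector_Spaces.linear.axioms(3)])

lemma clinear_sum: "clinear f \<Longrightarrow> f (\<Sum>i\<in>A. g i) = (\<Sum>i\<in>A. f (g i))"
  by (rule module_hom.sum[OF Vector_Spaces.linear.axioms(3)])

lemma clinear_separating:
  fixes x :: "'a::complex_vector"
  assumes "x \<noteq> 0"
  shows "\<exists>f :: 'a \<Rightarrow> complex. clinear f \<and> f x = 1"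
proof -
  interpret vector_space_pair "scaleC :: complex \<Rightarrow> 'a \<Rightarrow> 'a" "scaleC :: complex \<Rightarrow> complex \<Rightarrow> complex" ..
  have "cv.independent {x}" using assms by simp
  from linear_independent_extend[OF this, of "\<lambda>_. 1"] show ?thesis by auto
qed

text \<open>Reduces an identity in an abstract space to complex numbers; in \<open>ip_nonneg\<close>
  it lets an equation in the algebra be checked as an equation of traces.\<close>

lemma clinear_eqI:
  fixes x y :: "'a::complex_vector"
  assumes "\<And>f :: 'a \<Rightarrow> complex. clinear f \<Longrightarrow> f x = f y"
  shows "x = y"
proof (rule ccontr)
  assume "x \<noteq> y"
  then obtain f :: "'a \<Rightarrow> complex" where f: "clinear f" "f (x - y) = 1"
    using clinear_separating[of "x - y"] by auto
  have "f x = f ((x - y) + y)" by simp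
  also have "\<dots> = 1 + f y" using f by (subst clinear_add) auto
  finally show False using assms[OF f(1)] by simp
qed

text \<open>Stronger than \<open>balanced_on\<close>, which also admits maps conjugate linear in
  both arguments: here scalars come out of the value, so that \<open>sweedler F\<close> is linear
  and commutes with linear maps.\<close>

definition cbilinear ::
    "('a::complex_vector \<Rightarrow> 'b::complex_vector \<Rightarrow> 'c::complex_vector) \<Rightarrow> bool" where
  "cbilinear F \<longleftrightarrow> (\<forall>b. clinear (\<lambda>a. F a b)) \<and> (\<forall>a. clinear (F a))"

lemma cbilinearI:
  assumes "\<And>a a' b. F (a + a') b = F a b + F a' b" "\<And>c a b. F (c *\<^sub>C a) b = c *\<^sub>C F a b"
    "\<And>a b b'. F a (b + b') = F a b + F a b'" "\<And>c a b. F a (c *\<^sub>C b) = c *\<^sub>C F a b"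
  shows "cbilinear F"
  unfolding cbilinear_def using assms by (auto intro!: clinearI)

lemma cbilinear_balanced: "cbilinear F \<Longrightarrow> balanced_on UNIV F"
  unfolding cbilinear_def balanced_on_def
  by (auto simp: clinear_add clinear_scale dest: spec)
    (metis clinear_add clinear_scale)+

section \<open>Sweedler sums over finite index sets\<close>

lemma tensor_of_list_Nil [simp]: "tensor_of_list [] = 0"
  and tensor_of_list_Cons [simp]: "tensor_of_list ((a, b) # l) = a \<otimes> b + tensor_of_list l"
  and tensor_of_list_append: "tensor_of_list (l @ l') = tensor_of_list l + tensor_of_list l'"
  by (simp_all add: tensor_of_list_def)

lemma tensor_zero_left [simp]: "0 \<otimes> b = 0"
  using tensor_scaleC_left[of 0 0 b] by simp

lemma tensor_zero_right [simp]: "a \<otimes> 0 = 0"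
  using tensor_scaleC_right[of a 0 0] by simp

lemma tensor_sum_left: "(\<Sum>i\<in>I. a i) \<otimes> b = (\<Sum>i\<in>I. a i \<otimes> b)"
  by (induction I rule: infinite_finite_induct) (auto simp: tensor_add_left)

lemma tensor_sum_right: "a \<otimes> (\<Sum>i\<in>I. b i) = (\<Sum>i\<in>I. a \<otimes> b i)"
  by (induction I rule: infinite_finite_induct) (auto simp: tensor_add_right)

text \<open>The bridge from the Sweedler expressions of the axioms to the explicit finite sums in
  which coproducts and coactions are written from here on.\<close>

lemma sweedler_on_sum:
  assumes "cv.subspace V" "balanced_on V F" "finite I" "\<And>i. i \<in> I \<Longrightarrow> a i \<in> V"
  shows "sweedler_on V F (\<Sum>i\<in>I. a i \<otimes> b i) = (\<Sum>i\<in>I. F (a i) (b i))"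
proof -
  obtain xs where xs: "set xs = I" "distinct xs"
    using \<open>finite I\<close> finite_distinct_list by blast
  let ?l = "map (\<lambda>i. (a i, b i)) xs"
  have "(\<Sum>i\<in>I. a i \<otimes> b i) = tensor_of_list ?l"
    using xs by (simp add: tensor_of_list_def o_def sum_list_distinct_conv_sum_set)
  moreover have "fst ` set ?l \<subseteq> V"
    using xs assms(4) by auto
  ultimately show ?thesis
    using xs by (simp add: sweedler_on_eq[OF assms(1,2)] o_def sum_list_distinct_conv_sum_set)
qed

lemma sweedler_sum:
  assumes "balanced_on UNIV F" "finite I"
  shows "sweedler F (\<Sum>i\<in>I. a i \<otimes> b i) = (\<Sum>i\<in>I. F (a i) (b i))"
  using assms by (intro sweedler_on_sum) auto

lemma tensor_span_sum:
  assumes "cv.subspace V" "t \<in> tensor_span V"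
  obtains n :: nat and a b where "\<And>i. i < n \<Longrightarrow> a i \<in> V" "t = (\<Sum>i<n. a i \<otimes> b i)"
proof -
  obtain l where l: "fst ` set l \<subseteq> V" "t = tensor_of_list l"
    using tensor_span_representable[OF assms] by blast
  have "t = (\<Sum>i<length l. fst (l ! i) \<otimes> snd (l ! i))"
    unfolding l tensor_of_list_def
    by (subst sum_list_sum_nth) (simp add: case_prod_beta atLeast0LessThan)
  moreover have "fst (l ! i) \<in> V" if "i < length l" for i
    using l(1) that nth_mem by blast
  ultimately show ?thesis by (rule that[rotated])
qed

lemma tensor_sum:
  obtains n :: nat and a b where "t = (\<Sum>i<n. a i \<otimes> b i)"
  using tensor_span_sum[OF cv.subspace_UNIV tensor_span_UNIV] by metis

text \<open>The representing list is chosen from \<open>V\<close> and \<open>t\<close> alone, so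
  both sides are evaluated on the same list and agree entry by entry.\<close>

lemma sweedler_on_cong:
  assumes "cv.subspace V" "t \<in> tensor_span V" "\<And>a b. a \<in> V \<Longrightarrow> F a b = G a b"
  shows "sweedler_on V F t = sweedler_on V G t"
proof -
  define l where "l = (SOME l. fst ` set l \<subseteq> V \<and> t = tensor_of_list l)"
  have "fst ` set l \<subseteq> V \<and> t = tensor_of_list l"
    unfolding l_def by (rule someI_ex) (rule tensor_span_representable[OF assms(1,2)])
  then have "map (\<lambda>(a, b). F a b) l = map (\<lambda>(a, b). G a b) l"
    using assms(3) by auto
  then show ?thesis
    unfolding sweedler_on_def Let_def l_def[symmetric] by (rule arg_cong)
qed

lemma tensor_span_setsum:
  "(\<And>i. i \<in> I \<Longrightarrow> a i \<in> V) \<Longrightarrow> (\<Sum>i\<in>I. a i \<otimes> b i) \<in> tensor_span V"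
  unfolding tensor_span_def by (intro cv.span_sum cv.span_base) auto

lemma sweedler_on_add:
  assumes "cv.subspace V" "balanced_on V F" "s \<in> tensor_span V" "t \<in> tensor_span V"
  shows "sweedler_on V F (s + t) = sweedler_on V F s + sweedler_on V F t"
proof -
  obtain l l' where "fst ` set l \<subseteq> V" "s = tensor_of_list l" "fst ` set l' \<subseteq> V" "t = tensor_of_list l'"
    using tensor_span_representable assms by metis
  moreover from this have "s + t = tensor_of_list (l @ l')" "fst ` set (l @ l') \<subseteq> V"
    by (auto simp: tensor_of_list_append)
  ultimately show ?thesis
    using assms(1,2) by (simp only: sweedler_on_eq) simp
qed

lemma sweedler_pure: "balanced_on UNIV F \<Longrightarrow> sweedler F (a \<otimes> b) = F a b"
  using sweedler_sum[of F "{()}" "\<lambda>_. a" "\<lambda>_. b"] by simp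

lemma sweedler_linear:
  assumes "cbilinear F"
  shows "clinear (sweedler F)"
proof (rule clinearI)
  note bal = cbilinear_balanced[OF assms]
  show "sweedler F (s + t) = sweedler F s + sweedler F t" for s t
    by (rule sweedler_on_add[OF _ bal]) (auto simp: tensor_span_UNIV)
  show "sweedler F (c *\<^sub>C t) = c *\<^sub>C sweedler F t" for c t
  proof -
    obtain n :: nat and a b where t: "t = (\<Sum>i<n. a i \<otimes> b i)" by (rule tensor_sum)
    have "c *\<^sub>C t = (\<Sum>i<n. (c *\<^sub>C a i) \<otimes> b i)"
      by (simp add: t cv.scale_sum_right tensor_scaleC_left)
    moreover have "F (c *\<^sub>C a) b = c *\<^sub>C F a b" for a b
      using assms clinear_scale[of "\<lambda>a. F a b"] by (simp add: cbilinear_def)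
    ultimately show ?thesis
      by (simp add: t sweedler_sum[OF bal] cv.scale_sum_right)
  qed
qed

section \<open>Independent families and minimal tensor representations\<close>

definition free_family :: "nat set \<Rightarrow> (nat \<Rightarrow> 'a::complex_vector) \<Rightarrow> bool" where
  "free_family I a \<longleftrightarrow> (\<forall>c. (\<Sum>i\<in>I. c i *\<^sub>C a i) = 0 \<longrightarrow> (\<forall>i\<in>I. c i = 0))"

lemma free_familyD:
  "free_family I a \<Longrightarrow> (\<Sum>i\<in>I. c i *\<^sub>C a i) = 0 \<Longrightarrow> i \<in> I \<Longrightarrow> c i = 0"
  unfolding free_family_def by blast

text \<open>Freeness of an indexed family excludes repetitions, which independence of the image set
  would not notice. So injectivity has to be extracted before functionals prescribed on the image
  become dual to the indices.\<close>

lemma free_family_dual: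
  fixes a :: "nat \<Rightarrow> 'a::complex_vector"
  assumes "finite I" "free_family I a"
  obtains f :: "nat \<Rightarrow> 'a \<Rightarrow> complex"
  where "\<And>k. clinear (f k)" "\<And>i k. i \<in> I \<Longrightarrow> k \<in> I \<Longrightarrow> f k (a i) = (if i = k then 1 else 0)"
proof -
  interpret vector_space_pair "scaleC :: complex \<Rightarrow> 'a \<Rightarrow> 'a" "scaleC :: complex \<Rightarrow> complex \<Rightarrow> complex" ..
  have inj: "inj_on a I"
  proof (rule inj_onI, rule ccontr)
    fix i j assume ij: "i \<in> I" "j \<in> I" "a i = a j" "i \<noteq> j"
    let ?c = "\<lambda>k. if k = i then 1 else if k = j then -1 else (0 :: complex)"
    have "(\<Sum>k\<in>I. ?c k *\<^sub>C a k) = (\<Sum>k\<in>{i, j}. ?c k *\<^sub>C a k)"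
      using assms(1) ij by (intro sum.mono_neutral_right) auto
    also have "\<dots> = 0" using ij by simp
    finally have "?c i = 0" using free_familyD[OF assms(2), of ?c i] ij(1) by blast
    then show False by simp
  qed
  have "cv.independent (a ` I)"
  proof (rule cv.independent_if_scalars_zero)
    show "finite (a ` I)" using assms(1) by simp
    fix c x assume *: "(\<Sum>x\<in>a ` I. c x *\<^sub>C x) = 0" "x \<in> a ` I"
    have "(\<Sum>i\<in>I. c (a i) *\<^sub>C a i) = 0" using *(1) by (simp add: sum.reindex[OF inj])
    from free_familyD[OF assms(2) this] show "c x = 0" using *(2) by blast
  qed
  then have "\<exists>f. clinear f \<and> (\<forall>x\<in>a ` I. f x = (if x = a k then 1 else (0 :: complex)))" for k
    by (rule linear_independent_extend)
  then obtain f where "\<And>k. clinear (f k)" "\<And>k x. x \<in> a ` I \<Longrightarrow> f k x = (if x = a k then 1 else (0 :: complex))"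
    by metis
  then show ?thesis
    using inj by (intro that[of f]) (auto simp: inj_on_def)
qed

lemma not_free_familyE:
  assumes "finite I" "\<not> free_family I a"
  obtains m d where "m \<in> I" "a m = (\<Sum>i\<in>I - {m}. d i *\<^sub>C a i)"
proof -
  obtain c m where c: "(\<Sum>i\<in>I. c i *\<^sub>C a i) = 0" "m \<in> I" "c m \<noteq> 0"
    using assms(2) unfolding free_family_def by blast
  have "c m *\<^sub>C a m + (\<Sum>i\<in>I - {m}. c i *\<^sub>C a i) = 0"
    using c assms(1) by (simp add: sum.remove)
  then have "c m *\<^sub>C a m = - (\<Sum>i\<in>I - {m}. c i *\<^sub>C a i)"
    by (simp add: eq_neg_iff_add_eq_0)
  then have "(1 / c m) *\<^sub>C c m *\<^sub>C a m = (1 / c m) *\<^sub>C (- (\<Sum>i\<in>I - {m}. c i *\<^sub>C a i))"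
    by simp
  then have "a m = (\<Sum>i\<in>I - {m}. (- (c i / c m)) *\<^sub>C a i)"
    using c(3) by (simp add: scaleC_scaleC scaleC_one cv.scale_sum_right sum_negf[symmetric]
        del: sum_negf)
  with c(2) show ?thesis by (rule that)
qed

text \<open>A representation with the fewest terms has linearly independent legs on both sides.\<close>

lemma tensor_minimal:
  obtains I :: "nat set" and a b
  where "finite I" "t = (\<Sum>i\<in>I. a i \<otimes> b i)" "free_family I a" "free_family I b"
proof -
  define rep where "rep I \<longleftrightarrow> finite I \<and> (\<exists>a b. t = (\<Sum>i\<in>I. a i \<otimes> b i))" for I :: "nat set"
  have "\<exists>I. rep I"
    unfolding rep_def by (metis tensor_sum finite_lessThan)
  then obtain I where I: "rep I" and min: "\<And>J. rep J \<Longrightarrow> card I \<le> card J"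
    using ex_has_least_nat[of rep _ card] by blast
  then obtain a b where ab: "t = (\<Sum>i\<in>I. a i \<otimes> b i)" and fin: "finite I"
    unfolding rep_def by blast
  have not_smaller: False if "m \<in> I" "rep (I - {m})" for m
    using min[OF that(2)] that(1) fin by (meson card_Diff1_less not_le)
  have "free_family I a"
  proof (rule ccontr)
    assume "\<not> free_family I a"
    then obtain m d where m: "m \<in> I" "a m = (\<Sum>i\<in>I - {m}. d i *\<^sub>C a i)"
      using not_free_familyE[OF fin] by blast
    have "t = a m \<otimes> b m + (\<Sum>i\<in>I - {m}. a i \<otimes> b i)"
      using ab fin m(1) by (simp add: sum.remove)
    also have "a m \<otimes> b m = (\<Sum>i\<in>I - {m}. a i \<otimes> (d i *\<^sub>C b m))"
      by (subst m(2)) (simp add: tensor_sum_left tensor_scaleC_left tensor_scaleC_right)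
    \<comment> \<open>The term with index m is absorbed by the others, which leaves a representation
      with one term less.\<close>
    finally have "t = (\<Sum>i\<in>I - {m}. a i \<otimes> (d i *\<^sub>C b m + b i))"
      by (simp add: tensor_add_right sum.distrib)
    then show False using not_smaller[OF m(1)] fin unfolding rep_def by (metis finite_Diff)
  qed
  moreover have "free_family I b"
  proof (rule ccontr)
    assume "\<not> free_family I b"
    then obtain m d where m: "m \<in> I" "b m = (\<Sum>i\<in>I - {m}. d i *\<^sub>C b i)"
      using not_free_familyE[OF fin] by blast
    have "t = a m \<otimes> b m + (\<Sum>i\<in>I - {m}. a i \<otimes> b i)"
      using ab fin m(1) by (simp add: sum.remove)
    also have "a m \<otimes> b m = (\<Sum>i\<in>I - {m}. (d i *\<^sub>C a m) \<otimes> b i)"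
      by (subst m(2)) (simp add: tensor_sum_right tensor_scaleC_left tensor_scaleC_right)
    finally have "t = (\<Sum>i\<in>I - {m}. (d i *\<^sub>C a m + a i) \<otimes> b i)"
      by (simp add: tensor_add_left sum.distrib)
    then show False using not_smaller[OF m(1)] fin unfolding rep_def by (metis finite_Diff)
  qed
  ultimately show ?thesis using that fin ab by blast
qed

text \<open>For nested Sweedler sums: the inner sum must be linear in the leg of the outer one on
  which it depends.\<close>

lemma sweedler_param_linear:
  assumes "\<And>z. cbilinear (F z)" "\<And>u v. clinear (\<lambda>z. F z u v)"
  shows "clinear (\<lambda>z. sweedler (F z) t)"
proof -
  obtain n :: nat and a b where t: "t = (\<Sum>i<n. a i \<otimes> b i)" by (rule tensor_sum)
  have eq: "sweedler (F z) t = (\<Sum>i<n. F z (a i) (b i))" for z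
    using sweedler_sum[OF cbilinear_balanced[OF assms(1)], of "{..<n}"] by (simp add: t)
  have "F (x + y) u v = F x u v + F y u v" "F (c *\<^sub>C x) u v = c *\<^sub>C F x u v" for x y u v c
    using clinear_add[OF assms(2)] clinear_scale[OF assms(2)] by auto
  then show ?thesis
    by (intro clinearI) (simp_all add: eq sum.distrib cv.scale_sum_right)
qed

lemma sweedler_compose:
  assumes "cbilinear F" "clinear L"
  shows "L (sweedler F t) = sweedler (\<lambda>u v. L (F u v)) t"
proof -
  obtain n :: nat and a b where t: "t = (\<Sum>i<n. a i \<otimes> b i)" by (rule tensor_sum)
  have "F (a + a') b = F a b + F a' b" "F (c *\<^sub>C a) b = c *\<^sub>C F a b"
    "F a (b + b') = F a b + F a b'" "F a (c *\<^sub>C b) = c *\<^sub>C F a b" for a a' b b' c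
    using assms(1) clinear_add[of "\<lambda>a. F a b" for b] clinear_scale[of "\<lambda>a. F a b" for b]
    by (auto simp: cbilinear_def clinear_add clinear_scale)
  then have "cbilinear (\<lambda>u v. L (F u v))"
    by (intro cbilinearI) (simp_all add: clinear_add[OF assms(2)] clinear_scale[OF assms(2)])
  then show ?thesis
    using assms by (simp add: t sweedler_sum cbilinear_balanced clinear_sum)
qed

lemma cbilinear_tensor: "cbilinear (\<otimes>)"
  by (rule cbilinearI)
    (simp_all add: tensor_add_left tensor_add_right tensor_scaleC_left tensor_scaleC_right)

lemma cbilinear_tensor3: "cbilinear (\<lambda>u v. u \<otimes> v \<otimes> w)"
  by (rule cbilinearI)
    (simp_all add: tensor_add_left tensor_add_right tensor_scaleC_left tensor_scaleC_right)

lemma sweedler_tensor: "sweedler (\<otimes>) t = t"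
proof -
  obtain n :: nat and a b where t: "t = (\<Sum>i<n. a i \<otimes> b i)" by (rule tensor_sum)
  show ?thesis by (simp add: t sweedler_sum[OF cbilinear_balanced[OF cbilinear_tensor]])
qed

lemma cbilinear_slice_left: "clinear f \<Longrightarrow> cbilinear (\<lambda>u s. f u *\<^sub>C s)"
  by (rule cbilinearI)
    (simp_all add: clinear_add clinear_scale cv.scale_left_distrib cv.scale_right_distrib
      scaleC_scaleC mult.commute)

lemma cbilinear_slice_right: "clinear f \<Longrightarrow> cbilinear (\<lambda>u s. f s *\<^sub>C u)"
  by (rule cbilinearI)
    (simp_all add: clinear_add clinear_scale cv.scale_left_distrib cv.scale_right_distrib
      scaleC_scaleC mult.commute)

text \<open>Contracting the left leg with the functional dual to \<open>a k\<close> isolates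
  \<open>s k\<close>.\<close>

lemma free_family_tensor_cancel:
  assumes "finite I" "free_family I a" "(\<Sum>i\<in>I. a i \<otimes> s i) = (\<Sum>i\<in>I. a i \<otimes> r i)" "k \<in> I"
  shows "s k = r k"
proof -
  obtain g :: "nat \<Rightarrow> 'a \<Rightarrow> complex" where g: "\<And>k. clinear (g k)"
    "\<And>i k. i \<in> I \<Longrightarrow> k \<in> I \<Longrightarrow> g k (a i) = (if i = k then 1 else 0)"
    using free_family_dual[OF assms(1,2)] by blast
  have "sweedler (\<lambda>u s. g k u *\<^sub>C s) (\<Sum>i\<in>I. a i \<otimes> s i) = s k" for s :: "nat \<Rightarrow> 'b"
  proof -
    have "sweedler (\<lambda>u s. g k u *\<^sub>C s) (\<Sum>i\<in>I. a i \<otimes> s i) = (\<Sum>i\<in>I. g k (a i) *\<^sub>C s i)"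
      by (rule sweedler_sum[OF cbilinear_balanced[OF cbilinear_slice_left[OF g(1)]] assms(1)])
    also have "\<dots> = (\<Sum>i\<in>I. if i = k then s i else 0)"
      using assms(4) by (intro sum.cong) (auto simp: g(2))
    finally show ?thesis using assms(1,4) by simp
  qed
  then show ?thesis using assms(3) by metis
qed

section \<open>Corepresentations\<close>

text \<open>Matrix form of a finite-dimensional right comodule. Any finite set of naturals is
  allowed as index set, because that is what a minimal representation of a coproduct
  supplies.\<close>

definition corep ::
    "('h::complex_algebra_1 \<Rightarrow> ('h, 'h) tensor) \<Rightarrow> ('h \<Rightarrow> complex) \<Rightarrow> nat set \<Rightarrow> (nat \<Rightarrow> nat \<Rightarrow> 'h) \<Rightarrow> bool" where
  "corep \<Delta> \<epsilon> I t \<longleftrightarrow> finite I \<and>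
     (\<forall>i\<in>I. \<forall>j\<in>I. \<Delta> (t i j) = (\<Sum>k\<in>I. t i k \<otimes> t k j) \<and> \<epsilon> (t i j) = (if i = j then 1 else 0))"

section \<open>The corepresentation generated by an element\<close>

context hopf_algebra
begin

lemma comult_coassoc_sum:
  assumes "finite I" "\<Delta> a = (\<Sum>i\<in>I. x i \<otimes> y i)"
  shows "(\<Sum>i\<in>I. sweedler (\<lambda>u v. u \<otimes> v \<otimes> y i) (\<Delta> (x i))) = (\<Sum>i\<in>I. x i \<otimes> \<Delta> (y i))"
proof -
  have "cbilinear (\<lambda>x1 (x2 :: 'h). sweedler (\<lambda>x11 x12. x11 \<otimes> x12 \<otimes> x2) (\<Delta> x1))"
    unfolding cbilinear_def
  proof (intro conjI allI)
    fix b :: 'h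
    show "clinear (\<lambda>a. sweedler (\<lambda>x11 x12. x11 \<otimes> x12 \<otimes> b) (\<Delta> a))"
      by (intro clinearI)
        (simp_all add: clinear_add[OF comult_linear] clinear_scale[OF comult_linear]
          clinear_add[OF sweedler_linear[OF cbilinear_tensor3]]
          clinear_scale[OF sweedler_linear[OF cbilinear_tensor3]])
  next
    fix a :: 'h
    show "clinear (\<lambda>x2. sweedler (\<lambda>x11 x12. x11 \<otimes> x12 \<otimes> x2) (\<Delta> a))"
      by (rule sweedler_param_linear[OF cbilinear_tensor3])
        (simp add: clinearI tensor_add_right tensor_scaleC_right)
  qed
  moreover have "cbilinear (\<lambda>(x1 :: 'h) x2. x1 \<otimes> \<Delta> x2)"
    using comult_linear
    by (intro cbilinearI) (simp_all add: tensor_add_left tensor_add_right tensor_scaleC_left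
      tensor_scaleC_right clinear_add clinear_scale)
  ultimately show ?thesis
    using comult_coassoc[of a] by (simp add: assms sweedler_sum cbilinear_balanced)
qed

lemma counit_left_sum:
  assumes "finite I" "\<Delta> a = (\<Sum>i\<in>I. x i \<otimes> y i)"
  shows "(\<Sum>i\<in>I. \<epsilon> (x i) *\<^sub>C y i) = a"
  using counit_left[of a]
  by (simp add: assms sweedler_sum[OF cbilinear_balanced[OF cbilinear_slice_left[OF counit_linear]]])

lemma counit_right_sum:
  assumes "finite I" "\<Delta> a = (\<Sum>i\<in>I. x i \<otimes> y i)"
  shows "(\<Sum>i\<in>I. \<epsilon> (y i) *\<^sub>C x i) = a"
  using counit_right[of a]
  by (simp add: assms sweedler_sum[OF cbilinear_balanced[OF cbilinear_slice_right[OF counit_linear]]])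

text \<open>The finiteness theorem for comodules in coordinates: in a minimal representation of the
  coproduct of \<open>a\<close>, the left legs span a right subcomodule of the algebra that contains
  \<open>a\<close>, and \<open>t\<close> is its matrix.\<close>

lemma exists_corep:
  obtains I t c where "corep \<Delta> \<epsilon> I t" "a = (\<Sum>i\<in>I. \<Sum>j\<in>I. c i j *\<^sub>C t i j)"
proof -
  obtain I :: "nat set" and x y where I: "finite I" and a: "\<Delta> a = (\<Sum>i\<in>I. x i \<otimes> y i)"
    and free: "free_family I x" "free_family I y"
    by (rule tensor_minimal)
  obtain f :: "nat \<Rightarrow> 'h \<Rightarrow> complex" where f: "\<And>k. clinear (f k)"
    "\<And>i k. i \<in> I \<Longrightarrow> k \<in> I \<Longrightarrow> f k (y i) = (if i = k then 1 else 0)"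
    using free_family_dual[OF I free(2)] by blast
  \<comment> \<open>Contracting the last leg of coassociativity with \<open>f k\<close>, the dual of
    the right leg \<open>y k\<close>, leaves \<Delta> (x k) on one side and forces this
    \<open>t\<close> on the other.\<close>
  define t where "t i k = sweedler (\<lambda>u v. f k v *\<^sub>C u) (\<Delta> (y i))" for i k
  have \<Delta>x: "\<Delta> (x k) = (\<Sum>i\<in>I. x i \<otimes> t i k)" if k: "k \<in> I" for k
  proof -
    define \<Phi> :: "('h, ('h, 'h) tensor) tensor \<Rightarrow> ('h, 'h) tensor"
      where "\<Phi> = sweedler (\<lambda>u s. u \<otimes> sweedler (\<lambda>u v. f k v *\<^sub>C u) s)"
    have lin: "clinear (sweedler (\<lambda>u v. f k v *\<^sub>C u))"
      by (rule sweedler_linear[OF cbilinear_slice_right[OF f(1)]])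
    have bil: "cbilinear (\<lambda>(u :: 'h) s. u \<otimes> sweedler (\<lambda>u v. f k v *\<^sub>C (u :: 'h)) s)"
      by (intro cbilinearI) (simp_all add: tensor_add_left tensor_add_right
        tensor_scaleC_left tensor_scaleC_right clinear_add[OF lin] clinear_scale[OF lin])
    have \<Phi>lin: "clinear \<Phi>" unfolding \<Phi>_def by (rule sweedler_linear[OF bil])
    have pure: "\<Phi> (u \<otimes> s) = u \<otimes> sweedler (\<lambda>u v. f k v *\<^sub>C u) s" for u s
      unfolding \<Phi>_def by (rule sweedler_pure[OF cbilinear_balanced[OF bil]])
    have "\<Phi> (sweedler (\<lambda>u v. u \<otimes> v \<otimes> y i) (\<Delta> (x i))) = f k (y i) *\<^sub>C \<Delta> (x i)" for i
    proof -
      have "\<Phi> (sweedler (\<lambda>u v. u \<otimes> v \<otimes> y i) (\<Delta> (x i))) =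
          sweedler (\<lambda>u v. \<Phi> (u \<otimes> v \<otimes> y i)) (\<Delta> (x i))"
        by (rule sweedler_compose[OF cbilinear_tensor3 \<Phi>lin])
      also have "(\<lambda>u v. \<Phi> (u \<otimes> v \<otimes> y i)) = (\<lambda>u v. f k (y i) *\<^sub>C (u \<otimes> v))"
        by (simp add: pure sweedler_pure[OF cbilinear_balanced[OF cbilinear_slice_right[OF f(1)]]]
          tensor_scaleC_right)
      also have "sweedler \<dots> (\<Delta> (x i)) = f k (y i) *\<^sub>C sweedler (\<otimes>) (\<Delta> (x i))"
        by (rule sweedler_compose[OF cbilinear_tensor, symmetric])
          (simp add: clinearI cv.scale_right_distrib scaleC_scaleC mult.commute)
      finally show ?thesis by (simp add: sweedler_tensor)
    qed
    then have "\<Phi> (\<Sum>i\<in>I. sweedler (\<lambda>u v. u \<otimes> v \<otimes> y i) (\<Delta> (x i))) = (\<Sum>i\<in>I. f k (y i) *\<^sub>C \<Delta> (x i))"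
      by (simp add: clinear_sum[OF \<Phi>lin])
    also have "\<dots> = (\<Sum>i\<in>I. if i = k then \<Delta> (x i) else 0)"
      by (intro sum.cong) (simp_all add: f(2) k)
    also have "\<dots> = \<Delta> (x k)" using I k by simp
    finally show ?thesis
      unfolding comult_coassoc_sum[OF I a] clinear_sum[OF \<Phi>lin] pure t_def[symmetric] by simp
  qed
  \<comment> \<open>Coassociativity at \<open>x k\<close>, compared coefficientwise along the
    independent left legs.\<close>
  have "\<Delta> (t l k) = (\<Sum>i\<in>I. t l i \<otimes> t i k)" if "l \<in> I" "k \<in> I" for l k
  proof (rule free_family_tensor_cancel[OF I free(1) _ that(1)])
    have "(\<Sum>j\<in>I. x j \<otimes> \<Delta> (t j k)) = (\<Sum>i\<in>I. sweedler (\<lambda>u v. u \<otimes> v \<otimes> t i k) (\<Delta> (x i)))"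
      by (rule comult_coassoc_sum[OF I \<Delta>x[OF that(2)], symmetric])
    also have "\<dots> = (\<Sum>i\<in>I. \<Sum>j\<in>I. x j \<otimes> t j i \<otimes> t i k)"
      using I by (intro sum.cong) (simp_all add: \<Delta>x sweedler_sum cbilinear_balanced[OF cbilinear_tensor3])
    also have "\<dots> = (\<Sum>j\<in>I. x j \<otimes> (\<Sum>i\<in>I. t j i \<otimes> t i k))"
      unfolding tensor_sum_right by (rule sum.swap)
    finally show "(\<Sum>j\<in>I. x j \<otimes> \<Delta> (t j k)) = (\<Sum>j\<in>I. x j \<otimes> (\<Sum>i\<in>I. t j i \<otimes> t i k))" .
  qed
  moreover have "\<epsilon> (t i k) = (if i = k then 1 else 0)" if "i \<in> I" "k \<in> I" for i k
  proof -
    \<comment> \<open>The counit law at \<open>x k\<close>, written as a linear relation among the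
      independent left legs.\<close>
    have "(\<Sum>i\<in>I. (\<epsilon> (t i k) - (if i = k then 1 else 0)) *\<^sub>C x i) =
      (\<Sum>i\<in>I. \<epsilon> (t i k) *\<^sub>C x i) - (\<Sum>i\<in>I. if i = k then x i else 0)"
      unfolding sum_subtractf[symmetric] by (intro sum.cong) (auto simp: cv.scale_left_diff_distrib)
    also have "\<dots> = 0"
      using counit_right_sum[OF I \<Delta>x[OF that(2)]] that(2) I by simp
    finally show ?thesis
      using free_familyD[OF free(1) _ that(1), of "\<lambda>i. \<epsilon> (t i k) - (if i = k then 1 else 0)"] by simp
  qed
  ultimately have "corep \<Delta> \<epsilon> I t" using I by (simp add: corep_def)
  \<comment> \<open>The counit on the right legs puts \<open>a\<close> into the span of the
    \<open>x k\<close>; on the left legs of \<Delta> (x k) it turns \<open>x k\<close> into a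
    combination of the \<open>t i k\<close>.\<close>
  moreover have "a = (\<Sum>i\<in>I. \<Sum>k\<in>I. (\<epsilon> (y k) * \<epsilon> (x i)) *\<^sub>C t i k)"
  proof -
    have "a = (\<Sum>k\<in>I. \<epsilon> (y k) *\<^sub>C x k)" by (rule counit_right_sum[OF I a, symmetric])
    also have "\<dots> = (\<Sum>k\<in>I. \<epsilon> (y k) *\<^sub>C (\<Sum>i\<in>I. \<epsilon> (x i) *\<^sub>C t i k))"
      by (intro sum.cong) (simp_all add: counit_left_sum[OF I \<Delta>x])
    also have "\<dots> = (\<Sum>k\<in>I. \<Sum>i\<in>I. (\<epsilon> (y k) * \<epsilon> (x i)) *\<^sub>C t i k)"
      by (simp add: cv.scale_sum_right scaleC_scaleC)
    finally show ?thesis by (subst sum.swap) 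
  qed
  ultimately show ?thesis by (rule that)
qed

lemma corep_antipode_left:
  assumes "corep \<Delta> \<epsilon> I t" "i \<in> I" "j \<in> I"
  shows "(\<Sum>k\<in>I. S (t i k) * t k j) = (if i = j then 1 else 0)"
proof -
  have "cbilinear (\<lambda>x y. S x * y)"
    using antipode_linear by (intro cbilinearI)
      (simp_all add: clinear_add clinear_scale mult_scaleC_left mult_scaleC_right algebra_simps)
  then show ?thesis
    using assms antipode_left[of "t i j"]
    by (auto simp: corep_def sweedler_sum cbilinear_balanced scaleC_one)
qed

end

section \<open>The conjugate corepresentation\<close>

context hopf_star_algebra
begin

lemma star_one: "star 1 = 1"
  by (metis mult.right_neutral star_mult star_star mult.left_neutral)

lemma star_sum: "star (\<Sum>i\<in>I. f i) = (\<Sum>i\<in>I. star (f i))"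
proof -
  have "star 0 = 0" using star_scaleC[of 0 0] by simp
  then show ?thesis
    by (induction I rule: infinite_finite_induct) (auto simp: star_add)
qed

lemma comult_star_sum:
  assumes "finite I" "\<Delta> a = (\<Sum>i\<in>I. x i \<otimes> y i)"
  shows "\<Delta> (star a) = (\<Sum>i\<in>I. star (x i) \<otimes> star (y i))"
proof -
  \<comment> \<open>Conjugate linear in both arguments, hence balanced although not
    bilinear.\<close>
  have "balanced_on UNIV (\<lambda>x1 x2. star x1 \<otimes> star x2)"
    by (auto simp: balanced_on_def star_add star_scaleC tensor_add_left tensor_add_right
      tensor_scaleC_left tensor_scaleC_right)
  then show ?thesis
    using comult_star[of a] assms by (simp add: sweedler_sum)
qed

text \<open>Compatibility of the counit with \<open>star\<close> is not among the axioms. On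
  coefficients it follows by applying \<open>star\<close> and then \<epsilon> to the counit law for
  \<open>star (t i j)\<close>.\<close>

lemma corep_star:
  assumes "corep \<Delta> \<epsilon> I t"
  shows "corep \<Delta> \<epsilon> I (\<lambda>i j. star (t i j))"
proof -
  from assms have I: "finite I" and t: "\<And>i j. i \<in> I \<Longrightarrow> j \<in> I \<Longrightarrow> \<Delta> (t i j) = (\<Sum>k\<in>I. t i k \<otimes> t k j)"
    and eps: "\<And>i j. i \<in> I \<Longrightarrow> j \<in> I \<Longrightarrow> \<epsilon> (t i j) = (if i = j then 1 else 0)"
    by (auto simp: corep_def)
  have "\<epsilon> (star (t i j)) = (if i = j then 1 else 0)" if ij: "i \<in> I" "j \<in> I" for i j
  proof -
    have "star (\<Sum>k\<in>I. \<epsilon> (star (t i k)) *\<^sub>C star (t k j)) = star (star (t i j))"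
      by (simp only: counit_left_sum[OF I comult_star_sum[OF I t[OF ij]]])
    then have "(\<Sum>k\<in>I. cnj (\<epsilon> (star (t i k))) *\<^sub>C t k j) = t i j"
      by (simp add: star_sum star_scaleC star_star)
    then have "\<epsilon> (\<Sum>k\<in>I. cnj (\<epsilon> (star (t i k))) *\<^sub>C t k j) = \<epsilon> (t i j)" by simp
    moreover have "\<epsilon> (\<Sum>k\<in>I. cnj (\<epsilon> (star (t i k))) *\<^sub>C t k j) =
        (\<Sum>k\<in>I. if k = j then cnj (\<epsilon> (star (t i k))) else 0)"
      unfolding clinear_sum[OF counit_linear] clinear_scale[OF counit_linear]
      by (intro sum.cong) (simp_all add: eps ij)
    ultimately have "cnj (\<epsilon> (star (t i j))) = \<epsilon> (t i j)" using I ij by simp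
    then show ?thesis
      using ij by (metis eps complex_cnj_cnj complex_cnj_one complex_cnj_zero)
  qed
  then show ?thesis
    using I t by (auto simp: corep_def comult_star_sum)
qed

end

section \<open>Hermitian forms\<close>

text \<open>Three strengths are kept apart: \<open>hermitian_form\<close> for the integral form
  while its sign is unknown, \<open>psd_form\<close> for what is then proved about it, and
  \<open>pos_form\<close> for the scalar products on comodules and matrices. The carrier is a
  subspace of a type, as for comodules.\<close>

locale hermitian_form =
  fixes V :: "'v::complex_vector set" and h :: "'v \<Rightarrow> 'v \<Rightarrow> complex"
  assumes subspace: "cv.subspace V"
    and add_left: "u \<in> V \<Longrightarrow> v \<in> V \<Longrightarrow> w \<in> V \<Longrightarrow> h (u + v) w = h u w + h v w"
    and scale_left: "v \<in> V \<Longrightarrow> w \<in> V \<Longrightarrow> h (c *\<^sub>C v) w = c * h v w"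
    and herm: "v \<in> V \<Longrightarrow> w \<in> V \<Longrightarrow> h w v = cnj (h v w)"
begin

lemmas mem = cv.subspace_0[OF subspace] cv.subspace_add[OF subspace] cv.subspace_scale[OF subspace]
  cv.subspace_diff[OF subspace] cv.subspace_sum[OF subspace]

lemma add_right: "u \<in> V \<Longrightarrow> v \<in> V \<Longrightarrow> w \<in> V \<Longrightarrow> h w (u + v) = h w u + h w v"
  using herm[of "u + v" w] herm[of u w] herm[of v w] by (simp add: add_left mem)

lemma scale_right: "v \<in> V \<Longrightarrow> w \<in> V \<Longrightarrow> h w (c *\<^sub>C v) = cnj c * h w v"
  using herm[of "c *\<^sub>C v" w] herm[of v w] by (simp add: scale_left mem)

lemma zero_left: "w \<in> V \<Longrightarrow> h 0 w = 0"
  using scale_left[of 0 w 0] by (simp add: mem)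

lemma zero_right: "w \<in> V \<Longrightarrow> h w 0 = 0"
  using scale_right[of 0 w 0] by (simp add: mem)

lemma diff_left: "u \<in> V \<Longrightarrow> v \<in> V \<Longrightarrow> w \<in> V \<Longrightarrow> h (u - v) w = h u w - h v w"
  using add_left[of "u - v" v w] by (simp add: mem)

lemma diff_right: "u \<in> V \<Longrightarrow> v \<in> V \<Longrightarrow> w \<in> V \<Longrightarrow> h w (u - v) = h w u - h w v"
  using add_right[of "u - v" v w] by (simp add: mem)

lemma sum_left: "(\<And>i. i \<in> I \<Longrightarrow> f i \<in> V) \<Longrightarrow> w \<in> V \<Longrightarrow> h (\<Sum>i\<in>I. f i) w = (\<Sum>i\<in>I. h (f i) w)"
  by (induction I rule: infinite_finite_induct) (auto simp: zero_left add_left mem)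

lemma sum_right: "(\<And>i. i \<in> I \<Longrightarrow> f i \<in> V) \<Longrightarrow> w \<in> V \<Longrightarrow> h w (\<Sum>i\<in>I. f i) = (\<Sum>i\<in>I. h w (f i))"
  by (induction I rule: infinite_finite_induct) (auto simp: zero_right add_right mem)

lemma lincomb_left:
  assumes "\<And>i. i \<in> I \<Longrightarrow> e i \<in> V" "w \<in> V"
  shows "h (\<Sum>i\<in>I. c i *\<^sub>C e i) w = (\<Sum>i\<in>I. c i * h (e i) w)"
  using assms by (subst sum_left) (auto simp: scale_left mem intro!: sum.cong)

lemma lincomb_right:
  assumes "\<And>i. i \<in> I \<Longrightarrow> e i \<in> V" "w \<in> V"
  shows "h w (\<Sum>i\<in>I. c i *\<^sub>C e i) = (\<Sum>i\<in>I. cnj (c i) * h w (e i))"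
  using assms by (subst sum_right) (auto simp: scale_right mem intro!: sum.cong)

lemma lincomb:
  assumes "\<And>i. i \<in> I \<Longrightarrow> e i \<in> V" "\<And>j. j \<in> J \<Longrightarrow> g j \<in> V"
  shows "h (\<Sum>i\<in>I. c i *\<^sub>C e i) (\<Sum>j\<in>J. d j *\<^sub>C g j) =
    (\<Sum>i\<in>I. \<Sum>j\<in>J. c i * cnj (d j) * h (e i) (g j))"
proof -
  have "h (\<Sum>i\<in>I. c i *\<^sub>C e i) (\<Sum>j\<in>J. d j *\<^sub>C g j) =
      (\<Sum>i\<in>I. c i * h (e i) (\<Sum>j\<in>J. d j *\<^sub>C g j))"
    using assms by (intro lincomb_left) (auto intro!: mem)
  also have "\<dots> = (\<Sum>i\<in>I. c i * (\<Sum>j\<in>J. cnj (d j) * h (e i) (g j)))"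
    using assms by (intro sum.cong refl arg_cong2[of _ _ _ _ "(*)"] lincomb_right) auto
  finally show ?thesis by (simp add: sum_distrib_left mult.assoc)
qed

lemma real_diag: "v \<in> V \<Longrightarrow> h v v = of_real (Re (h v v))"
  using herm[of v v] by (simp add: complex_eq_iff)

end

locale psd_form = hermitian_form +
  assumes nonneg: "v \<in> V \<Longrightarrow> 0 \<le> Re (h v v)"
begin

lemma Cauchy_Schwarz:
  assumes "v \<in> V" "w \<in> V"
  shows "(cmod (h v w))\<^sup>2 \<le> Re (h v v) * Re (h w w)"
proof -
  define a b z where "a = Re (h v v)" and "b = Re (h w w)" and "z = h v w"
  have q: "0 \<le> a * (cmod c)\<^sup>2 - 2 * Re (c * z) + b" for c
  proof -
    have "h (c *\<^sub>C v - w) (c *\<^sub>C v - w) = c * cnj c * h v v - c * z - cnj c * cnj z + h w w"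
      using assms herm[OF assms]
      by (simp add: diff_left diff_right scale_left scale_right mem z_def algebra_simps)
    moreover have "Re (c * cnj c * h v v) = a * (cmod c)\<^sup>2"
      by (subst real_diag[OF assms(1)]) (simp add: a_def mult.commute flip: complex_norm_square)
    ultimately show ?thesis
      using nonneg[of "c *\<^sub>C v - w"] assms by (simp add: mem b_def)
  qed
  have nn: "0 \<le> a" "0 \<le> b" using nonneg assms by (auto simp: a_def b_def)
  \<comment> \<open>Taking \<open>c = of_real t * cnj z\<close> makes the cross term real and leaves
    a real quadratic in t.\<close>
  have q2: "0 \<le> a * (t * cmod z)\<^sup>2 - 2 * t * (cmod z)\<^sup>2 + b" for t :: real
  proof -
    have "of_real t * cnj z * z = of_real (t * (cmod z)\<^sup>2)"
      by (simp only: of_real_mult complex_norm_square mult.assoc mult.commute[of z "cnj z"])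
    then have "Re (of_real t * cnj z * z) = t * (cmod z)\<^sup>2" by (simp only: Re_complex_of_real)
    moreover have "cmod (of_real t * cnj z) = \<bar>t\<bar> * cmod z" by (simp add: norm_mult)
    ultimately show ?thesis using q[of "of_real t * cnj z"] by (simp add: power_mult_distrib)
  qed
  show ?thesis
  proof (cases "a = 0")
    case True
    have "cmod z = 0"
    proof (rule ccontr)
      assume "cmod z \<noteq> 0"
      \<comment> \<open>With a = 0 the quadratic is affine in t; at this t its value is -1.\<close>
      then show False using q2[of "(b + 1) / (2 * (cmod z)\<^sup>2)"] True nn by simp
    qed
    then show ?thesis using nn by (simp add: z_def[symmetric] a_def[symmetric] b_def[symmetric])
  next
    case False
    then have a: "a > 0" using nn by simp
    \<comment> \<open>The quadratic has its minimum at t = 1 / a.\<close>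
    have "0 \<le> a * (a * (1 / a * cmod z)\<^sup>2 - 2 * (1 / a) * (cmod z)\<^sup>2 + b)"
      using q2[of "1 / a"] a by simp
    also have "\<dots> = a * b - (cmod z)\<^sup>2"
      using a by (simp add: field_simps power2_eq_square)
    finally show ?thesis by (simp add: z_def a_def b_def)
  qed
qed

end

locale pos_form = hermitian_form +
  assumes pos: "v \<in> V \<Longrightarrow> v \<noteq> 0 \<Longrightarrow> 0 < Re (h v v)"
begin

sublocale psd_form
proof
  fix v assume "v \<in> V"
  then show "0 \<le> Re (h v v)" using pos[of v] zero_left[of 0] mem(1) by (cases "v = 0") auto
qed

end

lemma pos_form_iff: "pos_form V h \<longleftrightarrow> cv.subspace V \<and> scalar_product_on V h"
proof
  assume "pos_form V h"
  then interpret pos_form V h .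
  show "cv.subspace V \<and> scalar_product_on V h"
    unfolding scalar_product_on_def by (intro conjI allI ballI impI subspace add_left scale_left herm pos)
next
  assume *: "cv.subspace V \<and> scalar_product_on V h"
  show "pos_form V h"
  proof
    show "cv.subspace V" using * by (rule conjunct1)
  qed (insert *, unfold scalar_product_on_def, meson+)
qed

lemma hermitian_form_subset:
  "hermitian_form V h \<Longrightarrow> cv.subspace W \<Longrightarrow> W \<subseteq> V \<Longrightarrow> hermitian_form W h"
  unfolding hermitian_form_def by (meson subsetD)

lemma pos_form_subset:
  "pos_form V h \<Longrightarrow> cv.subspace W \<Longrightarrow> W \<subseteq> V \<Longrightarrow> pos_form W h"
  unfolding pos_form_def pos_form_axioms_def by (meson subsetD hermitian_form_subset)

section \<open>Orthonormal bases and extremal eigenspaces\<close>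

definition orthonormal_basis ::
    "'v::complex_vector set \<Rightarrow> ('v \<Rightarrow> 'v \<Rightarrow> complex) \<Rightarrow> nat \<Rightarrow> (nat \<Rightarrow> 'v) \<Rightarrow> bool" where
  "orthonormal_basis V h m e \<longleftrightarrow> (\<forall>i<m. e i \<in> V) \<and>
     (\<forall>i<m. \<forall>j<m. h (e i) (e j) = (if i = j then 1 else 0)) \<and>
     (\<forall>v\<in>V. v = (\<Sum>i<m. h v (e i) *\<^sub>C e i))"

text \<open>Gram-Schmidt along the generators: a generator equal to its projection \<open>b0\<close>
  adds nothing, otherwise its normalized residue \<open>f\<close> is appended.\<close>

lemma exists_orthonormal_basis_span:
  assumes "finite B" "pos_form (cv.span B) h"
  shows "\<exists>m e. orthonormal_basis (cv.span B) h m e"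
  using assms
proof (induction B rule: finite_induct)
  case empty
  show ?case by (intro exI[of _ 0]) (simp add: orthonormal_basis_def)
next
  case (insert b B)
  let ?V = "cv.span (insert b B)"
  interpret pos_form ?V h by (rule insert.prems)
  have sub: "cv.span B \<subseteq> ?V" by (rule cv.span_mono) blast
  then have "pos_form (cv.span B) h"
    by (rule pos_form_subset[OF insert.prems cv.subspace_span])
  then obtain m e where "orthonormal_basis (cv.span B) h m e"
    using insert.IH by blast
  then have e: "\<And>i. i < m \<Longrightarrow> e i \<in> cv.span B"
    "\<And>i j. i < m \<Longrightarrow> j < m \<Longrightarrow> h (e i) (e j) = (if i = j then 1 else 0)"
    "\<And>v. v \<in> cv.span B \<Longrightarrow> v = (\<Sum>i<m. h v (e i) *\<^sub>C e i)"
    and onb: "orthonormal_basis (cv.span B) h m e"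
    unfolding orthonormal_basis_def by (blast, blast, blast, blast)
  have eV: "e i \<in> ?V" if "i < m" for i using e(1)[OF that] sub by blast
  define b0 where "b0 = (\<Sum>i<m. h b (e i) *\<^sub>C e i)"
  have b0: "b0 \<in> cv.span B" unfolding b0_def by (intro cv.span_sum cv.span_scale e(1)) simp
  have bV: "b \<in> ?V" "b0 \<in> ?V" using sub b0 by (auto simp: cv.span_base)
  have orth: "h (b - b0) (e j) = 0" if "j < m" for j
  proof -
    have "h b0 (e j) = (\<Sum>i<m. h b (e i) * h (e i) (e j))"
      unfolding b0_def using eV that by (intro lincomb_left) auto
    also have "\<dots> = (\<Sum>i<m. if i = j then h b (e i) else 0)"
      using that by (intro sum.cong) (auto simp: e(2))
    finally show ?thesis using that bV eV by (simp add: diff_left)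
  qed
  show ?case
  proof (cases "b = b0")
    case True
    then have "cv.span (insert b B) = cv.span B" using b0 by (simp add: cv.span_redundant)
    then show ?thesis using onb by auto
  next
    case False
    define r where "r = sqrt (Re (h (b - b0) (b - b0)))"
    have dV: "b - b0 \<in> ?V" using bV by (rule mem)
    then have r: "r > 0" "h (b - b0) (b - b0) = of_real (r\<^sup>2)"
      using pos[OF dV] False real_diag[OF dV] by (auto simp: r_def)
    define f where "f = (of_real (1 / r)) *\<^sub>C (b - b0)"
    have fV: "f \<in> ?V" unfolding f_def by (rule mem(3)[OF dV])
    have f1: "h f f = 1"
      unfolding f_def using dV r
      by (simp add: scale_left scale_right mem power2_eq_square flip: of_real_mult)
    have f0: "h f (e j) = 0" "h (e j) f = 0" if "j < m" for j
    proof -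
      show *: "h f (e j) = 0" unfolding f_def using dV eV that orth by (simp add: scale_left)
      show "h (e j) f = 0" using herm[OF fV eV[OF that]] * by simp
    qed
    define e' where "e' i = (if i < m then e i else f)" for i
    have "v = (\<Sum>i<Suc m. h v (e' i) *\<^sub>C e' i)" if v: "v \<in> ?V" for v
    proof -
      obtain k where k: "v - k *\<^sub>C b \<in> cv.span B" using v cv.span_breakdown_eq by blast
      define w where "w = v - k *\<^sub>C b + k *\<^sub>C b0"
      have w: "w \<in> cv.span B" unfolding w_def using k b0 by (intro cv.span_add cv.span_scale)
      have "v = w + k *\<^sub>C (b - b0)" by (simp add: w_def cv.scale_right_diff_distrib)
      moreover have "b - b0 = of_real r *\<^sub>C f"
        unfolding f_def scaleC_scaleC using r by (simp add: scaleC_one flip: of_real_mult)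
      ultimately have vf: "v = w + (k * of_real r) *\<^sub>C f" by (simp add: scaleC_scaleC)
      have wV: "w \<in> ?V" using w sub by blast
      have h1: "h v (e i) = h w (e i)" if "i < m" for i
        unfolding vf using that wV fV eV by (simp add: add_left scale_left mem f0)
      have "h w f = 0"
      proof -
        have "h w f = h (\<Sum>i<m. h w (e i) *\<^sub>C e i) f" using e(3)[OF w] by simp
        also have "\<dots> = (\<Sum>i<m. h w (e i) * h (e i) f)" using eV fV by (intro lincomb_left) auto
        finally show ?thesis by (simp add: f0)
      qed
      then have "h v f = k * of_real r"
        unfolding vf using wV fV by (simp add: add_left scale_left mem f1)
      then have "(\<Sum>i<Suc m. h v (e' i) *\<^sub>C e' i) = (\<Sum>i<m. h w (e i) *\<^sub>C e i) + (k * of_real r) *\<^sub>C f"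
        by (simp add: e'_def h1)
      also have "\<dots> = v" using e(3)[OF w] vf by simp
      finally show ?thesis by simp
    qed
    then have "orthonormal_basis ?V h (Suc m) e'"
      unfolding orthonormal_basis_def using eV fV e(2) f1 f0
      by (auto simp: e'_def less_Suc_eq)
    then show ?thesis by blast
  qed
qed

text \<open>For a subspace that comes without generators, such as an eigenspace: a maximal
  independent subset is finite by the dimension bound.\<close>

lemma exists_orthonormal_basis:
  assumes "finite B" "W \<subseteq> cv.span B" "pos_form W h"
  obtains m e where "orthonormal_basis W h m e"
proof -
  have W: "cv.subspace W" using assms(3) by (simp add: pos_form_iff)
  obtain C where C: "C \<subseteq> W" "cv.independent C" "W \<subseteq> cv.span C"
    using cv.maximal_independent_subset by blast
  have "finite C" using cv.independent_span_bound[OF assms(1) C(2)] C(1) assms(2) by blast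
  moreover have "cv.span C = W" using C W by (simp add: cv.span_minimal subset_antisym)
  ultimately show ?thesis using exists_orthonormal_basis_span[of C h] assms(3) that by metis
qed

text \<open>Takes the place of compactness of the unit sphere. In an orthonormal basis for
  \<open>p\<close> the coordinates are bounded by the norm, so the sum of the moduli of the matrix
  entries of \<open>h\<close> is a bound; 1 is added to it to make it positive.\<close>

lemma form_bound:
  assumes p: "pos_form V p" and h: "hermitian_form V h" and B: "finite B" "V \<subseteq> cv.span B"
  obtains C where "C > 0" "\<And>v. v \<in> V \<Longrightarrow> \<bar>Re (h v v)\<bar> \<le> C * Re (p v v)"
proof -
  interpret p: pos_form V p by (rule p)
  interpret h: hermitian_form V h by (rule h)
  obtain m e where "orthonormal_basis V p m e"
    using exists_orthonormal_basis[OF B p] by blast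
  then have e: "\<And>i. i < m \<Longrightarrow> e i \<in> V"
    "\<And>i j. i < m \<Longrightarrow> j < m \<Longrightarrow> p (e i) (e j) = (if i = j then 1 else 0)"
    "\<And>v. v \<in> V \<Longrightarrow> v = (\<Sum>i<m. p v (e i) *\<^sub>C e i)"
    unfolding orthonormal_basis_def by (blast, blast, blast)
  define C where "C = (\<Sum>i<m. \<Sum>j<m. cmod (h (e i) (e j)))"
  have "\<bar>Re (h v v)\<bar> \<le> (C + 1) * Re (p v v)" if v: "v \<in> V" for v
  proof -
    define c where "c i = p v (e i)" for i
    have c: "cmod (c i) \<le> sqrt (Re (p v v))" if "i < m" for i
      using p.Cauchy_Schwarz[OF v e(1)[OF that]] that
      by (intro real_le_rsqrt) (simp add: c_def e(2))
    have "h v v = h (\<Sum>i<m. c i *\<^sub>C e i) (\<Sum>i<m. c i *\<^sub>C e i)"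
      using e(3)[OF v] by (simp add: c_def)
    also have "\<dots> = (\<Sum>i<m. \<Sum>j<m. c i * cnj (c j) * h (e i) (e j))"
      using e(1) by (intro h.lincomb) auto
    finally have "\<bar>Re (h v v)\<bar> \<le> cmod (\<Sum>i<m. \<Sum>j<m. c i * cnj (c j) * h (e i) (e j))"
      by (metis abs_Re_le_cmod)
    also have "\<dots> \<le> (\<Sum>i<m. \<Sum>j<m. cmod (c i) * cmod (c j) * cmod (h (e i) (e j)))"
      by (intro sum_norm_le) (simp add: norm_mult)
    also have "\<dots> \<le> (\<Sum>i<m. \<Sum>j<m. sqrt (Re (p v v)) * sqrt (Re (p v v)) * cmod (h (e i) (e j)))"
      by (intro sum_mono mult_right_mono mult_mono c) (auto intro: p.nonneg v)
    also have "\<dots> = Re (p v v) * C"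
      using p.nonneg[OF v] by (simp add: C_def sum_distrib_left)
    also have "\<dots> \<le> (C + 1) * Re (p v v)" using p.nonneg[OF v] by (simp add: algebra_simps)
    finally show ?thesis .
  qed
  moreover have "C + 1 > 0" unfolding C_def by (intro add_nonneg_pos sum_nonneg) auto
  ultimately show ?thesis by (rule that[rotated])
qed

text \<open>The least l for which h + l p is positive semidefinite makes -l the lowest eigenvalue of
  \<open>h\<close> relative to \<open>p\<close>: at the infimum the form degenerates, and its null
  vectors are the eigenvectors. The last conjunct says that the \<open>e i\<close> span the whole
  eigenspace.\<close>

lemma negative_eigenspace:
  assumes p: "pos_form V p" and h: "hermitian_form V h" and B: "finite B" "V \<subseteq> cv.span B"
    and x: "x \<in> V" "Re (h x x) < 0"
  shows "\<exists>(l :: real) (m :: nat) e. 0 < l \<and> 0 < m \<and> (\<forall>i<m. e i \<in> V) \<and>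
    (\<forall>i<m. \<forall>j<m. p (e i) (e j) = (if i = j then 1 else 0)) \<and>
    (\<forall>i<m. \<forall>y\<in>V. h (e i) y = - of_real l * p (e i) y) \<and>
    (\<forall>w\<in>V. (\<forall>y\<in>V. h w y = - of_real l * p w y) \<longrightarrow>
       w = (\<Sum>i<m. p w (e i) *\<^sub>C e i))"
proof -
  interpret p: pos_form V p by (rule p)
  interpret h: hermitian_form V h by (rule h)
  define K where "K = {l. 0 \<le> l \<and> (\<forall>v\<in>V. 0 \<le> Re (h v v) + l * Re (p v v))}"
  obtain C where C: "C > 0" "\<And>v. v \<in> V \<Longrightarrow> \<bar>Re (h v v)\<bar> \<le> C * Re (p v v)"
    using form_bound[OF p h B] by blast
  have "C \<in> K" unfolding K_def using C by (auto simp: abs_le_iff add.commute) (smt (verit) C(2))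
  then have ne: "K \<noteq> {}" by blast
  have bdd: "bdd_below K" unfolding K_def by (rule bdd_belowI[of _ 0]) auto
  define l where "l = Inf K"
  have lower: "- Re (h v v) \<le> l * Re (p v v)" if v: "v \<in> V" for v
  proof (cases "v = 0")
    case True
    then show ?thesis by (simp add: h.zero_left h.mem p.zero_left)
  next
    case False
    have "- Re (h v v) / Re (p v v) \<le> l"
      unfolding l_def
    proof (rule cInf_greatest[OF ne])
      fix k assume "k \<in> K"
      then have "- Re (h v v) \<le> k * Re (p v v)" using v unfolding K_def by (smt (verit) mem_Collect_eq)
      then show "- Re (h v v) / Re (p v v) \<le> k" using p.pos[OF v False] by (subst pos_divide_le_eq)
    qed
    then show ?thesis using p.pos[OF v False] pos_divide_le_eq by blast
  qed
  have l: "0 < l"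
  proof -
    have "0 < l * Re (p x x)" using lower[OF x(1)] x(2) by linarith
    then show ?thesis using p.nonneg[OF x(1)] by (simp add: zero_less_mult_iff)
  qed
  define g where "g v w = h v w + of_real l * p v w" for v w
  interpret g: psd_form V g
  proof
    show "cv.subspace V" by (rule h.subspace)
    show "0 \<le> Re (g v v)" if "v \<in> V" for v using lower[OF that] by (simp add: g_def)
    show "g w v = cnj (g v w)" if "v \<in> V" "w \<in> V" for v w
      using that h.herm[OF that] p.herm[OF that] by (simp add: g_def)
  qed (simp_all add: g_def h.add_left p.add_left h.scale_left p.scale_left algebra_simps)
  \<comment> \<open>If \<open>g\<close> were definite, it would dominate a multiple of
    \<open>p\<close>, and \<open>l\<close> could be lowered.\<close>
  have "\<exists>z\<in>V. z \<noteq> 0 \<and> Re (g z z) = 0"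
  proof (rule ccontr)
    assume "\<not> ?thesis"
    then have "pos_form V g"
      using g.nonneg by unfold_locales (metis order_le_less)
    then obtain D where D: "D > 0" "\<And>v. v \<in> V \<Longrightarrow> \<bar>Re (p v v)\<bar> \<le> D * Re (g v v)"
      using form_bound[OF _ p.hermitian_form_axioms B] by blast
    \<comment> \<open>The bound 1 / D keeps the form nonnegative after lowering \<open>l\<close>, as
      \<open>p\<close> is at most D times \<open>g\<close>; the minimum with \<open>l\<close> keeps
      \<open>l - d\<close> nonnegative, as \<open>K\<close> demands.\<close>
    define d where "d = min (1 / D) l"
    have d: "0 < d" "d \<le> 1 / D" "d \<le> l" using D l by (auto simp: d_def)
    have "l - d \<in> K"
      unfolding K_def
    proof (intro CollectI conjI ballI)
      fix v assume v: "v \<in> V"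
      have "d * Re (p v v) \<le> 1 / D * Re (p v v)"
        using d p.nonneg[OF v] by (intro mult_right_mono)
      also have "\<dots> \<le> Re (g v v)" using D(2)[OF v] p.nonneg[OF v] D(1) by (simp add: field_simps)
      finally show "0 \<le> Re (h v v) + (l - d) * Re (p v v)" by (simp add: g_def algebra_simps)
    qed (use d in simp)
    then have "l \<le> l - d" unfolding l_def using bdd by (rule cInf_lower)
    then show False using d by simp
  qed
  then obtain z where z: "z \<in> V" "z \<noteq> 0" "Re (g z z) = 0" by blast
  define W where "W = {w \<in> V. \<forall>y\<in>V. g w y = 0}"
  \<comment> \<open>By Cauchy-Schwarz a null vector of a semidefinite form is orthogonal to
    everything.\<close>
  have zW: "z \<in> W"
    unfolding W_def
  proof (intro CollectI conjI ballI z(1))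
    fix y assume "y \<in> V"
    from g.Cauchy_Schwarz[OF z(1) this] z(3) show "g z y = 0" by simp
  qed
  have "cv.subspace W"
    unfolding W_def cv.subspace_def by (auto simp: g.mem g.zero_left g.add_left g.scale_left)
  then have W: "pos_form W p" by (rule pos_form_subset[OF p]) (auto simp: W_def)
  obtain m e where "orthonormal_basis W p m e"
    using exists_orthonormal_basis[OF B(1) _ W] B(2) unfolding W_def by blast
  then have e: "\<And>i. i < m \<Longrightarrow> e i \<in> W"
    "\<And>i j. i < m \<Longrightarrow> j < m \<Longrightarrow> p (e i) (e j) = (if i = j then 1 else 0)"
    "\<And>v. v \<in> W \<Longrightarrow> v = (\<Sum>i<m. p v (e i) *\<^sub>C e i)"
    unfolding orthonormal_basis_def by (blast, blast, blast)
  have W_iff: "w \<in> W \<longleftrightarrow> w \<in> V \<and> (\<forall>y\<in>V. h w y = - of_real l * p w y)" for w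
    unfolding W_def g_def by (auto simp: eq_neg_iff_add_eq_0)
  have "m > 0" using e(3)[OF zW] z(2) by (cases m) auto
  with l show ?thesis
    using e by (intro exI[of _ l] exI[of _ m] exI[of _ e]) (simp add: W_iff)
qed

section \<open>Unitarizability\<close>

lemma tensor_span_mono: "U \<subseteq> V \<Longrightarrow> tensor_span U \<subseteq> tensor_span V"
  unfolding tensor_span_def by (intro cv.span_mono) auto

lemma tensor_span_sum_mem:
  "(\<And>i. i \<in> I \<Longrightarrow> t i \<in> tensor_span V) \<Longrightarrow> (\<Sum>i\<in>I. t i) \<in> tensor_span V"
  unfolding tensor_span_def by (rule cv.span_sum)

lemma sweedler_on_setsum:
  assumes "cv.subspace V" "balanced_on V F" "finite I" "\<And>i. i \<in> I \<Longrightarrow> t i \<in> tensor_span V"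
  shows "sweedler_on V F (\<Sum>i\<in>I. t i) = (\<Sum>i\<in>I. sweedler_on V F (t i))"
  using assms(3,4)
proof (induction I rule: finite_induct)
  case empty
  then show ?case using sweedler_on_eq[OF assms(1,2), of "[]"] by simp
next
  case (insert i I)
  then show ?case
    using sweedler_on_add[OF assms(1,2), of "t i" "\<Sum>i\<in>I. t i"] tensor_span_sum_mem[of I t V]
    by simp
qed

text \<open>A representing list over \<open>U\<close> is also one over \<open>V\<close>, so both
  evaluations may use it.\<close>

lemma sweedler_on_restrict:
  assumes "cv.subspace V" "cv.subspace U" "U \<subseteq> V" "balanced_on V F" "t \<in> tensor_span U"
  shows "sweedler_on V F t = sweedler_on U F t"
proof -
  obtain l where l: "fst ` set l \<subseteq> U" "t = tensor_of_list l"
    using tensor_span_representable[OF assms(2,5)] by blast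
  moreover have "balanced_on U F" using assms(3,4) by (simp add: balanced_on_def subset_iff)
  ultimately show ?thesis using assms by (simp add: sweedler_on_eq subset_trans)
qed

lemma (in hermitian_form) balanced_form_left:
  assumes "clinear L" "w \<in> V"
  shows "balanced_on V (\<lambda>v b. h v w *\<^sub>C L b)"
  unfolding balanced_on_def clinear_add[OF assms(1)] clinear_scale[OF assms(1)]
  using assms(2)
  by (intro conjI ballI allI) (simp_all add: add_left scale_left cv.scale_left_distrib
      cv.scale_right_distrib mult.commute)

context hopf_star_algebra
begin

lemma balanced_form_right:
  assumes "hermitian_form V h" "v \<in> V"
  shows "balanced_on V (\<lambda>w b. h v w *\<^sub>C star b)"
proof -
  interpret hermitian_form V h by (rule assms)
  show ?thesis
    unfolding balanced_on_def star_add star_scaleC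
    using assms(2)
    by (intro conjI ballI allI) (simp_all add: add_right scale_right cv.scale_left_distrib
        cv.scale_right_distrib mult.commute)
qed

end

context compact_hopf_star_algebra
begin

text \<open>The scalar products of the simple summands are added up.\<close>

lemma comodule_unitarizable:
  fixes V :: "universe set"
  assumes V: "right_comodule \<Delta> \<epsilon> V \<delta>" and fd: "finite_dimensional V"
  shows "unitarizable S star V \<delta>"
proof -
  have subV: "cv.subspace V" and \<delta>_add: "\<And>v w. v \<in> V \<Longrightarrow> w \<in> V \<Longrightarrow> \<delta> (v + w) = \<delta> v + \<delta> w"
    and \<delta>_scale: "\<And>c v. v \<in> V \<Longrightarrow> \<delta> (c *\<^sub>C v) = c *\<^sub>C \<delta> v"
    using V unfolding right_comodule_def by blast+
  obtain n :: nat and U where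
    "(\<forall>i<n. subcomodule (U i) V \<delta> \<and> simple_right_comodule \<Delta> \<epsilon> (U i) \<delta>) \<and>
     (\<forall>v\<in>V. \<exists>!x. (\<forall>i<n. x i \<in> U i) \<and> (\<forall>i\<ge>n. x i = 0) \<and> v = (\<Sum>i<n. x i))"
    using cosemisimple[OF V fd] unfolding direct_sum_of_simples_def by (elim exE) (rule that)
  then have U: "\<And>i. i < n \<Longrightarrow> subcomodule (U i) V \<delta>"
    "\<And>i. i < n \<Longrightarrow> simple_right_comodule \<Delta> \<epsilon> (U i) \<delta>"
    and dec: "\<And>v. v \<in> V \<Longrightarrow> \<exists>!x. (\<forall>i<n. x i \<in> U i) \<and> (\<forall>i\<ge>n. x i = 0) \<and> v = (\<Sum>i<n. x i)"
    by simp_all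
  have subU: "cv.subspace (U i)" "U i \<subseteq> V" "\<And>u. u \<in> U i \<Longrightarrow> \<delta> u \<in> tensor_span (U i)"
    if "i < n" for i
    using U(1)[OF that] unfolding subcomodule_def by blast+
  have "\<exists>ip. scalar_product_on (U i) ip \<and> (\<forall>v\<in>U i. \<forall>w\<in>U i.
           sweedler_on (U i) (\<lambda>v0 v1. ip v0 w *\<^sub>C S v1) (\<delta> v) =
           sweedler_on (U i) (\<lambda>w0 w1. ip v w0 *\<^sub>C star w1) (\<delta> w))" if "i < n" for i
    using simple_unitarizable[OF U(2)[OF that]] unfolding unitarizable_def .
  then obtain ip where ip: "\<And>i. i < n \<Longrightarrow> scalar_product_on (U i) (ip i)"
    "\<And>i v w. i < n \<Longrightarrow> v \<in> U i \<Longrightarrow> w \<in> U i \<Longrightarrow>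
       sweedler_on (U i) (\<lambda>v0 v1. ip i v0 w *\<^sub>C S v1) (\<delta> v) =
       sweedler_on (U i) (\<lambda>w0 w1. ip i v w0 *\<^sub>C star w1) (\<delta> w)"
    by metis
  have form: "pos_form (U i) (ip i)" if "i < n" for i
    using ip(1)[OF that] subU(1)[OF that] by (simp add: pos_form_iff)
  then have formH: "hermitian_form (U i) (ip i)" if "i < n" for i
    using that pos_form.axioms(1) by blast
  \<comment> \<open>The components of \<open>v\<close>. That they vanish from n on is prescribed by
    the decomposition, which makes x unique as a function on all naturals.\<close>
  define X where "X v = (THE x. (\<forall>i<n. x i \<in> U i) \<and> (\<forall>i\<ge>n. x i = 0) \<and> v = (\<Sum>i<n. x i))" for v
  have X: "(\<forall>i<n. X v i \<in> U i) \<and> (\<forall>i\<ge>n. X v i = 0) \<and> v = (\<Sum>i<n. X v i)" if "v \<in> V" for v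
    unfolding X_def by (rule theI'[OF dec[OF that]])
  have XU: "X v i \<in> U i" if "v \<in> V" "i < n" for v i using X that by blast
  have XV: "X v i \<in> V" if "v \<in> V" "i < n" for v i using XU[OF that] subU(2)[OF that(2)] by blast
  have X_unique: "X v = x" if "v \<in> V" "\<And>i. i < n \<Longrightarrow> x i \<in> U i" "\<And>i. i \<ge> n \<Longrightarrow> x i = 0"
    "v = (\<Sum>i<n. x i)" for v x
    unfolding X_def using that by (intro the1_equality dec) auto
  have X_add: "X (v + w) = (\<lambda>i. X v i + X w i)" if "v \<in> V" "w \<in> V" for v w
  proof (rule X_unique)
    show "v + w \<in> V" using that by (rule cv.subspace_add[OF subV])
    show "X v i + X w i \<in> U i" if "i < n" for i
      using XU \<open>v \<in> V\<close> \<open>w \<in> V\<close> that by (intro cv.subspace_add subU) auto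
    show "X v i + X w i = 0" if "i \<ge> n" for i using X[OF \<open>v \<in> V\<close>] X[OF \<open>w \<in> V\<close>] that by simp
    show "v + w = (\<Sum>i<n. X v i + X w i)"
      unfolding sum.distrib using X[OF that(1)] X[OF that(2)] by metis
  qed
  have X_scale: "X (c *\<^sub>C v) = (\<lambda>i. c *\<^sub>C X v i)" if "v \<in> V" for c v
  proof (rule X_unique)
    show "c *\<^sub>C v \<in> V" using that by (rule cv.subspace_scale[OF subV])
    show "c *\<^sub>C X v i \<in> U i" if "i < n" for i
      using XU \<open>v \<in> V\<close> that by (intro cv.subspace_scale subU) auto
    show "c *\<^sub>C X v i = 0" if "i \<ge> n" for i using X[OF \<open>v \<in> V\<close>] that by simp
    show "c *\<^sub>C v = (\<Sum>i<n. c *\<^sub>C X v i)"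
      unfolding cv.scale_sum_right[symmetric] using X[OF that(1)] by metis
  qed
  have X_U: "X u = (\<lambda>j. if j = i then u else 0)" if "i < n" "u \<in> U i" for i u
  proof (rule X_unique)
    show "u \<in> V" using that subU(2) by blast
  qed (use that in \<open>auto simp: cv.subspace_0 subU\<close>)
  define h where "h v w = (\<Sum>i<n. ip i (X v i) (X w i))" for v w
  have hform: "pos_form V h"
  proof
    show "cv.subspace V" by (rule subV)
    show "h (u + v) w = h u w + h v w" if "u \<in> V" "v \<in> V" "w \<in> V" for u v w
      unfolding h_def X_add[OF that(1,2)] sum.distrib[symmetric]
      using that by (intro sum.cong refl) (auto intro!: hermitian_form.add_left[OF formH] XU)
    show "h (c *\<^sub>C v) w = c * h v w" if "v \<in> V" "w \<in> V" for c v w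
      unfolding h_def X_scale[OF that(1)] sum_distrib_left
      using that by (intro sum.cong refl) (auto intro!: hermitian_form.scale_left[OF formH] XU)
    show "h w v = cnj (h v w)" if "v \<in> V" "w \<in> V" for v w
      unfolding h_def cnj_sum
      using that by (intro sum.cong refl) (auto intro!: hermitian_form.herm[OF formH] XU)
    show "0 < Re (h v v)" if v: "v \<in> V" "v \<noteq> 0" for v
    proof -
      have "\<exists>i<n. X v i \<noteq> 0"
      proof (rule ccontr)
        assume "\<not> ?thesis"
        then have "(\<Sum>i<n. X v i) = 0" by simp
        then show False using X[OF v(1)] v(2) by metis
      qed
      then obtain i where i: "i < n" "X v i \<noteq> 0" by blast
      have "0 \<le> Re (ip j (X v j) (X v j))" if "j < n" for j
      proof -
        interpret j: pos_form "U j" "ip j" by (rule form[OF that])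
        show ?thesis by (rule j.nonneg[OF XU[OF v(1) that]])
      qed
      moreover have "0 < Re (ip i (X v i) (X v i))"
        by (rule pos_form.pos[OF form[OF i(1)] XU[OF v(1) i(1)] i(2)])
      ultimately show ?thesis
        unfolding h_def Re_sum using i(1) by (intro sum_pos2[of _ i]) auto
    qed
  qed
  interpret h: pos_form V h by (rule hform)
  have \<delta>_sum: "\<delta> v = (\<Sum>i<n. \<delta> (X v i))" if v: "v \<in> V" for v
  proof -
    have "\<delta> (\<Sum>i\<in>I. X v i) = (\<Sum>i\<in>I. \<delta> (X v i))" if "finite I" "I \<subseteq> {..<n}" for I
      using that
    proof (induction I rule: finite_induct)
      case empty
      then show ?case using \<delta>_scale[of 0 0] by (simp add: h.mem)
    next
      case (insert i I)
      then show ?case using v by (simp add: \<delta>_add XV h.mem subset_iff)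
    qed
    from this[of "{..<n}"] show ?thesis using X[OF v] by auto
  qed
  have \<delta>_span: "\<delta> (X v i) \<in> tensor_span (U i)" "\<delta> (X v i) \<in> tensor_span V"
    if "v \<in> V" "i < n" for v i
    using subU(3)[OF that(2) XU[OF that]] tensor_span_mono[OF subU(2)[OF that(2)]] by auto
  \<comment> \<open>The coaction keeps the comodule leg of the i-th component in \<open>U i\<close>,
    where all other components vanish; so only \<open>ip i\<close> sees it and no cross terms
    between summands arise.\<close>
  have left: "sweedler_on V (\<lambda>v0 v1. h v0 w *\<^sub>C S v1) (\<delta> v) =
      (\<Sum>i<n. sweedler_on (U i) (\<lambda>v0 v1. ip i v0 (X w i) *\<^sub>C S v1) (\<delta> (X v i)))"
    if "v \<in> V" "w \<in> V" for v w
  proof -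
    have bal: "balanced_on V (\<lambda>v0 v1. h v0 w *\<^sub>C S v1)"
      by (rule h.balanced_form_left[OF antipode_linear that(2)])
    have "sweedler_on V (\<lambda>v0 v1. h v0 w *\<^sub>C S v1) (\<delta> (X v i)) =
        sweedler_on (U i) (\<lambda>v0 v1. ip i v0 (X w i) *\<^sub>C S v1) (\<delta> (X v i))" if i: "i < n" for i
    proof -
      have "h u w = ip i u (X w i)" if u: "u \<in> U i" for u
      proof -
        have "h u w = (\<Sum>j<n. if j = i then ip i u (X w i) else 0)"
          unfolding h_def X_U[OF i u]
          using hermitian_form.zero_left[OF formH] XU[OF \<open>w \<in> V\<close>]
          by (intro sum.cong) auto
        then show ?thesis using i by simp
      qed
      then show ?thesis
        using \<delta>_span[OF \<open>v \<in> V\<close> i] subU[OF i]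
        by (subst sweedler_on_restrict[OF subV _ _ bal, of "U i"]) (auto intro!: sweedler_on_cong)
    qed
    then show ?thesis
      unfolding \<delta>_sum[OF that(1)] using \<delta>_span[OF that(1)]
      by (subst sweedler_on_setsum[OF subV bal]) auto
  qed
  have right: "sweedler_on V (\<lambda>w0 w1. h v w0 *\<^sub>C star w1) (\<delta> w) =
      (\<Sum>i<n. sweedler_on (U i) (\<lambda>w0 w1. ip i (X v i) w0 *\<^sub>C star w1) (\<delta> (X w i)))"
    if "v \<in> V" "w \<in> V" for v w
  proof -
    have bal: "balanced_on V (\<lambda>w0 w1. h v w0 *\<^sub>C star w1)"
      by (rule balanced_form_right[OF h.hermitian_form_axioms that(1)])
    have "sweedler_on V (\<lambda>w0 w1. h v w0 *\<^sub>C star w1) (\<delta> (X w i)) =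
        sweedler_on (U i) (\<lambda>w0 w1. ip i (X v i) w0 *\<^sub>C star w1) (\<delta> (X w i))" if i: "i < n" for i
    proof -
      have "h v u = ip i (X v i) u" if u: "u \<in> U i" for u
      proof -
        have "h v u = (\<Sum>j<n. if j = i then ip i (X v i) u else 0)"
          unfolding h_def X_U[OF i u]
          using hermitian_form.zero_right[OF formH] XU[OF \<open>v \<in> V\<close>]
          by (intro sum.cong) auto
        then show ?thesis using i by simp
      qed
      then show ?thesis
        using \<delta>_span[OF \<open>w \<in> V\<close> i] subU[OF i]
        by (subst sweedler_on_restrict[OF subV _ _ bal, of "U i"]) (auto intro!: sweedler_on_cong)
    qed
    then show ?thesis
      unfolding \<delta>_sum[OF that(2)] using \<delta>_span[OF that(2)]
      by (subst sweedler_on_setsum[OF subV bal]) auto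
  qed
  have "scalar_product_on V h" using hform by (simp add: pos_form_iff)
  moreover have "sweedler_on V (\<lambda>v0 v1. h v0 w *\<^sub>C S v1) (\<delta> v) =
      sweedler_on V (\<lambda>w0 w1. h v w0 *\<^sub>C star w1) (\<delta> w)" if "v \<in> V" "w \<in> V" for v w
    unfolding left[OF that] right[OF that]
    using that by (intro sum.cong refl ip(2) XU) auto
  ultimately show ?thesis unfolding unitarizable_def by blast
qed

end

section \<open>Corepresentations realized on coordinate spaces\<close>

definition coord_space :: "nat set \<Rightarrow> universe set" where
  "coord_space I = {p. Poly_Mapping.keys p \<subseteq> I}"

abbreviation unit_vec :: "nat \<Rightarrow> universe" where
  "unit_vec i \<equiv> Poly_Mapping.single i 1"

text \<open>The index type is left general, since the same facts serve vectors here and matrices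
  indexed by pairs below.\<close>

lemma subspace_keys: "cv.subspace {p :: 'i \<Rightarrow>\<^sub>0 complex. Poly_Mapping.keys p \<subseteq> I}"
proof (rule cv.subspaceI)
  show "x + y \<in> {p. Poly_Mapping.keys p \<subseteq> I}"
    if "x \<in> {p. Poly_Mapping.keys p \<subseteq> I}" "y \<in> {p. Poly_Mapping.keys p \<subseteq> I}"
    for x y :: "'i \<Rightarrow>\<^sub>0 complex"
    using that Poly_Mapping.keys_add[of x y] by auto
qed (auto simp: in_keys_iff subset_iff)

lemma keys_subset_expand:
  fixes p :: "'i \<Rightarrow>\<^sub>0 complex"
  assumes "finite I" "Poly_Mapping.keys p \<subseteq> I"
  shows "p = (\<Sum>i\<in>I. Poly_Mapping.lookup p i *\<^sub>C Poly_Mapping.single i 1)"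
proof (rule poly_mapping_eqI)
  fix k
  have "Poly_Mapping.lookup (\<Sum>i\<in>I. Poly_Mapping.lookup p i *\<^sub>C Poly_Mapping.single i (1::complex)) k
      = (\<Sum>i\<in>I. if i = k then Poly_Mapping.lookup p i else 0)"
    unfolding lookup_sum by (intro sum.cong) (auto simp: lookup_single when_def)
  also have "\<dots> = Poly_Mapping.lookup p k"
    using assms by (auto simp: subset_iff in_keys_iff)
  finally show "Poly_Mapping.lookup p k = Poly_Mapping.lookup (\<Sum>i\<in>I. Poly_Mapping.lookup p i *\<^sub>C Poly_Mapping.single i 1) k"
    by simp
qed

lemma keys_subset_span:
  assumes "finite I"
  shows "{p :: 'i \<Rightarrow>\<^sub>0 complex. Poly_Mapping.keys p \<subseteq> I}
    = cv.span ((\<lambda>i. Poly_Mapping.single i 1) ` I)"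
proof
  show "{p :: 'i \<Rightarrow>\<^sub>0 complex. Poly_Mapping.keys p \<subseteq> I} \<subseteq> cv.span ((\<lambda>i. Poly_Mapping.single i 1) ` I)"
  proof
    fix p :: "'i \<Rightarrow>\<^sub>0 complex" assume "p \<in> {p. Poly_Mapping.keys p \<subseteq> I}"
    then have "p = (\<Sum>i\<in>I. Poly_Mapping.lookup p i *\<^sub>C Poly_Mapping.single i 1)"
      using keys_subset_expand[OF assms] by simp
    moreover have "\<dots> \<in> cv.span ((\<lambda>i. Poly_Mapping.single i 1) ` I)"
      by (intro cv.span_sum cv.span_scale cv.span_base) simp
    ultimately show "p \<in> cv.span ((\<lambda>i. Poly_Mapping.single i 1) ` I)" by simp
  qed
  show "cv.span ((\<lambda>i. Poly_Mapping.single i 1) ` I) \<subseteq> {p :: 'i \<Rightarrow>\<^sub>0 complex. Poly_Mapping.keys p \<subseteq> I}"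
    by (rule cv.span_minimal[OF _ subspace_keys]) auto
qed

text \<open>Entry i of the matrix \<open>t\<close> applied to the column vector
  \<open>v\<close>.\<close>

definition corep_map :: "nat set \<Rightarrow> (nat \<Rightarrow> nat \<Rightarrow> 'h::complex_algebra_1) \<Rightarrow> universe \<Rightarrow> nat \<Rightarrow> 'h" where
  "corep_map I t v i = (\<Sum>k\<in>I. Poly_Mapping.lookup v k *\<^sub>C t i k)"

lemma corep_map_add: "corep_map I t (v + w) i = corep_map I t v i + corep_map I t w i"
  by (simp add: corep_map_def lookup_add cv.scale_left_distrib sum.distrib)

lemma corep_map_scale: "corep_map I t (c *\<^sub>C v) i = c *\<^sub>C corep_map I t v i"
  by (simp add: corep_map_def cv.scale_sum_right)

lemma corep_map_unit: "finite I \<Longrightarrow> k \<in> I \<Longrightarrow> corep_map I t (unit_vec k) i = t i k"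
proof -
  assume "finite I" "k \<in> I"
  moreover have "corep_map I t (unit_vec k) i = (\<Sum>j\<in>I. if j = k then t i j else 0)"
    unfolding corep_map_def by (intro sum.cong) (auto simp: lookup_single when_def)
  ultimately show ?thesis by simp
qed

definition corep_coaction :: "nat set \<Rightarrow> (nat \<Rightarrow> nat \<Rightarrow> 'h::complex_algebra_1) \<Rightarrow> universe \<Rightarrow> (universe, 'h) tensor" where
  "corep_coaction I t v = (\<Sum>i\<in>I. unit_vec i \<otimes> corep_map I t v i)"

context hopf_algebra
begin

text \<open>Moves a corepresentation into \<open>universe\<close>, the type over which
  cosemisimplicity and unitarizability are assumed.\<close>

lemma corep_comodule:
  assumes t: "corep \<Delta> \<epsilon> I t"
  shows "right_comodule \<Delta> \<epsilon> (coord_space I) (corep_coaction I t)"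
proof -
  let ?V = "coord_space I" and ?\<delta> = "corep_coaction I t"
  have fin: "finite I" and t1: "\<And>i j. i \<in> I \<Longrightarrow> j \<in> I \<Longrightarrow> \<Delta> (t i j) = (\<Sum>k\<in>I. t i k \<otimes> t k j)"
    and t2: "\<And>i j. i \<in> I \<Longrightarrow> j \<in> I \<Longrightarrow> \<epsilon> (t i j) = (if i = j then 1 else 0)"
    using t by (auto simp: corep_def)
  have sub: "cv.subspace ?V" unfolding coord_space_def by (rule subspace_keys)
  have unit: "unit_vec i \<in> ?V" if "i \<in> I" for i using that by (simp add: coord_space_def)
  have coassoc: "sweedler_on ?V (\<lambda>v0 v1. sweedler_on ?V (\<lambda>v00 v01. v00 \<otimes> v01 \<otimes> v1) (?\<delta> v0)) (?\<delta> v)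
      = sweedler_on ?V (\<lambda>v0 v1. v0 \<otimes> \<Delta> v1) (?\<delta> v)" for v
  proof -
    have inner: "sweedler_on ?V (\<lambda>v00 v01. v00 \<otimes> v01 \<otimes> v1) (?\<delta> v0)
        = (\<Sum>i\<in>I. unit_vec i \<otimes> corep_map I t v0 i \<otimes> v1)" for v0 and v1 :: 'h
      unfolding corep_coaction_def
      by (rule sweedler_on_sum[OF sub _ fin unit])
        (simp_all add: balanced_on_def tensor_add_left tensor_add_right tensor_scaleC_left tensor_scaleC_right)
    have "sweedler_on ?V (\<lambda>v0 v1. \<Sum>i\<in>I. unit_vec i \<otimes> corep_map I t v0 i \<otimes> v1) (?\<delta> v)
        = (\<Sum>j\<in>I. \<Sum>i\<in>I. unit_vec i \<otimes> corep_map I t (unit_vec j) i \<otimes> corep_map I t v j)"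
      unfolding corep_coaction_def[of I t v]
      by (rule sweedler_on_sum[OF sub _ fin unit])
        (simp_all add: balanced_on_def corep_map_add corep_map_scale tensor_add_left tensor_add_right
          tensor_scaleC_left tensor_scaleC_right sum.distrib)
    also have "\<dots> = (\<Sum>i\<in>I. unit_vec i \<otimes> (\<Sum>j\<in>I. t i j \<otimes> corep_map I t v j))"
      by (subst sum.swap) (simp add: tensor_sum_right corep_map_unit[OF fin])
    also have "\<dots> = (\<Sum>i\<in>I. unit_vec i \<otimes> \<Delta> (corep_map I t v i))"
    proof (rule sum.cong[OF refl])
      fix i assume i: "i \<in> I"
      have "\<Delta> (corep_map I t v i) = (\<Sum>k\<in>I. Poly_Mapping.lookup v k *\<^sub>C (\<Sum>j\<in>I. t i j \<otimes> t j k))"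
        unfolding corep_map_def clinear_sum[OF comult_linear] clinear_scale[OF comult_linear]
        by (intro sum.cong) (simp_all add: t1 i)
      also have "\<dots> = (\<Sum>j\<in>I. t i j \<otimes> corep_map I t v j)"
        unfolding corep_map_def tensor_sum_right cv.scale_sum_right tensor_scaleC_right
        by (rule sum.swap)
      finally show "unit_vec i \<otimes> (\<Sum>j\<in>I. t i j \<otimes> corep_map I t v j) = unit_vec i \<otimes> \<Delta> (corep_map I t v i)"
        by simp
    qed
    also have "\<dots> = sweedler_on ?V (\<lambda>v0 v1. v0 \<otimes> \<Delta> v1) (?\<delta> v)"
      unfolding corep_coaction_def
      by (rule sweedler_on_sum[OF sub _ fin unit, symmetric])
        (simp_all add: balanced_on_def clinear_add[OF comult_linear] clinear_scale[OF comult_linear]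
          tensor_add_left tensor_add_right tensor_scaleC_left tensor_scaleC_right)
    finally show ?thesis unfolding inner .
  qed
  have counit: "sweedler_on ?V (\<lambda>v0 v1. \<epsilon> v1 *\<^sub>C v0) (?\<delta> v) = v" if v: "v \<in> ?V" for v
  proof -
    have "sweedler_on ?V (\<lambda>v0 v1. \<epsilon> v1 *\<^sub>C v0) (?\<delta> v) = (\<Sum>i\<in>I. \<epsilon> (corep_map I t v i) *\<^sub>C unit_vec i)"
      unfolding corep_coaction_def
      by (rule sweedler_on_sum[OF sub _ fin unit])
        (simp_all add: balanced_on_def clinear_add[OF counit_linear] clinear_scale[OF counit_linear]
          cv.scale_left_distrib cv.scale_right_distrib mult.commute)
    also have "\<dots> = (\<Sum>i\<in>I. Poly_Mapping.lookup v i *\<^sub>C unit_vec i)"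
    proof (rule sum.cong[OF refl])
      fix i assume i: "i \<in> I"
      have "\<epsilon> (corep_map I t v i) = (\<Sum>k\<in>I. if k = i then Poly_Mapping.lookup v k else 0)"
        unfolding corep_map_def clinear_sum[OF counit_linear] clinear_scale[OF counit_linear]
        by (intro sum.cong) (auto simp: t2 i)
      then show "\<epsilon> (corep_map I t v i) *\<^sub>C unit_vec i = Poly_Mapping.lookup v i *\<^sub>C unit_vec i"
        using i fin by simp
    qed
    finally show ?thesis using keys_subset_expand[OF fin, of v] v by (simp add: coord_space_def)
  qed
  have "?\<delta> v \<in> tensor_span ?V" for v
    unfolding corep_coaction_def by (rule tensor_span_setsum[OF unit])
  moreover have "?\<delta> (v + w) = ?\<delta> v + ?\<delta> w" "?\<delta> (c *\<^sub>C v) = c *\<^sub>C ?\<delta> v" for v w c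
    by (simp_all add: corep_coaction_def corep_map_add corep_map_scale tensor_add_right sum.distrib
      tensor_scaleC_right cv.scale_sum_right)
  ultimately show ?thesis
    unfolding right_comodule_def using sub coassoc counit by blast
qed

text \<open>The conjugate transpose of \<open>u\<close> is its antipode, that is, its inverse. The
  antipode form is the one that simplifies a convolution.\<close>

definition unitary_corep :: "('h \<Rightarrow> 'h) \<Rightarrow> nat \<Rightarrow> (nat \<Rightarrow> nat \<Rightarrow> 'h) \<Rightarrow> bool" where
  "unitary_corep star n u \<longleftrightarrow> corep \<Delta> \<epsilon> {..<n} u \<and> (\<forall>i<n. \<forall>j<n. S (u i j) = star (u j i))"

end

section \<open>Unitary corepresentations and the invariant form of the conjugate\<close>

context compact_hopf_star_algebra
begin

text \<open>Unitarizability in coordinates, with the Sweedler sums evaluated.\<close>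

lemma corep_invariant_form:
  assumes t: "corep \<Delta> \<epsilon> I t"
  shows "\<exists>h. pos_form (coord_space I) h \<and> (\<forall>v\<in>coord_space I. \<forall>w\<in>coord_space I.
       (\<Sum>i\<in>I. h (unit_vec i) w *\<^sub>C S (corep_map I t v i)) =
       (\<Sum>i\<in>I. h v (unit_vec i) *\<^sub>C star (corep_map I t w i)))"
proof -
  let ?V = "coord_space I" and ?\<delta> = "corep_coaction I t"
  have fin: "finite I" using t by (simp add: corep_def)
  have "?V = cv.span (unit_vec ` I)"
    unfolding coord_space_def by (rule keys_subset_span[OF fin])
  then have "finite_dimensional ?V" using fin unfolding finite_dimensional_def by blast
  from comodule_unitarizable[OF corep_comodule[OF t] this]
  obtain h where h: "scalar_product_on ?V h"
    and inv: "\<And>v w. v \<in> ?V \<Longrightarrow> w \<in> ?V \<Longrightarrow>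
      sweedler_on ?V (\<lambda>v0 v1. h v0 w *\<^sub>C S v1) (?\<delta> v) = sweedler_on ?V (\<lambda>w0 w1. h v w0 *\<^sub>C star w1) (?\<delta> w)"
    unfolding unitarizable_def by blast
  have sub: "cv.subspace ?V" unfolding coord_space_def by (rule subspace_keys)
  have unit: "unit_vec i \<in> ?V" if "i \<in> I" for i using that by (simp add: coord_space_def)
  interpret pos_form ?V h using h sub by (simp add: pos_form_iff)
  have "(\<Sum>i\<in>I. h (unit_vec i) w *\<^sub>C S (corep_map I t v i)) =
       (\<Sum>i\<in>I. h v (unit_vec i) *\<^sub>C star (corep_map I t w i))" if "v \<in> ?V" "w \<in> ?V" for v w
  proof -
    have "sweedler_on ?V (\<lambda>v0 v1. h v0 w *\<^sub>C S v1) (?\<delta> v) =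
        (\<Sum>i\<in>I. h (unit_vec i) w *\<^sub>C S (corep_map I t v i))"
      unfolding corep_coaction_def
      by (rule sweedler_on_sum[OF sub balanced_form_left[OF antipode_linear that(2)] fin unit])
    moreover have "sweedler_on ?V (\<lambda>w0 w1. h v w0 *\<^sub>C star w1) (?\<delta> w) =
        (\<Sum>i\<in>I. h v (unit_vec i) *\<^sub>C star (corep_map I t w i))"
      unfolding corep_coaction_def
      by (rule sweedler_on_sum[OF sub balanced_form_right[OF hermitian_form_axioms that(1)] fin unit])
    ultimately show ?thesis using inv[OF that] by simp
  qed
  with pos_form_axioms show ?thesis by blast
qed

text \<open>A corepresentation becomes unitary in an orthonormal basis of an invariant scalar
  product: \<open>u\<close> is the product Z t Y, with \<open>Y\<close> and \<open>Z\<close> the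
  mutually inverse base change matrices.\<close>

lemma exists_unitary_corep:
  obtains n u c where "unitary_corep star n u" "a = (\<Sum>i<n. \<Sum>j<n. c i j *\<^sub>C u i j)"
proof -
  obtain I t d where t: "corep \<Delta> \<epsilon> I t" and a: "a = (\<Sum>i\<in>I. \<Sum>j\<in>I. d i j *\<^sub>C t i j)"
    by (rule exists_corep)
  have fin: "finite I" and t1: "\<And>i j. i \<in> I \<Longrightarrow> j \<in> I \<Longrightarrow> \<Delta> (t i j) = (\<Sum>k\<in>I. t i k \<otimes> t k j)"
    and t2: "\<And>i j. i \<in> I \<Longrightarrow> j \<in> I \<Longrightarrow> \<epsilon> (t i j) = (if i = j then 1 else 0)"
    using t by (auto simp: corep_def)
  let ?V = "coord_space I"
  obtain h where hf: "pos_form ?V h" and inv: "\<And>v w. v \<in> ?V \<Longrightarrow> w \<in> ?V \<Longrightarrow>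
       (\<Sum>i\<in>I. h (unit_vec i) w *\<^sub>C S (corep_map I t v i)) =
       (\<Sum>i\<in>I. h v (unit_vec i) *\<^sub>C star (corep_map I t w i))"
    using corep_invariant_form[OF t] by blast
  interpret pos_form ?V h by (rule hf)
  have unit: "unit_vec i \<in> ?V" if "i \<in> I" for i using that by (simp add: coord_space_def)
  have "?V \<subseteq> cv.span (unit_vec ` I)"
    unfolding coord_space_def using keys_subset_span[OF fin] by blast
  then obtain n f where "orthonormal_basis ?V h n f"
    using exists_orthonormal_basis[OF finite_imageI[OF fin] _ hf] by blast
  then have f: "\<And>i. i < n \<Longrightarrow> f i \<in> ?V"
    "\<And>i j. i < n \<Longrightarrow> j < n \<Longrightarrow> h (f i) (f j) = (if i = j then 1 else 0)"
    "\<And>v. v \<in> ?V \<Longrightarrow> v = (\<Sum>i<n. h v (f i) *\<^sub>C f i)"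
    unfolding orthonormal_basis_def by (blast, blast, blast)
  \<comment> \<open>Column i of \<open>Y\<close> holds the old coordinates of \<open>f i\<close>,
    column p of \<open>Z\<close> the new coordinates of \<open>unit_vec p\<close>.\<close>
  define Y where "Y q i = Poly_Mapping.lookup (f i) q" for q i
  define Z where "Z k p = h (unit_vec p) (f k)" for k p
  have YZ: "(\<Sum>k<n. Y q k * Z k p) = (if p = q then 1 else 0)" if "p \<in> I" for p q
  proof -
    have "Poly_Mapping.lookup (unit_vec p) q =
        Poly_Mapping.lookup (\<Sum>k<n. h (unit_vec p) (f k) *\<^sub>C f k) q"
      using f(3)[OF unit[OF that]] by simp
    then show ?thesis
      by (simp add: lookup_sum Y_def Z_def lookup_single when_def mult.commute)
  qed
  have ZY: "(\<Sum>p\<in>I. Z k p * Y p i) = (if i = k then 1 else 0)" if "k < n" "i < n" for k i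
  proof -
    have "h (f i) (f k) = h (\<Sum>p\<in>I. Y p i *\<^sub>C unit_vec p) (f k)"
      using keys_subset_expand[OF fin, of "f i"] f(1)[OF that(2)] by (simp add: coord_space_def Y_def)
    also have "\<dots> = (\<Sum>p\<in>I. Y p i * h (unit_vec p) (f k))"
      using unit f(1)[OF that(1)] by (rule lincomb_left)
    finally show ?thesis using that by (simp add: f(2) Z_def mult.commute)
  qed
  \<comment> \<open>\<open>tY\<close> and \<open>Zt\<close> are the two half-transformed matrices,
    one for each way of bracketing Z t Y.\<close>
  define tY where "tY p i = corep_map I t (f i) p" for p i
  have tY: "tY p i = (\<Sum>q\<in>I. Y q i *\<^sub>C t p q)" for p i
    by (simp add: tY_def corep_map_def Y_def)
  define Zt where "Zt k q = (\<Sum>p\<in>I. Z k p *\<^sub>C t p q)" for k q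
  define u where "u k i = (\<Sum>p\<in>I. Z k p *\<^sub>C tY p i)" for k i
  have u_Zt: "u k i = (\<Sum>q\<in>I. Y q i *\<^sub>C Zt k q)" for k i
    unfolding u_def tY Zt_def cv.scale_sum_right scaleC_scaleC
    by (subst sum.swap) (simp add: mult.commute)
  have Yu: "(\<Sum>l<n. Y r l *\<^sub>C u l i) = tY r i" if "r \<in> I" for r i
  proof -
    have "(\<Sum>l<n. Y r l *\<^sub>C u l i) = (\<Sum>p\<in>I. (\<Sum>l<n. Y r l * Z l p) *\<^sub>C tY p i)"
      unfolding u_def cv.scale_sum_right scaleC_scaleC cv.scale_sum_left by (rule sum.swap)
    also have "\<dots> = (\<Sum>p\<in>I. if p = r then tY p i else 0)"
      by (intro sum.cong) (auto simp: YZ)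
    finally show ?thesis using that fin by simp
  qed
  have \<Delta>tY: "\<Delta> (tY p i) = (\<Sum>r\<in>I. t p r \<otimes> tY r i)" if "p \<in> I" for p i
  proof -
    have "\<Delta> (tY p i) = (\<Sum>q\<in>I. Y q i *\<^sub>C (\<Sum>r\<in>I. t p r \<otimes> t r q))"
      unfolding tY clinear_sum[OF comult_linear] clinear_scale[OF comult_linear]
      by (intro sum.cong) (simp_all add: t1 that)
    also have "\<dots> = (\<Sum>r\<in>I. t p r \<otimes> tY r i)"
      unfolding tY tensor_sum_right tensor_scaleC_right cv.scale_sum_right by (rule sum.swap)
    finally show ?thesis .
  qed
  have "\<Delta> (u k i) = (\<Sum>l<n. u k l \<otimes> u l i)" for k i
  proof -
    have "\<Delta> (u k i) = (\<Sum>p\<in>I. Z k p *\<^sub>C (\<Sum>r\<in>I. t p r \<otimes> tY r i))"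
      unfolding u_def clinear_sum[OF comult_linear] clinear_scale[OF comult_linear]
      by (intro sum.cong) (simp_all add: \<Delta>tY)
    also have "\<dots> = (\<Sum>r\<in>I. Zt k r \<otimes> tY r i)"
      unfolding Zt_def tensor_sum_left tensor_scaleC_left cv.scale_sum_right by (rule sum.swap)
    also have "\<dots> = (\<Sum>r\<in>I. Zt k r \<otimes> (\<Sum>l<n. Y r l *\<^sub>C u l i))"
      by (intro sum.cong refl) (simp add: Yu)
    also have "\<dots> = (\<Sum>l<n. \<Sum>r\<in>I. Y r l *\<^sub>C (Zt k r \<otimes> u l i))"
      unfolding tensor_sum_right tensor_scaleC_right by (rule sum.swap)
    also have "\<dots> = (\<Sum>l<n. u k l \<otimes> u l i)"
      unfolding u_Zt[of k] tensor_sum_left tensor_scaleC_left ..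
    finally show ?thesis .
  qed
  moreover have "\<epsilon> (u k i) = (if k = i then 1 else 0)" if "k < n" "i < n" for k i
  proof -
    have "\<epsilon> (tY p i) = Y p i" if "p \<in> I" for p
    proof -
      have "\<epsilon> (tY p i) = (\<Sum>q\<in>I. if q = p then Y q i else 0)"
        unfolding tY clinear_sum[OF counit_linear] clinear_scale[OF counit_linear]
        by (intro sum.cong) (auto simp: t2 that)
      then show ?thesis using that fin by simp
    qed
    then have "\<epsilon> (u k i) = (\<Sum>p\<in>I. Z k p * Y p i)"
      unfolding u_def clinear_sum[OF counit_linear] clinear_scale[OF counit_linear] by simp
    then show ?thesis using ZY[OF that] by auto
  qed
  moreover have "S (u i j) = star (u j i)" if "i < n" "j < n" for i j
  proof -
    have "S (u i j) = (\<Sum>p\<in>I. h (unit_vec p) (f i) *\<^sub>C S (corep_map I t (f j) p))"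
      unfolding u_def clinear_sum[OF antipode_linear] clinear_scale[OF antipode_linear] Z_def tY_def ..
    \<comment> \<open>Invariance at the basis vectors \<open>f j\<close> and \<open>f i\<close> is
      unitarity of \<open>u\<close>.\<close>
    also have "\<dots> = (\<Sum>p\<in>I. h (f j) (unit_vec p) *\<^sub>C star (corep_map I t (f i) p))"
      by (rule inv[OF f(1) f(1)]) (use that in auto)
    also have "\<dots> = (\<Sum>p\<in>I. cnj (Z j p) *\<^sub>C star (tY p i))"
      unfolding Z_def tY_def
      using herm[OF unit f(1)[OF that(2)]] by (intro sum.cong) auto
    also have "\<dots> = star (u j i)"
      unfolding u_def by (simp add: star_sum star_scaleC)
    finally show ?thesis .
  qed
  ultimately have "unitary_corep star n u" by (simp add: unitary_corep_def corep_def)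
  \<comment> \<open>The base change is inverted: t is Y u Z.\<close>
  moreover have "a = (\<Sum>k<n. \<Sum>i<n. (\<Sum>p\<in>I. \<Sum>q\<in>I. d p q * (Y p k * Z i q)) *\<^sub>C u k i)"
  proof -
    have tu: "t p q = (\<Sum>k<n. \<Sum>i<n. (Y p k * Z i q) *\<^sub>C u k i)" if "p \<in> I" "q \<in> I" for p q
    proof -
      have "(\<Sum>k<n. \<Sum>i<n. (Y p k * Z i q) *\<^sub>C u k i) = (\<Sum>i<n. Z i q *\<^sub>C (\<Sum>k<n. Y p k *\<^sub>C u k i))"
        by (subst sum.swap) (simp add: cv.scale_sum_right mult.commute)
      also have "\<dots> = (\<Sum>i<n. Z i q *\<^sub>C tY p i)" by (simp add: Yu that)
      also have "\<dots> = (\<Sum>r\<in>I. (\<Sum>i<n. Y r i * Z i q) *\<^sub>C t p r)"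
        unfolding tY cv.scale_sum_right cv.scale_sum_left scaleC_scaleC
        by (subst sum.swap) (simp add: mult.commute)
      also have "\<dots> = (\<Sum>r\<in>I. if r = q then t p r else 0)"
        by (intro sum.cong) (auto simp: YZ that)
      finally show ?thesis using that fin by simp
    qed
    have "a = (\<Sum>p\<in>I. \<Sum>q\<in>I. \<Sum>k<n. \<Sum>i<n. (d p q * (Y p k * Z i q)) *\<^sub>C u k i)"
      unfolding a by (intro sum.cong refl) (simp add: tu cv.scale_sum_right)
    also have "\<dots> = (\<Sum>p\<in>I. \<Sum>k<n. \<Sum>q\<in>I. \<Sum>i<n. (d p q * (Y p k * Z i q)) *\<^sub>C u k i)"
      by (rule sum.cong[OF refl], rule sum.swap)
    also have "\<dots> = (\<Sum>k<n. \<Sum>p\<in>I. \<Sum>i<n. \<Sum>q\<in>I. (d p q * (Y p k * Z i q)) *\<^sub>C u k i)"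
      by (rule trans[OF sum.swap], rule sum.cong[OF refl], rule sum.cong[OF refl], rule sum.swap)
    also have "\<dots> = (\<Sum>k<n. \<Sum>i<n. \<Sum>p\<in>I. \<Sum>q\<in>I. (d p q * (Y p k * Z i q)) *\<^sub>C u k i)"
      by (rule sum.cong[OF refl], rule sum.swap)
    finally show ?thesis by (simp add: cv.scale_sum_left)
  qed
  ultimately show ?thesis by (rule that)
qed

text \<open>The conjugate of a unitary corepresentation need not be unitary, and its invariant form
  \<open>Q\<close> enters as a weight. Once integrated, the identity gives known values for the
  \<open>Q\<close>-weighted sums of the \<open>ip (u k j) (u i l)\<close>; positivity of the
  integral form rests on them.\<close>

lemma conjugate_form:
  assumes u: "unitary_corep star n u"
  obtains Q where "pos_form (coord_space {..<n}) Q"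
    "\<And>j l. j < n \<Longrightarrow> l < n \<Longrightarrow>
       (\<Sum>i<n. \<Sum>k<n. Q (unit_vec i) (unit_vec k) *\<^sub>C (u k j * star (u i l))) =
       Q (unit_vec l) (unit_vec j) *\<^sub>C 1"
proof -
  let ?V = "coord_space {..<n}"
  have ubar: "corep \<Delta> \<epsilon> {..<n} (\<lambda>i j. star (u i j))"
    by (rule corep_star) (use u in \<open>simp add: unitary_corep_def\<close>)
  obtain Q where Q: "pos_form ?V Q" and inv: "\<And>v w. v \<in> ?V \<Longrightarrow> w \<in> ?V \<Longrightarrow>
       (\<Sum>i<n. Q (unit_vec i) w *\<^sub>C S (corep_map {..<n} (\<lambda>i j. star (u i j)) v i)) =
       (\<Sum>i<n. Q v (unit_vec i) *\<^sub>C star (corep_map {..<n} (\<lambda>i j. star (u i j)) w i))"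
    using corep_invariant_form[OF ubar] by blast
  have unit: "unit_vec i \<in> ?V" if "i < n" for i using that by (simp add: coord_space_def)
  have *: "(\<Sum>k<n. Q (unit_vec k) (unit_vec j) *\<^sub>C S (star (u k i))) =
       (\<Sum>k<n. Q (unit_vec i) (unit_vec k) *\<^sub>C u k j)" if "i < n" "j < n" for i j
    using inv[OF unit[OF that(1)] unit[OF that(2)]] that by (simp add: corep_map_unit star_star)
  have "(\<Sum>i<n. \<Sum>k<n. Q (unit_vec i) (unit_vec k) *\<^sub>C (u k j * star (u i l))) =
       Q (unit_vec l) (unit_vec j) *\<^sub>C 1" if jl: "j < n" "l < n" for j l
  proof -
    \<comment> \<open>Multiplying the invariance identity by \<open>star (u i l)\<close> and summing
      over i lets the antipode axiom of the conjugate corepresentation act.\<close>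
    have "(\<Sum>i<n. \<Sum>k<n. Q (unit_vec i) (unit_vec k) *\<^sub>C (u k j * star (u i l))) =
        (\<Sum>i<n. (\<Sum>k<n. Q (unit_vec i) (unit_vec k) *\<^sub>C u k j) * star (u i l))"
      by (simp add: sum_distrib_right mult_scaleC_left)
    also have "\<dots> = (\<Sum>i<n. (\<Sum>k<n. Q (unit_vec k) (unit_vec j) *\<^sub>C S (star (u k i))) * star (u i l))"
      using jl by (intro sum.cong refl) (simp add: *)
    also have "\<dots> = (\<Sum>k<n. Q (unit_vec k) (unit_vec j) *\<^sub>C (\<Sum>i<n. S (star (u k i)) * star (u i l)))"
      unfolding sum_distrib_right mult_scaleC_left cv.scale_sum_right by (rule sum.swap)
    also have "\<dots> = (\<Sum>k<n. if k = l then Q (unit_vec k) (unit_vec j) *\<^sub>C 1 else 0)"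
      using jl by (intro sum.cong refl) (simp add: corep_antipode_left[OF ubar])
    finally show ?thesis using jl by simp
  qed
  with Q show ?thesis by (rule that)
qed

end

section \<open>The form given by the integral\<close>

locale compact_hopf_integral = compact_hopf_star_algebra \<Delta> \<epsilon> S star
  for \<Delta> :: "'h::complex_algebra_1 \<Rightarrow> ('h, 'h) tensor" and \<epsilon> S star +
  fixes \<phi> :: "'h \<Rightarrow> complex"
  assumes integral: "hopf_integral \<Delta> \<phi>" and normalized: "\<phi> 1 = 1"
begin

lemma integral_linear: "clinear \<phi>"
  using integral by (simp add: hopf_integral_def)

lemma integral_left_sum:
  assumes "finite I" "\<Delta> a = (\<Sum>i\<in>I. x i \<otimes> y i)"
  shows "(\<Sum>i\<in>I. \<phi> (y i) *\<^sub>C x i) = \<phi> a *\<^sub>C 1"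
proof -
  have "sweedler (\<lambda>x1 x2. \<phi> x2 *\<^sub>C x1) (\<Delta> a) = \<phi> a *\<^sub>C 1"
    using integral unfolding hopf_integral_def by blast
  then show ?thesis
    by (simp add: assms sweedler_sum[OF cbilinear_balanced[OF cbilinear_slice_right[OF integral_linear]]])
qed

lemma integral_right_sum:
  assumes "finite I" "\<Delta> a = (\<Sum>i\<in>I. x i \<otimes> y i)"
  shows "(\<Sum>i\<in>I. \<phi> (x i) *\<^sub>C y i) = \<phi> a *\<^sub>C 1"
proof -
  have "sweedler (\<lambda>x1 x2. \<phi> x1 *\<^sub>C x2) (\<Delta> a) = \<phi> a *\<^sub>C 1"
    using integral unfolding hopf_integral_def by blast
  then show ?thesis
    by (simp add: assms sweedler_sum[OF cbilinear_balanced[OF cbilinear_slice_left[OF integral_linear]]])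
qed

text \<open>The functional \<open>x \<mapsto> cnj (\<phi> (star x))\<close> is again a normalized integral, so the usual
  uniqueness argument applies.\<close>

lemma integral_star: "\<phi> (star a) = cnj (\<phi> a)"
proof -
  obtain I t c where t: "corep \<Delta> \<epsilon> I t" and a: "a = (\<Sum>i\<in>I. \<Sum>j\<in>I. c i j *\<^sub>C t i j)"
    by (rule exists_corep)
  define \<psi> where "\<psi> x = cnj (\<phi> (star x))" for x
  have \<psi>: "clinear \<psi>"
    by (rule clinearI)
      (simp_all add: \<psi>_def star_add star_scaleC clinear_add[OF integral_linear] clinear_scale[OF integral_linear])
  have fin: "finite I" and t1: "\<And>i j. i \<in> I \<Longrightarrow> j \<in> I \<Longrightarrow> \<Delta> (t i j) = (\<Sum>k\<in>I. t i k \<otimes> t k j)"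
    using t by (auto simp: corep_def)
  have "\<psi> (t i j) = \<phi> (t i j)" if ij: "i \<in> I" "j \<in> I" for i j
  proof -
    \<comment> \<open>The sum over k of \<phi> (t i k) * \<psi> (t k j) equals \<phi> (t i j) by
      right invariance of \<phi> and \<psi> (t i j) by left invariance of \<psi>.\<close>
    have "\<psi> (\<Sum>k\<in>I. \<phi> (t i k) *\<^sub>C t k j) = \<psi> (\<phi> (t i j) *\<^sub>C 1)"
      by (simp only: integral_right_sum[OF fin t1[OF ij]])
    then have 1: "(\<Sum>k\<in>I. \<phi> (t i k) * \<psi> (t k j)) = \<phi> (t i j)"
      by (simp add: clinear_sum[OF \<psi>] clinear_scale[OF \<psi>] \<psi>_def[of 1] star_one normalized)
    have "star (\<Sum>k\<in>I. \<phi> (star (t k j)) *\<^sub>C star (t i k)) = star (\<phi> (star (t i j)) *\<^sub>C 1)"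
      by (simp only: integral_left_sum[OF fin comult_star_sum[OF fin t1[OF ij]]])
    then have "(\<Sum>k\<in>I. \<psi> (t k j) *\<^sub>C t i k) = \<psi> (t i j) *\<^sub>C 1"
      by (simp add: star_sum star_scaleC star_star star_one \<psi>_def)
    then have "\<phi> (\<Sum>k\<in>I. \<psi> (t k j) *\<^sub>C t i k) = \<phi> (\<psi> (t i j) *\<^sub>C 1)" by simp
    then have "(\<Sum>k\<in>I. \<phi> (t i k) * \<psi> (t k j)) = \<psi> (t i j)"
      by (simp add: clinear_sum[OF integral_linear] clinear_scale[OF integral_linear] normalized mult.commute)
    with 1 show ?thesis by simp
  qed
  then have "\<psi> a = \<phi> a"
    unfolding a clinear_sum[OF \<psi>] clinear_scale[OF \<psi>] clinear_sum[OF integral_linear]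
      clinear_scale[OF integral_linear] by simp
  then show ?thesis unfolding \<psi>_def by (metis complex_cnj_cnj)
qed

definition ip :: "'h \<Rightarrow> 'h \<Rightarrow> complex" where
  "ip a b = \<phi> (a * star b)"

sublocale ip: hermitian_form UNIV ip
proof
  show "ip b a = cnj (ip a b)" for a b
    using integral_star[of "a * star b"] by (simp add: ip_def star_mult star_star)
qed (simp_all add: ip_def algebra_simps mult_scaleC_left clinear_add[OF integral_linear]
    clinear_scale[OF integral_linear])

lemma comult_mult_sum:
  assumes "finite I" "\<Delta> a = (\<Sum>i\<in>I. x i \<otimes> y i)" "finite J" "\<Delta> b = (\<Sum>j\<in>J. z j \<otimes> w j)"
  shows "\<Delta> (a * b) = (\<Sum>i\<in>I. \<Sum>j\<in>J. (x i * z j) \<otimes> (y i * w j))"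
proof -
  have bil: "cbilinear (\<lambda>y1 y2. (p * y1) \<otimes> (q * y2))" for p q :: 'h
    by (rule cbilinearI) (simp_all add: distrib_left mult_scaleC_right tensor_add_left
        tensor_add_right tensor_scaleC_left tensor_scaleC_right)
  have inner: "sweedler (\<lambda>y1 y2. (p * y1) \<otimes> (q * y2)) (\<Delta> b) =
      (\<Sum>j\<in>J. (p * z j) \<otimes> (q * w j))" for p q
    unfolding assms(4) by (rule sweedler_sum[OF cbilinear_balanced[OF bil] assms(3)])
  have "cbilinear (\<lambda>x1 x2. \<Sum>j\<in>J. (x1 * z j) \<otimes> (x2 * w j))"
    by (rule cbilinearI) (simp_all add: distrib_right mult_scaleC_left tensor_add_left
        tensor_add_right tensor_scaleC_left tensor_scaleC_right sum.distrib cv.scale_sum_right)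
  then show ?thesis
    unfolding comult_mult inner assms(2) by (rule sweedler_sum[OF cbilinear_balanced _]) (rule assms(1))
qed

lemma unitaryD:
  assumes "unitary_corep star n u" "i < n" "j < n"
  shows "\<Delta> (u i j) = (\<Sum>k<n. u i k \<otimes> u k j)" "S (u i j) = star (u j i)"
    "(\<Sum>k<n. star (u k i) * u k j) = (if i = j then 1 else 0)"
proof -
  show "\<Delta> (u i j) = (\<Sum>k<n. u i k \<otimes> u k j)" "S (u i j) = star (u j i)"
    using assms by (simp_all add: unitary_corep_def corep_def)
  have "(\<Sum>k<n. star (u k i) * u k j) = (\<Sum>k<n. S (u i k) * u k j)"
    using assms by (intro sum.cong) (simp_all add: unitary_corep_def)
  also have "\<dots> = (if i = j then 1 else 0)"
    using assms by (intro corep_antipode_left[of "{..<n}"]) (simp_all add: unitary_corep_def)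
  finally show "(\<Sum>k<n. star (u k i) * u k j) = (if i = j then 1 else 0)" .
qed

text \<open>Indexed by pairs so that \<open>integral_left_sum\<close>, which takes a single index
  set, applies.\<close>

lemma comult_mult_star:
  assumes "unitary_corep star m v" "unitary_corep star n u" "p < m" "q < m" "k < n" "i < n"
  shows "\<Delta> (v p q * star (u k i)) =
    (\<Sum>(r, s)\<in>{..<m} \<times> {..<n}. (v p r * star (u k s)) \<otimes> (v r q * star (u s i)))"
  by (simp add: comult_mult_sum[OF finite_lessThan unitaryD(1)[OF assms(1,3,4)] finite_lessThan
        comult_star_sum[OF finite_lessThan unitaryD(1)[OF assms(2,5,6)]]] sum.cartesian_product)

text \<open>Left invariance at \<open>v p q * star (u k i)\<close>, multiplied on the right by
  \<open>u k j\<close> and summed over k: unitarity of \<open>u\<close> collapses the products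
  \<open>star (u k s) * u k j\<close> to the term with s = j.\<close>

lemma strong_invariance:
  assumes v: "unitary_corep star m v" and u: "unitary_corep star n u"
    and "p < m" "q < m" "i < n" "j < n"
  shows "(\<Sum>k<n. ip (v p q) (u k i) *\<^sub>C u k j) = (\<Sum>r<m. ip (v r q) (u j i) *\<^sub>C v p r)"
proof -
  have inv: "ip (v p q) (u k i) *\<^sub>C 1 =
      (\<Sum>r<m. \<Sum>s<n. ip (v r q) (u s i) *\<^sub>C (v p r * star (u k s)))" if "k < n" for k
  proof -
    have "(\<Sum>rs\<in>{..<m} \<times> {..<n}. \<phi> (v (fst rs) q * star (u (snd rs) i)) *\<^sub>C
        (v p (fst rs) * star (u k (snd rs)))) = \<phi> (v p q * star (u k i)) *\<^sub>C 1"
      by (rule integral_left_sum) (simp_all add: comult_mult_star[OF v u assms(3,4) that assms(5)] case_prod_beta)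
    then show ?thesis by (simp add: ip_def sum.cartesian_product case_prod_beta)
  qed
  have "(\<Sum>k<n. ip (v p q) (u k i) *\<^sub>C u k j) = (\<Sum>k<n. (ip (v p q) (u k i) *\<^sub>C 1) * u k j)"
    by (simp add: mult_scaleC_left)
  also have "\<dots> = (\<Sum>k<n. \<Sum>r<m. \<Sum>s<n. ip (v r q) (u s i) *\<^sub>C (v p r * (star (u k s) * u k j)))"
    by (intro sum.cong refl) (simp add: inv sum_distrib_right mult_scaleC_left mult.assoc)
  also have "\<dots> = (\<Sum>r<m. \<Sum>k<n. \<Sum>s<n. ip (v r q) (u s i) *\<^sub>C (v p r * (star (u k s) * u k j)))"
    by (rule sum.swap)
  also have "\<dots> = (\<Sum>r<m. \<Sum>s<n. \<Sum>k<n. ip (v r q) (u s i) *\<^sub>C (v p r * (star (u k s) * u k j)))"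
    by (rule sum.cong[OF refl], rule sum.swap)
  also have "\<dots> = (\<Sum>r<m. \<Sum>s<n. ip (v r q) (u s i) *\<^sub>C (v p r * (\<Sum>k<n. star (u k s) * u k j)))"
    by (simp add: sum_distrib_left cv.scale_sum_right)
  also have "\<dots> = (\<Sum>r<m. \<Sum>s<n. if s = j then ip (v r q) (u s i) *\<^sub>C v p r else 0)"
    using assms(6) by (intro sum.cong refl) (simp add: unitaryD(3)[OF u])
  also have "\<dots> = (\<Sum>r<m. ip (v r q) (u j i) *\<^sub>C v p r)"
    using assms(6) by simp
  finally show ?thesis .
qed

end

section \<open>Coefficient matrices with their standard scalar product\<close>

definition mat_space :: "nat \<Rightarrow> ((nat \<times> nat) \<Rightarrow>\<^sub>0 complex) set" where
  "mat_space n = {x. Poly_Mapping.keys x \<subseteq> {..<n} \<times> {..<n}}"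

definition mat_ip :: "nat \<Rightarrow> ((nat \<times> nat) \<Rightarrow>\<^sub>0 complex) \<Rightarrow> ((nat \<times> nat) \<Rightarrow>\<^sub>0 complex) \<Rightarrow> complex" where
  "mat_ip n x y = (\<Sum>p<n. \<Sum>q<n. Poly_Mapping.lookup x (p, q) * cnj (Poly_Mapping.lookup y (p, q)))"

lemma subspace_mat_space: "cv.subspace (mat_space n)"
  unfolding mat_space_def by (rule subspace_keys)

lemma mat_space_eqI:
  assumes "x \<in> mat_space n" "y \<in> mat_space n"
    "\<And>p q. p < n \<Longrightarrow> q < n \<Longrightarrow> Poly_Mapping.lookup x (p, q) = Poly_Mapping.lookup y (p, q)"
  shows "x = y"
proof (rule poly_mapping_eqI)
  fix k
  show "Poly_Mapping.lookup x k = Poly_Mapping.lookup y k"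
  proof (cases "k \<in> {..<n} \<times> {..<n}")
    case True
    then show ?thesis using assms(3) by auto
  next
    case False
    then have "k \<notin> Poly_Mapping.keys x" "k \<notin> Poly_Mapping.keys y"
      using assms(1,2) unfolding mat_space_def by blast+
    then show ?thesis by (simp add: in_keys_iff)
  qed
qed

lemma mat_ip_pos_form: "pos_form (mat_space n) (mat_ip n)"
proof
  show "cv.subspace (mat_space n)" by (rule subspace_mat_space)
  show "0 < Re (mat_ip n x x)" if x: "x \<in> mat_space n" "x \<noteq> 0" for x
  proof -
    have r: "Re (mat_ip n x x) = (\<Sum>p<n. \<Sum>q<n. (cmod (Poly_Mapping.lookup x (p, q)))\<^sup>2)"
      unfolding mat_ip_def complex_norm_square[symmetric] by simp
    have "Re (mat_ip n x x) \<noteq> 0"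
    proof
      assume "Re (mat_ip n x x) = 0"
      then have "\<forall>p<n. \<forall>q<n. Poly_Mapping.lookup x (p, q) = 0"
        unfolding r by (simp add: sum_nonneg_eq_0_iff sum_nonneg)
      then have "x = 0"
        by (intro mat_space_eqI[OF x(1)]) (auto simp: mat_space_def)
      then show False using x(2) by simp
    qed
    moreover have "0 \<le> Re (mat_ip n x x)" unfolding r by (intro sum_nonneg) auto
    ultimately show ?thesis by simp
  qed
qed (simp_all add: mat_ip_def lookup_add algebra_simps sum.distrib sum_distrib_left)

definition mat :: "nat \<Rightarrow> (nat \<Rightarrow> nat \<Rightarrow> complex) \<Rightarrow> (nat \<times> nat) \<Rightarrow>\<^sub>0 complex" where
  "mat n c = (\<Sum>p<n. \<Sum>q<n. c p q *\<^sub>C Poly_Mapping.single (p, q) 1)"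

lemma lookup_mat: "p < n \<Longrightarrow> q < n \<Longrightarrow> Poly_Mapping.lookup (mat n c) (p, q) = c p q"
proof -
  assume pq: "p < n" "q < n"
  have "Poly_Mapping.lookup (mat n c) (p, q) = (\<Sum>p'<n. \<Sum>q'<n. if q' = q then if p' = p then c p' q' else 0 else 0)"
    unfolding mat_def lookup_sum by (intro sum.cong refl) (auto simp: lookup_single when_def)
  then show ?thesis using pq by simp
qed

lemma mat_mem: "mat n c \<in> mat_space n"
  unfolding mat_def
  by (intro cv.subspace_sum[OF subspace_mat_space] cv.subspace_scale[OF subspace_mat_space])
    (simp add: mat_space_def)

text \<open>The transpose of \<open>m\<close> times \<open>x\<close>. For
  \<open>m p r = \<omega> (u p r)\<close> it is the map (\<omega> \<otimes> id) \<Delta> written on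
  coefficient matrices.\<close>

definition slice :: "nat \<Rightarrow> (nat \<Rightarrow> nat \<Rightarrow> complex) \<Rightarrow> ((nat \<times> nat) \<Rightarrow>\<^sub>0 complex) \<Rightarrow> (nat \<times> nat) \<Rightarrow>\<^sub>0 complex" where
  "slice n m x = mat n (\<lambda>r q. \<Sum>p<n. m p r * Poly_Mapping.lookup x (p, q))"

text \<open>For unitary \<open>u\<close> the adjoint of a slice by a functional is again a slice by
  a functional, which is what makes the projection onto a stable eigenspace commute with
  slices.\<close>

lemma mat_ip_slice:
  "mat_ip n (slice n m x) y = mat_ip n x (slice n (\<lambda>p r. cnj (m r p)) y)"
proof -
  have "mat_ip n (slice n m x) y =
      (\<Sum>r<n. \<Sum>q<n. \<Sum>p<n. m p r * Poly_Mapping.lookup x (p, q) * cnj (Poly_Mapping.lookup y (r, q)))"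
    unfolding mat_ip_def slice_def by (intro sum.cong refl) (simp add: lookup_mat sum_distrib_right)
  also have "\<dots> = (\<Sum>r<n. \<Sum>p<n. \<Sum>q<n. m p r * Poly_Mapping.lookup x (p, q) * cnj (Poly_Mapping.lookup y (r, q)))"
    by (rule sum.cong[OF refl], rule sum.swap)
  also have "\<dots> = (\<Sum>p<n. \<Sum>r<n. \<Sum>q<n. m p r * Poly_Mapping.lookup x (p, q) * cnj (Poly_Mapping.lookup y (r, q)))"
    by (rule sum.swap)
  also have "\<dots> = (\<Sum>p<n. \<Sum>q<n. \<Sum>r<n. m p r * Poly_Mapping.lookup x (p, q) * cnj (Poly_Mapping.lookup y (r, q)))"
    by (rule sum.cong[OF refl], rule sum.swap)
  also have "\<dots> = mat_ip n x (slice n (\<lambda>p r. cnj (m r p)) y)"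
    unfolding mat_ip_def slice_def
    by (intro sum.cong refl) (simp add: lookup_mat sum_distrib_left mult.assoc mult.left_commute)
  finally show ?thesis .
qed

section \<open>Positivity of the integral form\<close>

context compact_hopf_integral
begin

text \<open>If the form were not positive semidefinite on the coefficients of \<open>u\<close>, it would have an
  eigenspace of a negative eigenvalue, with respect to the standard scalar product on
  \<open>n \<times> n\<close> matrices. This eigenspace is stable under the coaction on the row index, hence so is
  the orthogonal projection T onto it. The images under T of the matrix units in the column y
  are therefore linear combinations of the coefficients in a single row of \<open>u\<close>, and the form
  weighted by the invariant form Q of the conjugate corepresentation is at once negative and
  nonnegative on them.\<close>

lemma ip_nonneg: "0 \<le> Re (ip a a)"
proof (rule ccontr)
  assume neg: "\<not> ?thesis"
  obtain n u c where u: "unitary_corep star n u" and a: "a = (\<Sum>i<n. \<Sum>j<n. c i j *\<^sub>C u i j)"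
    by (rule exists_unitary_corep)
  obtain Q where Q: "pos_form (coord_space {..<n}) Q"
    and Qinv: "\<And>j l. j < n \<Longrightarrow> l < n \<Longrightarrow>
       (\<Sum>i<n. \<Sum>k<n. Q (unit_vec i) (unit_vec k) *\<^sub>C (u k j * star (u i l))) =
       Q (unit_vec l) (unit_vec j) *\<^sub>C 1"
    using conjugate_form[OF u] by blast
  interpret Q: pos_form "coord_space {..<n}" Q by (rule Q)
  interpret m: pos_form "mat_space n" "mat_ip n" by (rule mat_ip_pos_form)
  \<comment> \<open>The \<open>u p q\<close> may be dependent, so the integral form is pulled back
    along \<open>J\<close> to matrices, which carry a definite scalar product of their own.\<close>
  define J where "J x = (\<Sum>p<n. \<Sum>q<n. Poly_Mapping.lookup x (p, q) *\<^sub>C u p q)" for x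
  have J_add: "J (x + y) = J x + J y" and J_scale: "J (d *\<^sub>C x) = d *\<^sub>C J x" for x y d
    by (simp_all add: J_def lookup_add cv.scale_left_distrib sum.distrib cv.scale_sum_right)
  have ip_J_left: "ip (J x) b = (\<Sum>p<n. \<Sum>q<n. Poly_Mapping.lookup x (p, q) * ip (u p q) b)" for x b
    unfolding J_def by (simp add: ip.sum_left ip.scale_left)
  have ip_J_right: "ip b (J x) = (\<Sum>p<n. \<Sum>q<n. cnj (Poly_Mapping.lookup x (p, q)) * ip b (u p q))" for x b
    unfolding J_def by (simp add: ip.sum_right ip.scale_right)
  have B: "hermitian_form (mat_space n) (\<lambda>x y. ip (J x) (J y))"
  proof
    show "ip (J y) (J x) = cnj (ip (J x) (J y))" for x y by (rule ip.herm) auto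
  qed (simp_all add: subspace_mat_space J_add J_scale ip.add_left ip.scale_left)
  have Ja: "J (mat n c) = a" unfolding J_def a by (simp add: lookup_mat)
  have fin: "finite ((\<lambda>i. Poly_Mapping.single i (1::complex)) ` ({..<n} \<times> {..<n}))" by simp
  have span: "mat_space n \<subseteq> cv.span ((\<lambda>i. Poly_Mapping.single i 1) ` ({..<n} \<times> {..<n}))"
    unfolding mat_space_def by (subst keys_subset_span) auto
  have "Re (ip (J (mat n c)) (J (mat n c))) < 0" using neg Ja by simp
  from negative_eigenspace[OF mat_ip_pos_form B fin span mat_mem this]
  obtain l :: real and m :: nat and e where "0 < l \<and> 0 < m \<and> (\<forall>i<m. e i \<in> mat_space n) \<and>
    (\<forall>i<m. \<forall>j<m. mat_ip n (e i) (e j) = (if i = j then 1 else 0)) \<and>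
    (\<forall>i<m. \<forall>y\<in>mat_space n. ip (J (e i)) (J y) = - of_real l * mat_ip n (e i) y) \<and>
    (\<forall>w\<in>mat_space n. (\<forall>y\<in>mat_space n. ip (J w) (J y) = - of_real l * mat_ip n w y) \<longrightarrow>
       w = (\<Sum>i<m. mat_ip n w (e i) *\<^sub>C e i))"
    by (elim exE) (rule that)
  then have l: "0 < l" "0 < m" and e: "\<And>i. i < m \<Longrightarrow> e i \<in> mat_space n"
    and orth: "\<And>i j. i < m \<Longrightarrow> j < m \<Longrightarrow> mat_ip n (e i) (e j) = (if i = j then 1 else 0)"
    and eig: "\<And>i y. i < m \<Longrightarrow> y \<in> mat_space n \<Longrightarrow> ip (J (e i)) (J y) = - of_real l * mat_ip n (e i) y"
    and expand: "\<And>w. w \<in> mat_space n \<Longrightarrow>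
      (\<And>y. y \<in> mat_space n \<Longrightarrow> ip (J w) (J y) = - of_real l * mat_ip n w y) \<Longrightarrow>
       w = (\<Sum>i<m. mat_ip n w (e i) *\<^sub>C e i)"
    by simp_all
  define E where "E \<alpha> p q = Poly_Mapping.lookup (e \<alpha>) (p, q)" for \<alpha> p q
  have eig_coeff: "ip (J (e \<alpha>)) (u k i) = - of_real l * E \<alpha> k i" if "\<alpha> < m" "k < n" "i < n" for \<alpha> k i
  proof -
    \<comment> \<open>The matrix unit at (k, i), a coefficient matrix of
      \<open>u k i\<close>.\<close>
    let ?s = "mat n (\<lambda>p q. if q = i then if p = k then 1 else 0 else 0)"
    have "J ?s = (\<Sum>p<n. \<Sum>q<n. if q = i then if p = k then u p q else 0 else 0)"
      unfolding J_def by (intro sum.cong refl) (simp add: lookup_mat)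
    then have "J ?s = u k i" using that by simp
    moreover have "mat_ip n (e \<alpha>) ?s = (\<Sum>p<n. \<Sum>q<n. if q = i then if p = k then E \<alpha> p q else 0 else 0)"
      unfolding mat_ip_def by (intro sum.cong refl) (simp add: lookup_mat E_def)
    then have "mat_ip n (e \<alpha>) ?s = E \<alpha> k i" using that by simp
    ultimately show ?thesis using eig[OF that(1) mat_mem] by metis
  qed
  \<comment> \<open>The eigenspace is stable under slices: \<open>strong_invariance\<close> moves
    \<omega> from the left argument of the form to the right one, where the eigenvector equation of
    \<open>e \<alpha>\<close> applies.\<close>
  have slice_expand: "slice n (\<lambda>p r. \<omega> (u p r)) (e \<alpha>) =
      (\<Sum>\<beta><m. mat_ip n (slice n (\<lambda>p r. \<omega> (u p r)) (e \<alpha>)) (e \<beta>) *\<^sub>C e \<beta>)"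
    if \<alpha>: "\<alpha> < m" and \<omega>: "clinear \<omega>" for \<omega> :: "'h \<Rightarrow> complex" and \<alpha>
  proof (rule expand)
    let ?w = "slice n (\<lambda>p r. \<omega> (u p r)) (e \<alpha>)"
    show "?w \<in> mat_space n" unfolding slice_def by (rule mat_mem)
    have coeff: "ip (J ?w) (u j i) = - of_real l * Poly_Mapping.lookup ?w (j, i)" if ji: "j < n" "i < n" for j i
    proof -
      have "ip (J ?w) (u j i) = (\<Sum>r<n. \<Sum>q<n. \<Sum>p<n. E \<alpha> p q * (ip (u r q) (u j i) * \<omega> (u p r)))"
        unfolding ip_J_left slice_def
        by (intro sum.cong refl) (simp add: lookup_mat E_def sum_distrib_right, simp add: mult_ac)
      also have "\<dots> = (\<Sum>r<n. \<Sum>p<n. \<Sum>q<n. E \<alpha> p q * (ip (u r q) (u j i) * \<omega> (u p r)))"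
        by (rule sum.cong[OF refl], rule sum.swap)
      also have "\<dots> = (\<Sum>p<n. \<Sum>r<n. \<Sum>q<n. E \<alpha> p q * (ip (u r q) (u j i) * \<omega> (u p r)))"
        by (rule sum.swap)
      also have "\<dots> = (\<Sum>p<n. \<Sum>q<n. \<Sum>r<n. E \<alpha> p q * (ip (u r q) (u j i) * \<omega> (u p r)))"
        by (rule sum.cong[OF refl], rule sum.swap)
      also have "\<dots> = (\<Sum>p<n. \<Sum>q<n. E \<alpha> p q * \<omega> (\<Sum>r<n. ip (u r q) (u j i) *\<^sub>C u p r))"
        by (simp add: clinear_sum[OF \<omega>] clinear_scale[OF \<omega>] sum_distrib_left)
      also have "\<dots> = (\<Sum>p<n. \<Sum>q<n. E \<alpha> p q * \<omega> (\<Sum>k<n. ip (u p q) (u k i) *\<^sub>C u k j))"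
        using ji by (intro sum.cong refl) (simp add: strong_invariance[OF u u])
      also have "\<dots> = (\<Sum>p<n. \<Sum>q<n. \<Sum>k<n. E \<alpha> p q * ip (u p q) (u k i) * \<omega> (u k j))"
        by (simp add: clinear_sum[OF \<omega>] clinear_scale[OF \<omega>] sum_distrib_left mult.assoc)
      also have "\<dots> = (\<Sum>p<n. \<Sum>k<n. \<Sum>q<n. E \<alpha> p q * ip (u p q) (u k i) * \<omega> (u k j))"
        by (rule sum.cong[OF refl], rule sum.swap)
      also have "\<dots> = (\<Sum>k<n. \<Sum>p<n. \<Sum>q<n. E \<alpha> p q * ip (u p q) (u k i) * \<omega> (u k j))"
        by (rule sum.swap)
      also have "\<dots> = (\<Sum>k<n. ip (J (e \<alpha>)) (u k i) * \<omega> (u k j))"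
        unfolding ip_J_left by (simp add: sum_distrib_right E_def)
      also have "\<dots> = (\<Sum>k<n. - of_real l * (\<omega> (u k j) * E \<alpha> k i))"
        using ji \<alpha> by (intro sum.cong refl) (simp add: eig_coeff mult_ac)
      also have "\<dots> = - of_real l * Poly_Mapping.lookup ?w (j, i)"
        using ji by (simp add: slice_def lookup_mat E_def sum_distrib_left sum_negf)
      finally show ?thesis .
    qed
    show "ip (J ?w) (J y) = - of_real l * mat_ip n ?w y" for y
    proof -
      have "ip (J ?w) (J y) = (\<Sum>p<n. \<Sum>q<n. cnj (Poly_Mapping.lookup y (p, q)) * (- of_real l * Poly_Mapping.lookup ?w (p, q)))"
        unfolding ip_J_right by (intro sum.cong refl) (simp add: coeff)
      then show ?thesis by (simp add: mat_ip_def sum_distrib_left sum_negf mult_ac)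
    qed
  qed
  \<comment> \<open>The trace of the image under T of the matrix unit at (p, y).\<close>
  define \<xi> where "\<xi> y p = (\<Sum>q<n. \<Sum>\<beta><m. E \<beta> q q * cnj (E \<beta> p y))" for y p
  \<comment> \<open>The value of \<omega> at \<open>J x\<close> is the trace of the slice of
    \<open>x\<close> by \<omega>. As T commutes with slices, for the image x of the matrix unit at
    (k, y) this is the trace of T applied to the sliced unit, the sum over p of \<omega> (u k p)
    times the unit at (p, y).\<close>
  have row: "(\<Sum>\<alpha><m. cnj (E \<alpha> k y) *\<^sub>C J (e \<alpha>)) = (\<Sum>p<n. \<xi> y p *\<^sub>C u k p)"
    if ky: "k < n" "y < n" for k y
  proof (rule clinear_eqI)
    fix \<omega> :: "'h \<Rightarrow> complex" assume \<omega>: "clinear \<omega>"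
    \<comment> \<open>Chosen linear and such that slicing by it is adjoint to slicing by \<omega> on
      the coefficients of the unitary \<open>u\<close>.\<close>
    define \<omega>' where "\<omega>' x = cnj (\<omega> (star (S x)))" for x
    have \<omega>'_lin: "clinear \<omega>'"
      by (rule clinearI) (simp_all add: \<omega>'_def clinear_add[OF antipode_linear] clinear_scale[OF antipode_linear]
        star_add star_scaleC clinear_add[OF \<omega>] clinear_scale[OF \<omega>])
    have \<omega>': "\<omega>' (u p r) = cnj (\<omega> (u r p))" if "p < n" "r < n" for p r
      unfolding \<omega>'_def using unitaryD(2)[OF u that] by (simp add: star_star)
    define C where "C \<alpha> \<beta> = mat_ip n (slice n (\<lambda>p r. \<omega> (u p r)) (e \<alpha>)) (e \<beta>)" for \<alpha> \<beta>
    have slice\<omega>': "slice n (\<lambda>p r. \<omega>' (u p r)) x = slice n (\<lambda>p r. cnj (\<omega> (u r p))) x" for x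
      unfolding slice_def mat_def by (intro sum.cong refl arg_cong2[of _ _ _ _ scaleC]) (simp add: \<omega>')
    have C': "mat_ip n (slice n (\<lambda>p r. \<omega>' (u p r)) (e \<beta>)) (e \<alpha>) = cnj (C \<alpha> \<beta>)" if "\<alpha> < m" "\<beta> < m" for \<alpha> \<beta>
      unfolding C_def mat_ip_slice[of n _ "e \<alpha>"] slice\<omega>'
      using m.herm[OF e[OF that(1)] mat_mem] unfolding slice_def by simp
    have tr: "\<omega> (J (e \<alpha>)) = (\<Sum>\<beta><m. C \<alpha> \<beta> * (\<Sum>q<n. E \<beta> q q))" if \<alpha>: "\<alpha> < m" for \<alpha>
    proof -
      have "\<omega> (J (e \<alpha>)) = (\<Sum>p<n. \<Sum>q<n. E \<alpha> p q * \<omega> (u p q))"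
        unfolding J_def by (simp add: clinear_sum[OF \<omega>] clinear_scale[OF \<omega>] E_def)
      also have "\<dots> = (\<Sum>q<n. \<Sum>p<n. \<omega> (u p q) * E \<alpha> p q)"
        by (subst sum.swap) (simp add: mult.commute)
      also have "\<dots> = (\<Sum>q<n. Poly_Mapping.lookup (slice n (\<lambda>p r. \<omega> (u p r)) (e \<alpha>)) (q, q))"
        by (simp add: slice_def lookup_mat E_def)
      also have "\<dots> = (\<Sum>q<n. \<Sum>\<beta><m. C \<alpha> \<beta> * E \<beta> q q)"
        by (subst slice_expand[OF \<alpha> \<omega>]) (simp add: lookup_sum C_def E_def)
      also have "\<dots> = (\<Sum>\<beta><m. C \<alpha> \<beta> * (\<Sum>q<n. E \<beta> q q))"
        by (subst sum.swap) (simp add: sum_distrib_left)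
      finally show ?thesis .
    qed
    have adj: "(\<Sum>p<n. \<omega> (u k p) * cnj (E \<beta> p y)) = (\<Sum>\<alpha><m. C \<alpha> \<beta> * cnj (E \<alpha> k y))" if \<beta>: "\<beta> < m" for \<beta>
    proof -
      have "(\<Sum>p<n. \<omega> (u k p) * cnj (E \<beta> p y)) = cnj (\<Sum>p<n. \<omega>' (u p k) * E \<beta> p y)"
        using ky by (simp add: \<omega>')
      also have "(\<Sum>p<n. \<omega>' (u p k) * E \<beta> p y) = Poly_Mapping.lookup (slice n (\<lambda>p r. \<omega>' (u p r)) (e \<beta>)) (k, y)"
        using ky by (simp add: slice_def lookup_mat E_def)
      also have "\<dots> = (\<Sum>\<alpha><m. cnj (C \<alpha> \<beta>) * E \<alpha> k y)"
        using \<beta> by (subst slice_expand[OF \<beta> \<omega>'_lin]) (simp add: lookup_sum C' E_def)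
      finally show ?thesis by simp
    qed
    have "\<omega> (\<Sum>\<alpha><m. cnj (E \<alpha> k y) *\<^sub>C J (e \<alpha>)) = (\<Sum>\<alpha><m. \<Sum>\<beta><m. C \<alpha> \<beta> * cnj (E \<alpha> k y) * (\<Sum>q<n. E \<beta> q q))"
      unfolding clinear_sum[OF \<omega>] clinear_scale[OF \<omega>]
      by (intro sum.cong refl) (simp add: tr sum_distrib_left mult_ac)
    also have "\<dots> = (\<Sum>\<beta><m. (\<Sum>\<alpha><m. C \<alpha> \<beta> * cnj (E \<alpha> k y)) * (\<Sum>q<n. E \<beta> q q))"
      unfolding sum_distrib_right by (rule sum.swap)
    also have "\<dots> = (\<Sum>\<beta><m. \<Sum>p<n. \<omega> (u k p) * (cnj (E \<beta> p y) * (\<Sum>q<n. E \<beta> q q)))"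
      by (intro sum.cong refl) (simp add: adj[symmetric] sum_distrib_right mult.assoc)
    also have "\<dots> = (\<Sum>p<n. \<Sum>\<beta><m. \<omega> (u k p) * (cnj (E \<beta> p y) * (\<Sum>q<n. E \<beta> q q)))"
      by (rule sum.swap)
    also have "\<dots> = (\<Sum>p<n. \<xi> y p * \<omega> (u k p))"
    proof (rule sum.cong[OF refl])
      fix p
      have "\<xi> y p = (\<Sum>\<beta><m. cnj (E \<beta> p y) * (\<Sum>q<n. E \<beta> q q))"
        unfolding \<xi>_def sum_distrib_left by (subst sum.swap) (simp add: mult.commute)
      then show "(\<Sum>\<beta><m. \<omega> (u k p) * (cnj (E \<beta> p y) * (\<Sum>q<n. E \<beta> q q))) = \<xi> y p * \<omega> (u k p)"
        by (simp add: sum_distrib_left mult.commute)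
    qed
    also have "\<dots> = \<omega> (\<Sum>p<n. \<xi> y p *\<^sub>C u k p)"
      by (simp add: clinear_sum[OF \<omega>] clinear_scale[OF \<omega>])
    finally show "\<omega> (\<Sum>\<alpha><m. cnj (E \<alpha> k y) *\<^sub>C J (e \<alpha>)) = \<omega> (\<Sum>p<n. \<xi> y p *\<^sub>C u k p)" .
  qed
  have unit: "unit_vec i \<in> coord_space {..<n}" if "i \<in> {..<n}" for i using that by (simp add: coord_space_def)
  have Qsum: "Q (\<Sum>i<n. f i *\<^sub>C unit_vec i) (\<Sum>i<n. f i *\<^sub>C unit_vec i) =
      (\<Sum>i<n. \<Sum>k<n. f i * cnj (f k) * Q (unit_vec i) (unit_vec k))" for f
    by (rule Q.lincomb[OF unit unit])
  have Qmem: "(\<Sum>i<n. f i *\<^sub>C unit_vec i) \<in> coord_space {..<n}" for f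
    by (intro Q.mem) (simp add: coord_space_def)
  \<comment> \<open>\<open>z \<alpha> y\<close> is column y of \<open>e \<alpha>\<close>, and
    \<open>A k y\<close> belongs to the image under T of the matrix unit at (k, y).
    \<open>X y\<close> is evaluated by orthonormality of the \<open>e \<alpha>\<close> in
    \<open>X1\<close> and by \<open>row\<close> in \<open>X2\<close>.\<close>
  define z where "z \<alpha> y = (\<Sum>i<n. E \<alpha> i y *\<^sub>C unit_vec i)" for \<alpha> y
  define A where "A k y = (\<Sum>\<alpha><m. cnj (E \<alpha> k y) *\<^sub>C J (e \<alpha>))" for k y
  define X where "X y = (\<Sum>i<n. \<Sum>k<n. Q (unit_vec i) (unit_vec k) * ip (A k y) (A i y))" for y
  have X1: "X y = - of_real l * (\<Sum>\<alpha><m. Q (z \<alpha> y) (z \<alpha> y))" if "y < n" for y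
  proof -
    have "ip (A k y) (A i y) = - of_real l * (\<Sum>\<alpha><m. E \<alpha> i y * cnj (E \<alpha> k y))" for i k
    proof -
      have "ip (A k y) (A i y) = (\<Sum>\<alpha><m. \<Sum>\<beta><m. cnj (E \<alpha> k y) * cnj (cnj (E \<beta> i y)) * ip (J (e \<alpha>)) (J (e \<beta>)))"
        unfolding A_def by (rule ip.lincomb) auto
      also have "\<dots> = (\<Sum>\<alpha><m. \<Sum>\<beta><m. if \<beta> = \<alpha> then - of_real l * (E \<beta> i y * cnj (E \<alpha> k y)) else 0)"
        by (intro sum.cong refl) (simp add: eig e orth)
      finally show ?thesis by (simp add: sum_distrib_left sum_negf)
    qed
    then have "X y = (\<Sum>i<n. \<Sum>k<n. \<Sum>\<alpha><m. - of_real l * (E \<alpha> i y * cnj (E \<alpha> k y) * Q (unit_vec i) (unit_vec k)))"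
      unfolding X_def by (simp add: sum_distrib_left mult_ac)
    also have "\<dots> = (\<Sum>i<n. \<Sum>\<alpha><m. \<Sum>k<n. - of_real l * (E \<alpha> i y * cnj (E \<alpha> k y) * Q (unit_vec i) (unit_vec k)))"
      by (rule sum.cong[OF refl], rule sum.swap)
    also have "\<dots> = (\<Sum>\<alpha><m. \<Sum>i<n. \<Sum>k<n. - of_real l * (E \<alpha> i y * cnj (E \<alpha> k y) * Q (unit_vec i) (unit_vec k)))"
      by (rule sum.swap)
    finally show ?thesis unfolding z_def Qsum by (simp only: sum_distrib_left)
  qed
  have X2: "0 \<le> Re (X y)" if y: "y < n" for y
  proof -
    \<comment> \<open>After \<open>row\<close>, the sums over i and k are those of the integrated
      identity for \<open>Q\<close>, which leaves the value of \<open>Q\<close> at the vector with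
      coordinates \<open>?f\<close>.\<close>
    let ?f = "\<lambda>i. cnj (\<xi> y i)"
    have "X y = (\<Sum>i<n. \<Sum>k<n. \<Sum>j<n. \<Sum>h<n. \<xi> y j * cnj (\<xi> y h) * (Q (unit_vec i) (unit_vec k) * ip (u k j) (u i h)))"
    proof -
      have "ip (A k y) (A i y) = (\<Sum>j<n. \<Sum>h<n. \<xi> y j * cnj (\<xi> y h) * ip (u k j) (u i h))"
        if "k < n" "i < n" for k i
        unfolding A_def row[OF that(1) y] row[OF that(2) y] by (rule ip.lincomb) auto
      then show ?thesis
        unfolding X_def by (intro sum.cong refl) (simp add: sum_distrib_left mult.left_commute)
    qed
    also have "\<dots> = (\<Sum>i<n. \<Sum>j<n. \<Sum>k<n. \<Sum>h<n. \<xi> y j * cnj (\<xi> y h) * (Q (unit_vec i) (unit_vec k) * ip (u k j) (u i h)))"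
      by (rule sum.cong[OF refl], rule sum.swap)
    also have "\<dots> = (\<Sum>j<n. \<Sum>i<n. \<Sum>h<n. \<Sum>k<n. \<xi> y j * cnj (\<xi> y h) * (Q (unit_vec i) (unit_vec k) * ip (u k j) (u i h)))"
      by (rule trans[OF sum.swap], rule sum.cong[OF refl], rule sum.cong[OF refl], rule sum.swap)
    also have "\<dots> = (\<Sum>j<n. \<Sum>h<n. \<Sum>i<n. \<Sum>k<n. \<xi> y j * cnj (\<xi> y h) * (Q (unit_vec i) (unit_vec k) * ip (u k j) (u i h)))"
      by (rule sum.cong[OF refl], rule sum.swap)
    also have "\<dots> = (\<Sum>h<n. \<Sum>j<n. \<Sum>i<n. \<Sum>k<n. \<xi> y j * cnj (\<xi> y h) * (Q (unit_vec i) (unit_vec k) * ip (u k j) (u i h)))"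
      by (rule sum.swap)
    also have "\<dots> = (\<Sum>h<n. \<Sum>j<n. ?f h * cnj (?f j) * Q (unit_vec h) (unit_vec j))"
    proof (intro sum.cong refl)
      fix h j assume "h \<in> {..<n}" "j \<in> {..<n}"
      then have "\<phi> (\<Sum>i<n. \<Sum>k<n. Q (unit_vec i) (unit_vec k) *\<^sub>C (u k j * star (u i h))) = \<phi> (Q (unit_vec h) (unit_vec j) *\<^sub>C 1)"
        using Qinv by simp
      then have "(\<Sum>i<n. \<Sum>k<n. Q (unit_vec i) (unit_vec k) * ip (u k j) (u i h)) = Q (unit_vec h) (unit_vec j)"
        by (simp add: clinear_sum[OF integral_linear] clinear_scale[OF integral_linear] normalized ip_def)
      then show "(\<Sum>i<n. \<Sum>k<n. \<xi> y j * cnj (\<xi> y h) * (Q (unit_vec i) (unit_vec k) * ip (u k j) (u i h))) =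
          ?f h * cnj (?f j) * Q (unit_vec h) (unit_vec j)"
        by (simp add: sum_distrib_left[symmetric] mult.commute)
    qed
    also have "\<dots> = Q (\<Sum>i<n. ?f i *\<^sub>C unit_vec i) (\<Sum>i<n. ?f i *\<^sub>C unit_vec i)" by (rule Qsum[symmetric])
    finally show ?thesis using Q.nonneg[OF Qmem] by simp
  qed
  \<comment> \<open>Both signs force every column of \<open>e 0\<close> to vanish, although it has
    norm 1; it exists because \<open>0 < m\<close>.\<close>
  have "E 0 i y = 0" if "i < n" "y < n" for i y
  proof -
    have nn: "0 \<le> Re (Q (z \<alpha> y) (z \<alpha> y))" for \<alpha> unfolding z_def by (rule Q.nonneg[OF Qmem])
    have "0 \<le> - l * (\<Sum>\<alpha><m. Re (Q (z \<alpha> y) (z \<alpha> y)))"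
      using X2[OF that(2)] X1[OF that(2)] by simp
    then have "(\<Sum>\<alpha><m. Re (Q (z \<alpha> y) (z \<alpha> y))) \<le> 0" using l(1) by (simp add: mult_le_0_iff)
    then have "(\<Sum>\<alpha><m. Re (Q (z \<alpha> y) (z \<alpha> y))) = 0" using nn by (simp add: sum_nonneg antisym)
    then have "Re (Q (z 0 y) (z 0 y)) = 0" using nn l(2) by (simp add: sum_nonneg_eq_0_iff)
    moreover have "z 0 y \<in> coord_space {..<n}" unfolding z_def by (rule Qmem)
    ultimately have "z 0 y = 0" using Q.pos[of "z 0 y"] by force
    then have "Poly_Mapping.lookup (z 0 y) i = 0" by simp
    moreover have "Poly_Mapping.lookup (z 0 y) i = (\<Sum>j<n. if j = i then E 0 j y else 0)"
      unfolding z_def lookup_sum by (intro sum.cong refl) (simp add: lookup_single when_def)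
    ultimately show ?thesis using that by simp
  qed
  then have "mat_ip n (e 0) (e 0) = 0" by (simp add: mat_ip_def E_def)
  then show False using orth[of 0 0] l(2) by simp
qed

sublocale ip: psd_form UNIV ip
  by unfold_locales (rule ip_nonneg)

end

section \<open>Convolution operators\<close>

context psd_form
begin

lemma null_left: "v \<in> V \<Longrightarrow> w \<in> V \<Longrightarrow> Re (h w w) = 0 \<Longrightarrow> h v w = 0"
  using Cauchy_Schwarz[of v w] by simp

text \<open>Projecting out \<open>w\<close> subtracts a rank-one term from a Gram matrix.\<close>

lemma diff_proj:
  assumes "u \<in> V" "v \<in> V" "w \<in> V" "Re (h w w) > 0"
  defines "N \<equiv> complex_of_real (Re (h w w))"
  shows "h (u - (h u w / N) *\<^sub>C w) (v - (h v w / N) *\<^sub>C w) = h u v - h u w * cnj (h v w) / N"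
proof -
  have N: "h w w = N" unfolding N_def by (rule real_diag[OF assms(3)])
  have N0: "N \<noteq> 0" "cnj N = N" unfolding N_def using assms(4) by simp_all
  have hwv: "h w v = cnj (h v w)" by (rule herm[OF assms(2,3)])
  show ?thesis
    using assms(1-3) N0 by (simp add: diff_left diff_right scale_left scale_right mem N hwv)
qed

text \<open>The tensor square of the form, evaluated at the sum of the x i \<otimes> y i. Projecting
  \<open>x a\<close> out of all \<open>x i\<close> removes a rank-one part, which contributes
  \<open>h s s / N\<close>, and makes the a-th vector zero; as this changes the vectors, the
  induction is over arbitrary \<open>x\<close>.\<close>

lemma Schur_product_nonneg:
  assumes "finite A" "\<And>i. i \<in> A \<Longrightarrow> x i \<in> V" "\<And>i. i \<in> A \<Longrightarrow> y i \<in> V"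
  shows "0 \<le> Re (\<Sum>i\<in>A. \<Sum>j\<in>A. h (x i) (x j) * h (y i) (y j))"
  using assms
proof (induction A arbitrary: x rule: finite_induct)
  case empty
  then show ?case by simp
next
  case (insert a A)
  have xa: "x a \<in> V" using insert.prems by simp
  show ?case
  proof (cases "Re (h (x a) (x a)) = 0")
    case True
    \<comment> \<open>A null vector is orthogonal to everything, so its row and column drop
      out.\<close>
    have null: "h (x i) (x a) = 0" "h (x a) (x i) = 0" if "i \<in> insert a A" for i
      using null_left[OF insert.prems(1)[OF that] xa True] herm[OF insert.prems(1)[OF that] xa] by auto
    then have "(\<Sum>i\<in>insert a A. \<Sum>j\<in>insert a A. h (x i) (x j) * h (y i) (y j)) =
        (\<Sum>i\<in>A. \<Sum>j\<in>A. h (x i) (x j) * h (y i) (y j))"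
      using insert.hyps by simp
    then show ?thesis using insert.IH[of x] insert.prems by simp
  next
    case False
    then have pos: "Re (h (x a) (x a)) > 0" using nonneg[OF xa] by simp
    define N where "N = Re (h (x a) (x a))"
    define x' where "x' i = x i - (h (x i) (x a) / of_real N) *\<^sub>C x a" for i
    define s where "s = (\<Sum>i\<in>insert a A. h (x i) (x a) *\<^sub>C y i)"
    have N: "h (x a) (x a) = of_real N" "N > 0" using real_diag[OF xa] pos by (simp_all add: N_def)
    have x'a: "x' a = 0" using N by (simp add: x'_def)
    have x'V: "x' i \<in> V" if "i \<in> insert a A" for i
      unfolding x'_def using insert.prems(1)[OF that] xa by (intro mem)
    have sV: "s \<in> V" unfolding s_def using insert.prems(2) by (intro mem) auto
    have hs: "h s s = (\<Sum>i\<in>insert a A. \<Sum>j\<in>insert a A. h (x i) (x a) * cnj (h (x j) (x a)) * h (y i) (y j))"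
      unfolding s_def by (rule lincomb) (use insert.prems(2) in auto)
    have "(\<Sum>i\<in>insert a A. \<Sum>j\<in>insert a A. h (x i) (x j) * h (y i) (y j)) =
        (\<Sum>i\<in>insert a A. \<Sum>j\<in>insert a A. h (x' i) (x' j) * h (y i) (y j)
          + h (x i) (x a) * cnj (h (x j) (x a)) * h (y i) (y j) / of_real N)"
    proof (intro sum.cong refl)
      fix i j assume "i \<in> insert a A" "j \<in> insert a A"
      then have eq: "h (x' i) (x' j) = h (x i) (x j) - h (x i) (x a) * cnj (h (x j) (x a)) / of_real N"
        unfolding x'_def N_def using xa pos insert.prems(1) by (intro diff_proj) auto
      show "h (x i) (x j) * h (y i) (y j) = h (x' i) (x' j) * h (y i) (y j)
          + h (x i) (x a) * cnj (h (x j) (x a)) * h (y i) (y j) / of_real N"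
        unfolding eq by (simp add: algebra_simps)
    qed
    also have "\<dots> = (\<Sum>i\<in>insert a A. \<Sum>j\<in>insert a A. h (x' i) (x' j) * h (y i) (y j)) + h s s / of_real N"
      unfolding hs by (simp only: sum.distrib sum_divide_distrib)
    also have "(\<Sum>i\<in>insert a A. \<Sum>j\<in>insert a A. h (x' i) (x' j) * h (y i) (y j)) =
        (\<Sum>i\<in>A. \<Sum>j\<in>A. h (x' i) (x' j) * h (y i) (y j))"
      using insert.hyps x'V by (simp add: x'a zero_left zero_right mem)
    finally have "Re (\<Sum>i\<in>insert a A. \<Sum>j\<in>insert a A. h (x i) (x j) * h (y i) (y j)) =
        Re (\<Sum>i\<in>A. \<Sum>j\<in>A. h (x' i) (x' j) * h (y i) (y j)) + Re (h s s) / N"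
      by simp
    moreover have "0 \<le> Re (\<Sum>i\<in>A. \<Sum>j\<in>A. h (x' i) (x' j) * h (y i) (y j))"
      using insert.IH[of x'] x'V insert.prems by simp
    moreover have "0 \<le> Re (h s s) / N" using nonneg[OF sV] N by simp
    ultimately show ?thesis by simp
  qed
qed

text \<open>Contracting one leg of a tensor with \<open>z\<close> costs at most the norm of
  \<open>z\<close>: projecting \<open>z\<close> out of the \<open>y i\<close> leaves a tensor of
  nonnegative square by the Schur product lemma, and the removed part has square
  \<open>h w w / h z z\<close>.\<close>

lemma tensor_Cauchy_Schwarz:
  assumes "finite A" "\<And>i. i \<in> A \<Longrightarrow> x i \<in> V" "\<And>i. i \<in> A \<Longrightarrow> y i \<in> V" "z \<in> V"
  defines "w \<equiv> \<Sum>i\<in>A. h (y i) z *\<^sub>C x i"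
  shows "Re (h w w) \<le> Re (\<Sum>i\<in>A. \<Sum>j\<in>A. h (x i) (x j) * h (y i) (y j)) * Re (h z z)"
proof (cases "Re (h z z) = 0")
  case True
  then have "w = 0" unfolding w_def using null_left[OF assms(3,4)] by simp
  then show ?thesis using True by (simp add: zero_left mem)
next
  case False
  define N where "N = Re (h z z)"
  have N: "N > 0" using nonneg[OF assms(4)] False by (simp add: N_def)
  define y' where "y' i = y i - (h (y i) z / of_real N) *\<^sub>C z" for i
  have y'V: "y' i \<in> V" if "i \<in> A" for i
    unfolding y'_def using assms(3)[OF that] assms(4) by (intro mem)
  have "0 \<le> Re (\<Sum>i\<in>A. \<Sum>j\<in>A. h (x i) (x j) * h (y' i) (y' j))"
    by (rule Schur_product_nonneg) (use assms y'V in auto)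
  also have "(\<Sum>i\<in>A. \<Sum>j\<in>A. h (x i) (x j) * h (y' i) (y' j)) =
      (\<Sum>i\<in>A. \<Sum>j\<in>A. h (x i) (x j) * h (y i) (y j) - h (y i) z * cnj (h (y j) z) * h (x i) (x j) / of_real N)"
  proof (intro sum.cong refl)
    fix i j assume "i \<in> A" "j \<in> A"
    then have eq: "h (y' i) (y' j) = h (y i) (y j) - h (y i) z * cnj (h (y j) z) / of_real N"
      unfolding y'_def N_def using assms N by (intro diff_proj) (auto simp: N_def)
    show "h (x i) (x j) * h (y' i) (y' j) =
        h (x i) (x j) * h (y i) (y j) - h (y i) z * cnj (h (y j) z) * h (x i) (x j) / of_real N"
      unfolding eq by (simp add: algebra_simps)
  qed
  also have "\<dots> = (\<Sum>i\<in>A. \<Sum>j\<in>A. h (x i) (x j) * h (y i) (y j)) - h w w / of_real N"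
  proof -
    have "h w w = (\<Sum>i\<in>A. \<Sum>j\<in>A. h (y i) z * cnj (h (y j) z) * h (x i) (x j))"
      unfolding w_def by (rule lincomb) (use assms in auto)
    then show ?thesis by (simp only: sum_subtractf sum_divide_distrib)
  qed
  finally show ?thesis using N by (simp add: N_def field_simps)
qed

end

section \<open>Operator bounds for the convolution\<close>

context compact_hopf_integral
begin

definition nrm :: "'h \<Rightarrow> real" where
  "nrm x = sqrt (Re (ip x x))"

lemma nrm_nonneg: "0 \<le> nrm x"
  by (simp add: nrm_def ip.nonneg)

lemma nrm_square: "(nrm x)\<^sup>2 = Re (ip x x)"
  by (simp add: nrm_def ip.nonneg)

lemma ip_le_nrm: "Re (ip x y) \<le> nrm x * nrm y"
proof -
  have "(cmod (ip x y))\<^sup>2 \<le> (nrm x * nrm y)\<^sup>2"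
    using ip.Cauchy_Schwarz[of x y] by (simp add: power_mult_distrib nrm_square)
  then have "cmod (ip x y) \<le> nrm x * nrm y"
    by (rule power2_le_imp_le) (simp add: nrm_nonneg)
  then show ?thesis using complex_Re_le_cmod order_trans by blast
qed

definition elt :: "nat \<Rightarrow> (nat \<Rightarrow> nat \<Rightarrow> 'h) \<Rightarrow> (nat \<Rightarrow> nat \<Rightarrow> complex) \<Rightarrow> 'h" where
  "elt n u a = (\<Sum>i<n. \<Sum>j<n. a i j *\<^sub>C u i j)"

text \<open>The convolution of \<open>u i j\<close> with \<open>g\<close> for unitary
  \<open>u\<close>: there \<open>S (u i k)\<close> is \<open>star (u k i)\<close>, which leaves an
  expression in the form alone.\<close>

definition conv_coeff :: "nat \<Rightarrow> (nat \<Rightarrow> nat \<Rightarrow> 'h) \<Rightarrow> 'h \<Rightarrow> nat \<Rightarrow> nat \<Rightarrow> 'h" where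
  "conv_coeff n u g i j = (\<Sum>k<n. ip g (u k i) *\<^sub>C u k j)"

definition conv_op :: "nat \<Rightarrow> (nat \<Rightarrow> nat \<Rightarrow> 'h) \<Rightarrow> (nat \<Rightarrow> nat \<Rightarrow> complex) \<Rightarrow> 'h \<Rightarrow> 'h" where
  "conv_op n u a g = (\<Sum>i<n. \<Sum>j<n. a i j *\<^sub>C conv_coeff n u g i j)"

lemma conv_coeff_linear: "clinear (\<lambda>g. conv_coeff n u g i j)"
  by (rule clinearI) (simp_all add: conv_coeff_def ip.add_left ip.scale_left cv.scale_left_distrib
      sum.distrib cv.scale_sum_right)

text \<open>The left side depends on the element and not on its coefficients, so two coefficient
  matrices of one element define the same operator; \<open>adjoint_product_bound\<close> relies on
  this.\<close>

lemma convolution_elt: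
  assumes "unitary_corep star n u"
  shows "convolution \<Delta> S \<phi> (elt n u a) g = conv_op n u a g"
proof -
  have bil: "cbilinear (\<lambda>g1 g2. \<phi> (g * S g1) *\<^sub>C g2)"
    by (rule cbilinear_slice_left)
      (rule clinearI, simp_all add: clinear_add[OF antipode_linear] clinear_scale[OF antipode_linear]
        distrib_left mult_scaleC_right clinear_add[OF integral_linear] clinear_scale[OF integral_linear])
  note lin = sweedler_linear[OF bil]
  have "sweedler (\<lambda>g1 g2. \<phi> (g * S g1) *\<^sub>C g2) (\<Delta> (u i j)) = conv_coeff n u g i j" if "i < n" "j < n" for i j
    using that unfolding unitaryD(1)[OF assms that] sweedler_sum[OF cbilinear_balanced[OF bil] finite_lessThan]
      conv_coeff_def ip_def
    by (intro sum.cong refl) (simp add: unitaryD(2)[OF assms])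
  then show ?thesis
    unfolding convolution_def elt_def conv_op_def clinear_sum[OF comult_linear]
      clinear_scale[OF comult_linear] clinear_sum[OF lin] clinear_scale[OF lin] by simp
qed

lemma conv_coeff_adjoint: "ip (conv_coeff n u g i j) h = ip g (conv_coeff n u h j i)"
proof -
  have "cnj (ip h (u k j)) = ip (u k j) h" for k using ip.herm[of h "u k j"] by simp
  then show ?thesis
    by (simp add: conv_coeff_def ip.sum_left ip.scale_left ip.sum_right ip.scale_right mult.commute)
qed

text \<open>The adjoint swaps the two indices of \<open>u\<close>, hence the conjugate transpose of
  \<open>a\<close>. For unitary \<open>u\<close> it is a coefficient matrix of
  \<open>star (S f)\<close> where \<open>f\<close> is \<open>elt n u a\<close>.\<close>

lemma conv_op_adjoint: "ip (conv_op n u a g) h = ip g (conv_op n u (\<lambda>i j. cnj (a j i)) h)"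
proof -
  have "ip (conv_op n u a g) h = (\<Sum>i<n. \<Sum>j<n. a i j * ip g (conv_coeff n u h j i))"
    by (simp add: conv_op_def ip.sum_left ip.scale_left conv_coeff_adjoint)
  also have "\<dots> = (\<Sum>j<n. \<Sum>i<n. a i j * ip g (conv_coeff n u h j i))"
    by (rule sum.swap)
  also have "\<dots> = ip g (conv_op n u (\<lambda>i j. cnj (a j i)) h)"
    by (simp add: conv_op_def ip.sum_right ip.scale_right)
  finally show ?thesis .
qed

lemma conv_coeff_unitary:
  assumes "unitary_corep star m v" "unitary_corep star n u" "p < m" "q < m" "i < n" "j < n"
  shows "conv_coeff n u (v p q) i j = (\<Sum>r<m. ip (v r q) (u j i) *\<^sub>C v p r)"
  unfolding conv_coeff_def by (rule strong_invariance[OF assms])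

text \<open>Associativity of the convolution: the coefficients are those of
  \<open>conv_coeff_unitary\<close>, with \<open>conv_coeff n u g p s\<close> in place of
  \<open>u p s\<close>.\<close>

lemma conv_coeff_conv_coeff:
  assumes u: "unitary_corep star n u" and "q < n" "i < n" "j < n"
  shows "conv_coeff n u (conv_coeff n u g p q) i j = (\<Sum>s<n. ip (u s q) (u j i) *\<^sub>C conv_coeff n u g p s)"
proof -
  have "conv_coeff n u (conv_coeff n u g p q) i j = (\<Sum>r<n. ip g (u r p) *\<^sub>C conv_coeff n u (u r q) i j)"
    unfolding conv_coeff_def[of n u g p q] clinear_sum[OF conv_coeff_linear] clinear_scale[OF conv_coeff_linear] ..
  also have "\<dots> = (\<Sum>r<n. \<Sum>s<n. ip (u s q) (u j i) *\<^sub>C ip g (u r p) *\<^sub>C u r s)"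
    using assms by (intro sum.cong refl)
      (simp add: conv_coeff_unitary[OF u u] cv.scale_sum_right mult.commute)
  also have "\<dots> = (\<Sum>s<n. ip (u s q) (u j i) *\<^sub>C conv_coeff n u g p s)"
    unfolding conv_coeff_def cv.scale_sum_right by (rule sum.swap)
  finally show ?thesis .
qed

lemma convolution_bound:
  assumes u: "unitary_corep star n u"
  shows "nrm (conv_op n u c g) \<le> nrm (elt n u (\<lambda>i j. cnj (c j i))) * nrm g"
proof -
  let ?z = "elt n u (\<lambda>i j. cnj (c j i))"
  obtain m v b where v: "unitary_corep star m v" and g: "g = (\<Sum>p<m. \<Sum>q<m. b p q *\<^sub>C v p q)"
    by (rule exists_unitary_corep)
  \<comment> \<open>The coproduct of \<open>g\<close> is the sum of the x \<alpha> \<otimes> y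
    \<alpha> over \<open>A\<close>; the convolution contracts its right legs with
    \<open>?z\<close>.\<close>
  define A where "A = {..<m} \<times> {..<m} \<times> {..<m}"
  define x where "x = (\<lambda>(p, q, r). b p q *\<^sub>C v p r)"
  define y where "y = (\<lambda>(p :: nat, q, r). v r q)"
  have A_sum: "(\<Sum>\<alpha>\<in>A. F \<alpha>) = (\<Sum>p<m. \<Sum>q<m. \<Sum>r<m. F (p, q, r))"
    for F :: "nat \<times> nat \<times> nat \<Rightarrow> 'k::comm_monoid_add"
    by (simp add: A_def sum.cartesian_product case_prod_beta)
  have "conv_op n u c g = (\<Sum>(p, q, r)\<in>A. ip (y (p, q, r)) ?z *\<^sub>C x (p, q, r))"
  proof -
    have "conv_op n u c (v p q) = (\<Sum>r<m. ip (v r q) ?z *\<^sub>C v p r)" if "p < m" "q < m" for p q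
    proof -
      have "conv_op n u c (v p q) = (\<Sum>i<n. \<Sum>j<n. \<Sum>r<m. (c i j * ip (v r q) (u j i)) *\<^sub>C v p r)"
        unfolding conv_op_def using that
        by (intro sum.cong refl) (simp add: conv_coeff_unitary[OF v u] cv.scale_sum_right)
      also have "\<dots> = (\<Sum>i<n. \<Sum>r<m. \<Sum>j<n. (c i j * ip (v r q) (u j i)) *\<^sub>C v p r)"
        by (rule sum.cong[OF refl], rule sum.swap)
      also have "\<dots> = (\<Sum>r<m. \<Sum>i<n. \<Sum>j<n. (c i j * ip (v r q) (u j i)) *\<^sub>C v p r)"
        by (rule sum.swap)
      also have "\<dots> = (\<Sum>r<m. ip (v r q) ?z *\<^sub>C v p r)"
      proof (rule sum.cong[OF refl])
        fix r
        have "ip (v r q) ?z = (\<Sum>i<n. \<Sum>j<n. c i j * ip (v r q) (u j i))"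
          unfolding elt_def by (subst sum.swap) (simp add: ip.sum_right ip.scale_right)
        then show "(\<Sum>i<n. \<Sum>j<n. (c i j * ip (v r q) (u j i)) *\<^sub>C v p r) = ip (v r q) ?z *\<^sub>C v p r"
          by (simp add: cv.scale_sum_left)
      qed
      finally show ?thesis .
    qed
    moreover have "clinear (conv_op n u c)"
      by (rule clinearI) (simp_all add: conv_op_def clinear_add[OF conv_coeff_linear]
        clinear_scale[OF conv_coeff_linear] cv.scale_right_distrib sum.distrib cv.scale_sum_right mult.commute)
    ultimately have "conv_op n u c g = (\<Sum>p<m. \<Sum>q<m. \<Sum>r<m. ip (v r q) ?z *\<^sub>C b p q *\<^sub>C v p r)"
      unfolding g by (simp add: clinear_sum clinear_scale cv.scale_sum_right mult.commute)
    then show ?thesis by (simp add: A_def x_def y_def sum.cartesian_product)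
  qed
  then have w: "conv_op n u c g = (\<Sum>\<alpha>\<in>A. ip (y \<alpha>) ?z *\<^sub>C x \<alpha>)" by (simp add: case_prod_beta)
  have iso: "(\<Sum>\<alpha>\<in>A. \<Sum>\<beta>\<in>A. ip (x \<alpha>) (x \<beta>) * ip (y \<alpha>) (y \<beta>)) = ip g g"
  proof -
    \<comment> \<open>Left invariance at \<open>v p q * star (v p' q')\<close>, integrated once
      more: the coproduct preserves the form.\<close>
    have inv: "(\<Sum>r<m. \<Sum>s<m. ip (v p r) (v p' s) * ip (v r q) (v s q')) = ip (v p q) (v p' q')"
      if "p < m" "q < m" "p' < m" "q' < m" for p q p' q'
    proof -
      have "(\<Sum>rs\<in>{..<m} \<times> {..<m}. \<phi> (v (fst rs) q * star (v (snd rs) q')) *\<^sub>C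
          (v p (fst rs) * star (v p' (snd rs)))) = \<phi> (v p q * star (v p' q')) *\<^sub>C 1"
        by (rule integral_left_sum) (simp_all add: comult_mult_star[OF v v that] case_prod_beta)
      then have "\<phi> (\<Sum>r<m. \<Sum>s<m. ip (v r q) (v s q') *\<^sub>C (v p r * star (v p' s))) = \<phi> (ip (v p q) (v p' q') *\<^sub>C 1)"
        by (simp add: ip_def sum.cartesian_product case_prod_beta)
      then show ?thesis
        by (simp add: clinear_sum[OF integral_linear] clinear_scale[OF integral_linear] normalized
          ip_def[of "v p _"] mult.commute)
    qed
    have "(\<Sum>\<alpha>\<in>A. \<Sum>\<beta>\<in>A. ip (x \<alpha>) (x \<beta>) * ip (y \<alpha>) (y \<beta>)) =
        (\<Sum>p<m. \<Sum>q<m. \<Sum>r<m. \<Sum>p'<m. \<Sum>q'<m. \<Sum>s<m.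
          b p q * cnj (b p' q') * (ip (v p r) (v p' s) * ip (v r q) (v s q')))"
      unfolding A_sum by (simp add: x_def y_def ip.scale_left ip.scale_right mult_ac)
    also have "\<dots> = (\<Sum>p<m. \<Sum>q<m. \<Sum>p'<m. \<Sum>q'<m. \<Sum>r<m. \<Sum>s<m.
          b p q * cnj (b p' q') * (ip (v p r) (v p' s) * ip (v r q) (v s q')))"
      by (rule sum.cong[OF refl], rule sum.cong[OF refl], rule trans[OF sum.swap],
          rule sum.cong[OF refl], rule sum.swap)
    also have "\<dots> = (\<Sum>p<m. \<Sum>q<m. \<Sum>p'<m. \<Sum>q'<m. b p q * cnj (b p' q') * ip (v p q) (v p' q'))"
      by (intro sum.cong refl) (simp add: sum_distrib_left[symmetric] inv)
    also have "\<dots> = ip g g"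
    proof -
      have 1: "ip x g = (\<Sum>p'<m. \<Sum>q'<m. cnj (b p' q') * ip x (v p' q'))" for x
        unfolding g by (simp add: ip.sum_right ip.scale_right)
      have 2: "ip g x = (\<Sum>p<m. \<Sum>q<m. b p q * ip (v p q) x)" for x
        unfolding g by (simp add: ip.sum_left ip.scale_left)
      show ?thesis unfolding 2[of g] unfolding 1 by (simp add: sum_distrib_left mult.assoc)
    qed
    finally show ?thesis .
  qed
  have "(nrm (conv_op n u c g))\<^sup>2 \<le> Re (ip g g) * Re (ip ?z ?z)"
    unfolding nrm_square w iso[symmetric]
    by (rule ip.tensor_Cauchy_Schwarz) (simp_all add: A_def)
  also have "\<dots> = (nrm ?z * nrm g)\<^sup>2" by (simp add: power_mult_distrib nrm_square mult.commute)
  finally show ?thesis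
    by (rule power2_le_imp_le) (simp add: nrm_nonneg)
qed

text \<open>The product of the adjoint of an operator with the operator itself is the convolution with
  an element h that is self-adjoint, so that the previous bound applies with h on both sides.\<close>

lemma adjoint_product_bound:
  assumes u: "unitary_corep star n u"
  shows "nrm (conv_op n u (\<lambda>i j. cnj (a j i)) (conv_op n u a g)) \<le>
    nrm (conv_op n u (\<lambda>i j. cnj (a j i)) (elt n u a)) * nrm g"
proof -
  define h where "h = conv_op n u (\<lambda>i j. cnj (a j i)) (elt n u a)"
  \<comment> \<open>Two coefficient matrices of the same \<open>h\<close>: \<open>c\<close> from the
    definition of \<open>conv_coeff\<close>, \<open>d\<close> from \<open>strong_invariance\<close>.
    They are conjugate transposes of each other, which is self-adjointness of \<open>h\<close>; as
    entries of \<open>u\<close> may be dependent, they need not coincide.\<close>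
  define c where "c k j = (\<Sum>i<n. \<Sum>p<n. \<Sum>q<n. cnj (a j i) * a p q * ip (u p q) (u k i))" for k j
  define d where "d p r = (\<Sum>q<n. \<Sum>j<n. \<Sum>i<n. cnj (a j i) * a p q * ip (u r q) (u j i))" for p r
  have dc: "d = (\<lambda>k j. cnj (c j k))"
  proof (intro ext)
    fix k j
    have "cnj (ip x y) = ip y x" for x y using ip.herm[of x y] by simp
    then show "d k j = cnj (c j k)"
      unfolding d_def c_def by (simp add: mult_ac)
  qed
  \<comment> \<open>\<open>F\<close> is \<open>u\<close> when \<open>h\<close> is computed and
    \<open>conv_coeff n u g\<close> when the operator is.\<close>
  have rearrange: "(\<Sum>i<n. \<Sum>j<n. cnj (a j i) *\<^sub>C (\<Sum>p<n. \<Sum>q<n. a p q *\<^sub>C (\<Sum>r<n. ip (u r q) (u j i) *\<^sub>C F p r))) =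
      (\<Sum>p<n. \<Sum>r<n. d p r *\<^sub>C F p r)" for F :: "nat \<Rightarrow> nat \<Rightarrow> 'h"
    by (simp add: d_def cv.scale_sum_left cv.scale_sum_right mult.assoc sum.cartesian_product case_prod_beta)
      (rule sum.reindex_bij_witness[of _ "\<lambda>(p, r, q, j, i). (i, j, p, q, r)" "\<lambda>(i, j, p, q, r). (p, r, q, j, i)"], auto)
  have hd: "h = elt n u d"
  proof -
    have "h = (\<Sum>i<n. \<Sum>j<n. cnj (a j i) *\<^sub>C (\<Sum>p<n. \<Sum>q<n. a p q *\<^sub>C (\<Sum>r<n. ip (u r q) (u j i) *\<^sub>C u p r)))"
      unfolding h_def conv_op_def elt_def clinear_sum[OF conv_coeff_linear] clinear_scale[OF conv_coeff_linear]
      by (intro sum.cong refl arg_cong2[of _ _ _ _ scaleC]) (simp add: conv_coeff_unitary[OF u u])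
    then show ?thesis unfolding rearrange elt_def .
  qed
  have hc: "h = elt n u c"
  proof -
    have "h = (\<Sum>i<n. \<Sum>j<n. cnj (a j i) *\<^sub>C (\<Sum>p<n. \<Sum>q<n. a p q *\<^sub>C (\<Sum>k<n. ip (u p q) (u k i) *\<^sub>C u k j)))"
      unfolding h_def conv_op_def elt_def clinear_sum[OF conv_coeff_linear] clinear_scale[OF conv_coeff_linear]
      unfolding conv_coeff_def ..
    also have "\<dots> = (\<Sum>k<n. \<Sum>j<n. c k j *\<^sub>C u k j)"
      by (simp add: c_def cv.scale_sum_left cv.scale_sum_right mult.assoc sum.cartesian_product case_prod_beta)
        (rule sum.reindex_bij_witness[of _ "\<lambda>(k, j, i, p, q). (i, j, p, q, k)" "\<lambda>(i, j, p, q, k). (k, j, i, p, q)"], auto)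
    finally show ?thesis unfolding elt_def .
  qed
  have "conv_op n u (\<lambda>i j. cnj (a j i)) (conv_op n u a g) = conv_op n u d g"
  proof -
    have "conv_op n u (\<lambda>i j. cnj (a j i)) (conv_op n u a g) =
      (\<Sum>i<n. \<Sum>j<n. cnj (a j i) *\<^sub>C (\<Sum>p<n. \<Sum>q<n. a p q *\<^sub>C (\<Sum>r<n. ip (u r q) (u j i) *\<^sub>C conv_coeff n u g p r)))"
      unfolding conv_op_def clinear_sum[OF conv_coeff_linear] clinear_scale[OF conv_coeff_linear]
      by (intro sum.cong refl arg_cong2[of _ _ _ _ scaleC]) (simp add: conv_coeff_conv_coeff[OF u])
    then show ?thesis unfolding rearrange conv_op_def .
  qed
  \<comment> \<open>Passing through the element \<open>h\<close> replaces \<open>d\<close> by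
    \<open>c\<close>; the bound for \<open>c\<close> involves its conjugate transpose
    \<open>d\<close>, which is \<open>h\<close> again.\<close>
  also have "\<dots> = convolution \<Delta> S \<phi> h g" unfolding hd by (rule convolution_elt[OF u, symmetric])
  also have "\<dots> = conv_op n u c g" unfolding hc by (rule convolution_elt[OF u])
  also have "nrm \<dots> \<le> nrm h * nrm g"
    using convolution_bound[OF u, of c g] by (simp add: hd dc)
  finally show ?thesis by (simp add: h_def)
qed

lemma convolution_le:
  "nrm (convolution \<Delta> S \<phi> f g) \<le> nrm f * nrm g"
proof -
  obtain n u a where u: "unitary_corep star n u" and "f = (\<Sum>i<n. \<Sum>j<n. a i j *\<^sub>C u i j)"
    by (rule exists_unitary_corep)
  then have f: "f = elt n u a" by (simp add: elt_def)
  define R where "R = conv_op n u a"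
  define R' where "R' = conv_op n u (\<lambda>i j. cnj (a j i))"
  have adj: "ip (R x) y = ip x (R' y)" "ip (R' x) y = ip x (R y)" for x y
    unfolding R_def R'_def conv_op_adjoint by simp_all
  \<comment> \<open>The bounds of \<open>R\<close>; the infimum \<open>N\<close> is its operator
    norm. \<open>K\<close> is nonempty by the bound with the norm of the conjugate transposed
    element.\<close>
  define K where "K = {k. 0 \<le> k \<and> (\<forall>x. nrm (R x) \<le> k * nrm x)}"
  have "nrm (elt n u (\<lambda>i j. cnj (a j i))) \<in> K"
    unfolding K_def R_def using convolution_bound[OF u] nrm_nonneg by blast
  then have ne: "K \<noteq> {}" by blast
  have bdd: "bdd_below K" unfolding K_def by (rule bdd_belowI[of _ 0]) auto
  define N where "N = Inf K"
  have N0: "0 \<le> N" unfolding N_def using ne by (rule cInf_greatest) (simp add: K_def)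
  have NK: "nrm (R x) \<le> N * nrm x" for x
  proof (cases "nrm x = 0")
    case True
    \<comment> \<open>Any bound in \<open>K\<close> forces \<open>R x\<close> to be null when
      \<open>x\<close> is.\<close>
    obtain k where "k \<in> K" using ne by blast
    then have "nrm (R x) \<le> k * nrm x" unfolding K_def by blast
    then show ?thesis using True by simp
  next
    case False
    then have pos: "0 < nrm x" using nrm_nonneg[of x] by simp
    have "nrm (R x) / nrm x \<le> N"
      unfolding N_def
    proof (rule cInf_greatest[OF ne])
      fix k assume "k \<in> K"
      then have "nrm (R x) \<le> k * nrm x" unfolding K_def by blast
      then show "nrm (R x) / nrm x \<le> k" using pos by (subst pos_divide_le_eq)
    qed
    then show ?thesis using pos by (simp add: pos_divide_le_eq)
  qed
  have R'_bound: "nrm (R' x) \<le> N * nrm x" for x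
  proof -
    have "nrm (R' x) * nrm (R' x) = Re (ip x (R (R' x)))"
      using nrm_square[of "R' x"] by (simp add: power2_eq_square adj)
    also have "\<dots> \<le> nrm x * nrm (R (R' x))" by (rule ip_le_nrm)
    also have "\<dots> \<le> nrm x * (N * nrm (R' x))" using NK nrm_nonneg by (intro mult_left_mono)
    finally have "nrm (R' x) * nrm (R' x) \<le> (N * nrm x) * nrm (R' x)" by (simp add: mult_ac)
    then show ?thesis
      using nrm_nonneg[of "R' x"] N0 nrm_nonneg[of x]
      by (cases "nrm (R' x) = 0") (simp_all add: mult_le_cancel_right)
  qed
  \<comment> \<open>One factor \<open>N\<close> is traded for the norm of \<open>f\<close>:
    \<open>R' (R x)\<close> is controlled by \<open>R' f\<close>, and \<open>R'\<close> has bound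
    \<open>N\<close> too. Minimality of \<open>N\<close> then limits \<open>N\<close>
    itself.\<close>
  have "sqrt (N * nrm f) \<in> K"
    unfolding K_def
  proof (intro CollectI conjI allI)
    show "0 \<le> sqrt (N * nrm f)" using N0 nrm_nonneg by simp
    fix x
    have "(nrm (R x))\<^sup>2 = Re (ip x (R' (R x)))" by (simp add: nrm_square adj)
    also have "\<dots> \<le> nrm x * nrm (R' (R x))" by (rule ip_le_nrm)
    also have "\<dots> \<le> nrm x * (nrm (R' f) * nrm x)"
      using adjoint_product_bound[OF u, of a x] nrm_nonneg
      by (intro mult_left_mono) (simp_all add: R_def R'_def f)
    also have "\<dots> \<le> nrm x * (N * nrm f * nrm x)"
      using R'_bound nrm_nonneg by (intro mult_left_mono mult_right_mono)
    also have "\<dots> = (sqrt (N * nrm f) * nrm x)\<^sup>2"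
      using N0 nrm_nonneg by (simp add: power_mult_distrib power2_eq_square)
    finally show "nrm (R x) \<le> sqrt (N * nrm f) * nrm x"
      by (rule power2_le_imp_le) (simp add: N0 nrm_nonneg)
  qed
  then have "N \<le> sqrt (N * nrm f)" unfolding N_def using bdd by (rule cInf_lower)
  then have "N\<^sup>2 \<le> (sqrt (N * nrm f))\<^sup>2" using N0 by (rule power_mono)
  then have "N * N \<le> N * nrm f" using N0 nrm_nonneg by (simp add: power2_eq_square)
  then have "N \<le> nrm f" using N0 nrm_nonneg by (cases "N = 0") (simp_all add: mult_le_cancel_left)
  then have "nrm (R g) \<le> nrm f * nrm g"
    using NK[of g] nrm_nonneg[of g] by (meson mult_right_mono order_trans)
  then show ?thesis by (simp add: R_def f convolution_elt[OF u])
qed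

end

theorem lemma3p2:
  fixes \<Delta> :: "'h::complex_algebra_1 \<Rightarrow> ('h, 'h) tensor"
    and \<epsilon> :: "'h \<Rightarrow> complex"
    and S star :: "'h \<Rightarrow> 'h"
    and \<phi> :: "'h \<Rightarrow> complex"
  assumes "compact_hopf_star_algebra \<Delta> \<epsilon> S star"
    and "hopf_integral \<Delta> \<phi>"
    and "\<phi> 1 = 1"
  shows "\<forall>f g. L2_norm star \<phi> (convolution \<Delta> S \<phi> f g) \<le> L2_norm star \<phi> f * L2_norm star \<phi> g"
proof (intro allI)
  fix f g :: 'h
  interpret compact_hopf_integral \<Delta> \<epsilon> S star \<phi>
    by (intro compact_hopf_integral.intro compact_hopf_integral_axioms.intro assms)
  show "L2_norm star \<phi> (convolution \<Delta> S \<phi> f g) \<le> L2_norm star \<phi> f * L2_norm star \<phi> g"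
    using convolution_le[of f g] by (simp only: nrm_def ip_def L2_norm_def)
qed

end
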